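(* Let $d\ge2$ and let $X$ be an affine process on $S_d^+$ with transition function $p_t(x,d\xi)$, whose generator (on rapidly decreasing functions supported on $S_d^+$) is \[ \mathcal Af(x)=2\langle\nabla \alpha\nabla f(x),x\rangle+ \langle \nabla f(x), b+B(x)\rangle- (c+\langle \gamma,x\rangle)f(x)+\int_{S_d^+ \setminus\{0\}} \left(f(x+\xi)-f(x)\right)\big(m(d\xi)+\langle \mu(d\xi), x\rangle\big) \] for an admissible parameter set $(\alpha,b,B,c,\gamma,m,\mu)$, and suppose $\alpha$ is either invertible or zero. Then there exist functions $\phi:\mathbb R_+\times(S_d^++iS_d)\to\mathbb R_++i\mathbb R$ and $\psi:\mathbb R_+\times(S_d^++iS_d)\to S_d^++iS_d$ such that for each $u\in S_d^++iS_d$, $t\mapsto(\phi(t,u),\psi(t,u))$ is a (not necessarily unique) global solution on $[0,\infty)$ of \begin{align*} \partial_t\phi(t,u)&=\langle b,\psi(t,u)\rangle + c-\int_{S_d^+\setminus\{0\}}\left(e^{-\langle \psi(t,u),\xi\rangle}-1\right)m(d\xi),\\ \partial_t\psi(t,u)&=-2\psi(t,u)\alpha\psi(t,u)+B^\top(\psi(t,u))+\gamma-\int_{S_d^+\setminus\{0\}}\left(e^{-\langle \psi(t,u),\xi\rangle}-1\right)\mu(d\xi), \end{align*} with $\phi(0,u)=0$, $\psi(0,u)=u$, and for all $t\ge0$, $x\in S_d^+$, $u\in S_d^++iS_d$, \[ \int_{S_d^+}e^{-\langle u,\xi\rangle}p_t(x,d\xi)=e^{-\phi(t,u)-\langle\psi(t,u),x\rangle}.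 \]
   Context: $S_d$: real symmetric $d\times d$ matrices, $\langle x,y\rangle=\operatorname{tr}(xy)$ (extended complex-bilinearly to $S_d+iS_d$), norm $\|\cdot\|$; $S_d^+$ positive semidefinite matrices; $\preceq$ the order induced by $S_d^+$. $B^\top$ is the adjoint of $B$ w.r.t. $\langle\cdot,\cdot\rangle$ (extended complex-linearly). $\nabla$ is the gradient w.r.t. $\langle\cdot,\cdot\rangle$ viewed as a matrix of operators $(\nabla_{ij})$, and $\langle\nabla\alpha\nabla f(x),x\rangle=\sum_{i,j,k,l}x_{li}\alpha_{jk}\nabla_{ij}\nabla_{kl}f(x)$. An affine process on $S_d^+$ is a stochastically continuous time-homogeneous (sub-)Markov process with transition function $p_t(x,d\xi)$ such that $\int e^{-\langle u,\xi\rangle}p_t(x,d\xi)=e^{-\phi(t,u)-\langle\psi(t,u),x\rangle}$ for all $t\ge0$, $u,x\in S_d^+$, for some $\phi:\mathbb R_+\times S_d^+\to\mathbb R_+$, $\psi:\mathbb R_+\times S_d^+\to S_d^+$. An admissible parameter set $(\alpha,b,B,c,\gamma,m,\mu)$: $\alpha\in S_d^+$; $b\in S_d^+$ with $b\succeq(d-1)\alpha$; $c\ge0$; $\gamma\in S_d^+$; a Borel measure $m$ on $S_d^+\setminus\{0\}$ with $\int(\|\xi\|\wedge1)m(d\xi)<\infty$; an $S_d^+$-valued sigma-finite measure $\mu$ on $S_d^+\setminus\{0\}$ (i.e. $\mu(E)\in S_d^+$ for Borel $E$ with closure in $S_d^+\setminus\{0\}$) with $\int(\|\xi\|\wedge1)\mu(d\xi)<\infty$;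 a linear $B:S_d\to S_d$ with $\langle B(x),u\rangle\ge0$ whenever $x,u\in S_d^+$, $\langle x,u\rangle=0$. *)

theory Defs
  imports "HOL-Analysis.Analysis"
begin

definition ip :: "real^'d^'d \<Rightarrow> real^'d^'d \<Rightarrow> real" where
  "ip x y = (\<Sum>i\<in>UNIV. \<Sum>j\<in>UNIV. x$i$j * y$j$i)"

definition cip :: "complex^'d^'d \<Rightarrow> real^'d^'d \<Rightarrow> complex" where
  "cip u x = (\<Sum>i\<in>UNIV. \<Sum>j\<in>UNIV. u$i$j * complex_of_real (x$j$i))"

definition Sd :: "(real^'d^'d) set" where
  "Sd = {x. transpose x = x}"

definition Sdp :: "(real^'d^'d) set" where
  "Sdp = {x \<in> Sd. \<forall>v. 0 \<le> v \<bullet> (x *v v)}"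

definition psd_le :: "real^'d^'d \<Rightarrow> real^'d^'d \<Rightarrow> bool" where
  "psd_le x y \<longleftrightarrow> y - x \<in> Sdp"

definition re_mat :: "complex^'d^'d \<Rightarrow> real^'d^'d" where
  "re_mat u = (\<chi> i j. Re (u$i$j))"

definition im_mat :: "complex^'d^'d \<Rightarrow> real^'d^'d" where
  "im_mat u = (\<chi> i j. Im (u$i$j))"

definition cmat :: "real^'d^'d \<Rightarrow> complex^'d^'d" where
  "cmat x = (\<chi> i j. complex_of_real (x$i$j))"

definition CSdp :: "(complex^'d^'d) set" where
  "CSdp = {u. re_mat u \<in> Sdp \<and> im_mat u \<in> Sd}"

definition Esym :: "'d \<Rightarrow> 'd \<Rightarrow> real^'d^'d" where
  "Esym i j = (\<chi> k l. ((if k = i \<and> l = j then 1 else 0) + (if k = j \<and> l = i then 1 else 0)) / 2)"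

definition Ediag :: "'d \<Rightarrow> real^'d^'d" where
  "Ediag k = (\<chi> i j. if i = k \<and> j = k then 1 else 0)"

definition Epair :: "'d \<Rightarrow> 'd \<Rightarrow> real^'d^'d" where
  "Epair k l = (\<chi> i j. (if i = k \<or> i = l then 1 else 0) * (if j = k \<or> j = l then 1 else 0))"

definition dirder :: "real^'d^'d \<Rightarrow> (real^'d^'d \<Rightarrow> real) \<Rightarrow> real^'d^'d \<Rightarrow> real" where
  "dirder v f x = deriv (\<lambda>s. f (x + s *\<^sub>R v)) 0"

fun iter_dirder :: "(real^'d^'d) list \<Rightarrow> (real^'d^'d \<Rightarrow> real) \<Rightarrow> real^'d^'d \<Rightarrow> real" where
  "iter_dirder [] f = f"
| "iter_dirder (v # vs) f = dirder v (iter_dirder vs f)"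

text \<open>Schwartz (rapidly decreasing C^\<infinity>) functions on the matrix space; their restrictions
to S_d^+ form the class of rapidly decreasing functions on S_d^+.\<close>
definition rapidly_decreasing :: "(real^'d^'d \<Rightarrow> real) \<Rightarrow> bool" where
  "rapidly_decreasing f \<longleftrightarrow>
     (\<forall>vs. (\<forall>x. iter_dirder vs f differentiable (at x)) \<and>
           (\<forall>k::nat. bounded (range (\<lambda>x. (1 + norm x) ^ k * iter_dirder vs f x))))"

text \<open>gradient w.r.t. the trace inner product on S_d (a symmetric matrix); entry (i,j) is
the operator nabla_ij\<close>
definition nabla :: "'d \<Rightarrow> 'd \<Rightarrow> (real^'d^'d \<Rightarrow> real) \<Rightarrow> real^'d^'d \<Rightarrow> real" where
  "nabla i j f x = dirder (Esym i j) f x"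

definition grad :: "(real^'d^'d \<Rightarrow> real) \<Rightarrow> real^'d^'d \<Rightarrow> real^'d^'d" where
  "grad f x = (\<chi> i j. nabla i j f x)"

text \<open>An S_d^+-valued measure mu is given as a set function on Borel sets with closure
in S_d^+ minus 0.  For x in S_d^+, mu_pair mu x is the (positive) measure
E \<mapsto> <mu(E), x> on S_d^+ minus 0, obtained by exhausting with the sets {norm \<ge> 1/(n+1)}.\<close>
definition mu_pair :: "((real^'d^'d) set \<Rightarrow> real^'d^'d) \<Rightarrow> real^'d^'d \<Rightarrow> (real^'d^'d) measure" where
  "mu_pair \<mu> x = measure_of UNIV (sets borel)
     (\<lambda>E. SUP n::nat. ennreal (ip (\<mu> (E \<inter> Sdp \<inter> {\<xi>. 1 / real (Suc n) \<le> norm \<xi>})) x))"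

text \<open>matrix-valued integral of a complex function w.r.t. mu, entrywise:
mu_kk = <mu, E_kk>, mu_kl = (<mu, P_kl> - mu_kk - mu_ll)/2\<close>
definition mat_integral :: "((real^'d^'d) set \<Rightarrow> real^'d^'d) \<Rightarrow> (real^'d^'d \<Rightarrow> complex) \<Rightarrow> complex^'d^'d" where
  "mat_integral \<mu> g = (\<chi> k l.
     if k = l then integral\<^sup>L (mu_pair \<mu> (Ediag k)) g
     else (integral\<^sup>L (mu_pair \<mu> (Epair k l)) g - integral\<^sup>L (mu_pair \<mu> (Ediag k)) g
           - integral\<^sup>L (mu_pair \<mu> (Ediag l)) g) / 2)"

text \<open>adjoint of B on S_d w.r.t. the trace pairing, extended complex-linearly:
(B^T u)_kl = <B((E_kl+E_lk)/2), u>\<close>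
definition adj_c :: "(real^'d^'d \<Rightarrow> real^'d^'d) \<Rightarrow> complex^'d^'d \<Rightarrow> complex^'d^'d" where
  "adj_c B u = (\<chi> k l. \<Sum>i\<in>UNIV. \<Sum>j\<in>UNIV. complex_of_real ((B (Esym k l))$i$j) * u$j$i)"

definition admissible ::
  "real^'d^'d \<Rightarrow> real^'d^'d \<Rightarrow> (real^'d^'d \<Rightarrow> real^'d^'d) \<Rightarrow> real \<Rightarrow> real^'d^'d
   \<Rightarrow> (real^'d^'d) measure \<Rightarrow> ((real^'d^'d) set \<Rightarrow> real^'d^'d) \<Rightarrow> bool" where
  "admissible \<alpha> b B c \<gamma> m \<mu> \<longleftrightarrow>
     \<alpha> \<in> Sdp \<and>
     b \<in> Sdp \<and> psd_le ((real CARD('d) - 1) *\<^sub>R \<alpha>) b \<and>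
     c \<ge> 0 \<and>
     \<gamma> \<in> Sdp \<and>
     sets m = sets borel \<and> emeasure m (UNIV - (Sdp - {0})) = 0 \<and>
     (\<integral>\<^sup>+ \<xi>. ennreal (min (norm \<xi>) 1) \<partial>m) < \<infinity> \<and>
     (\<forall>E \<in> sets borel. closure E \<subseteq> Sdp - {0} \<longrightarrow> \<mu> E \<in> Sdp) \<and>
     (\<forall>A::nat \<Rightarrow> (real^'d^'d) set. (\<forall>n. A n \<in> sets borel) \<longrightarrow> disjoint_family A \<longrightarrow>
         closure (\<Union>n. A n) \<subseteq> Sdp - {0} \<longrightarrow> (\<lambda>n. \<mu> (A n)) sums \<mu> (\<Union>n. A n)) \<and>
     (\<forall>x\<in>Sdp. (\<integral>\<^sup>+ \<xi>. ennreal (min (norm \<xi>) 1) \<partial>(mu_pair \<mu> x)) < \<infinity>) \<and>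
     (\<forall>x\<in>Sd. B x \<in> Sd) \<and>
     (\<forall>x\<in>Sd. \<forall>y\<in>Sd. \<forall>r::real. B (x + y) = B x + B y \<and> B (r *\<^sub>R x) = r *\<^sub>R B x) \<and>
     (\<forall>x\<in>Sdp. \<forall>u\<in>Sdp. ip x u = 0 \<longrightarrow> ip (B x) u \<ge> 0)"

definition affine_transition :: "(real \<Rightarrow> real^'d^'d \<Rightarrow> (real^'d^'d) measure) \<Rightarrow> bool" where
  "affine_transition p \<longleftrightarrow>
     \<comment> \<open>sub-Markov kernels on S_d^+\<close>
     (\<forall>t\<ge>0. \<forall>x\<in>Sdp. sets (p t x) = sets borel \<and> emeasure (p t x) UNIV \<le> 1 \<and>
                       emeasure (p t x) (UNIV - Sdp) = 0) \<and>
     (\<forall>t\<ge>0. \<forall>A\<in>sets borel. (\<lambda>x. emeasure (p t x) A) \<in> borel_measurable (restrict_space borel Sdp)) \<and>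
     (\<forall>x\<in>Sdp. \<forall>A\<in>sets borel. emeasure (p 0 x) A = indicator A x) \<and>
     \<comment> \<open>Chapman--Kolmogorov (time-homogeneous Markov property)\<close>
     (\<forall>s\<ge>0. \<forall>t\<ge>0. \<forall>x\<in>Sdp. \<forall>A\<in>sets borel.
         emeasure (p (s + t) x) A = (\<integral>\<^sup>+ y. emeasure (p t y) A * indicator Sdp y \<partial>(p s x))) \<and>
     \<comment> \<open>stochastic continuity: weak continuity in t on S_d^+\<close>
     (\<forall>x\<in>Sdp. \<forall>s\<ge>0. \<forall>f::real^'d^'d \<Rightarrow> real. continuous_on Sdp f \<longrightarrow> bounded (f ` Sdp) \<longrightarrow>
         ((\<lambda>t. set_lebesgue_integral (p t x) Sdp f) \<longlongrightarrow> set_lebesgue_integral (p s x) Sdp f)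
           (at s within {0..})) \<and>
     \<comment> \<open>affine property\<close>
     (\<exists>\<phi> :: real \<Rightarrow> real^'d^'d \<Rightarrow> real. \<exists>\<psi> :: real \<Rightarrow> real^'d^'d \<Rightarrow> real^'d^'d.
        (\<forall>t\<ge>0. \<forall>u\<in>Sdp. \<phi> t u \<ge> 0 \<and> \<psi> t u \<in> Sdp) \<and>
        (\<forall>t\<ge>0. \<forall>x\<in>Sdp. \<forall>u\<in>Sdp.
           set_lebesgue_integral (p t x) Sdp (\<lambda>\<xi>. exp (- ip u \<xi>)) = exp (- \<phi> t u - ip (\<psi> t u) x)))"

definition gen_A ::
  "real^'d^'d \<Rightarrow> real^'d^'d \<Rightarrow> (real^'d^'d \<Rightarrow> real^'d^'d) \<Rightarrow> real \<Rightarrow> real^'d^'d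
   \<Rightarrow> (real^'d^'d) measure \<Rightarrow> ((real^'d^'d) set \<Rightarrow> real^'d^'d)
   \<Rightarrow> (real^'d^'d \<Rightarrow> real) \<Rightarrow> real^'d^'d \<Rightarrow> real" where
  "gen_A \<alpha> b B c \<gamma> m \<mu> f x =
     2 * (\<Sum>i\<in>UNIV. \<Sum>j\<in>UNIV. \<Sum>k\<in>UNIV. \<Sum>l\<in>UNIV. x$l$i * \<alpha>$j$k * nabla i j (nabla k l f) x)
     + ip (grad f x) (b + B x)
     - (c + ip \<gamma> x) * f x
     + set_lebesgue_integral m (Sdp - {0}) (\<lambda>\<xi>. f (x + \<xi>) - f x)
     + set_lebesgue_integral (mu_pair \<mu> x) (Sdp - {0}) (\<lambda>\<xi>. f (x + \<xi>) - f x)"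

definition has_generator :: "(real \<Rightarrow> real^'d^'d \<Rightarrow> (real^'d^'d) measure)
   \<Rightarrow> ((real^'d^'d \<Rightarrow> real) \<Rightarrow> real^'d^'d \<Rightarrow> real) \<Rightarrow> bool" where
  "has_generator p A \<longleftrightarrow>
     (\<forall>f. rapidly_decreasing f \<longrightarrow> (\<forall>x\<in>Sdp.
        ((\<lambda>t. (set_lebesgue_integral (p t x) Sdp f - f x) / t) \<longlongrightarrow> A f x) (at_right 0)))"

end

theory Submission
  imports Defs "HOL-Probability.Giry_Monad"
begin

text \<open>
  Write \<open>g t x u\<close> for the Fourier-Laplace transform of \<open>p t x\<close>. Since real Laplace transforms are
  uniformly dense (Stone-Weierstrass), \<open>g t (x + y) u * g t 0 u = g t x u * g t y u\<close> extends from real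
  to complex \<open>u\<close>; hence, wherever \<open>g t 0 u \<noteq> 0\<close>, the quotient \<open>g t x u / g t 0 u\<close> is a character
  \<open>exp (- cip (\<psi> t u) x)\<close> of the cone. If \<open>re_mat u\<close> is positive definite, then so is the real part
  of \<open>\<psi> t u\<close>, the generator may be applied to \<open>exp (- cip (\<psi> t u) x)\<close>, and together with the
  Chapman-Kolmogorov equation it gives the right derivative of \<open>g t x u\<close> in \<open>t\<close>; integrating, the
  Riccati equations hold up to the first zero of \<open>g t 0 u\<close>. For invertible \<open>\<alpha>\<close> the norm
  \<open>tr (\<alpha> v \<alpha> v) + tr (\<alpha> w \<alpha> w)\<close> of \<open>v + \<i> w\<close> grows at most exponentially along solutions, because
  the quadratic term points inwards, and for \<open>\<alpha> = 0\<close> the vector field has linear growth. So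
  there is no explosion, hence no zero. These bounds are uniform, so singular \<open>re_mat u\<close> are reached as
  limits of \<open>u + I / n\<close> in the integrated equations.
\<close>

section \<open>Positive semidefinite matrices\<close>

text \<open>The hypothesis fixes only real Laplace transforms, and a complex transform may vanish a
  priori, so no continuous logarithm of \<open>g\<close> is at hand. Exponents are therefore
  identified along whole rays: the values \<open>exp (- (s *\<^sub>R a))\<close> for all
  \<open>s\<close> determine \<open>a\<close> without an ambiguity of 2 pi i. The field
  \<open>R\<close> is continuous on \<open>CSdp\<close>, but in general not Lipschitz at its
  boundary, since large jumps need not have a first moment. The solution is therefore read off from
  the process, and no existence or uniqueness theorem for differential equations is invoked. The
  generator is known on Schwartz functions of the full matrix space, while
  \<open>exp (- cip u y)\<close> may grow outside the cone. A Gaussian factor centred at the point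
  of evaluation repairs this, and positive definiteness of \<open>re_mat u\<close> makes its removal
  uniform in time. That is why the real part of \<open>\<psi> t u\<close> has to stay positive
  definite, which is derived from the real exponent \<open>\<psi>0\<close>. Only right derivatives
  come out; continuity in time turns them into integral equations.\<close>

definition outer :: "real^'d \<Rightarrow> real^'d^'d" where
  "outer v = (\<chi> i j. v$i * v$j)"

text \<open>Positive definiteness with an explicit spectral lower bound \<delta>, the form in which
  it yields coercivity on the cone.\<close>

definition Spp :: "(real^'d^'d) set" where
  "Spp = {x \<in> Sd. \<exists>\<delta>>0. \<forall>v. \<delta> * (v \<bullet> v) \<le> v \<bullet> (x *v v)}"

text \<open>The pairing is the Euclidean inner product with one argument transposed, so boundedness
  is inherited from there.\<close>

lemma bilinear_ip: "bounded_bilinear (ip :: real^'d^'d \<Rightarrow> _)"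
proof -
  have "bounded_bilinear (\<lambda>x y :: real^'d^'d. x \<bullet> transpose y)"
  proof (rule bounded_bilinear.comp[OF bounded_bilinear_inner bounded_linear_ident])
    show "bounded_linear (transpose :: real^'d^'d \<Rightarrow> real^'d^'d)"
      by (intro linear_conv_bounded_linear[THEN iffD1] linearI) (simp_all add: transpose_def vec_eq_iff)
  qed
  moreover have "(\<lambda>x y :: real^'d^'d. x \<bullet> transpose y) = ip"
    by (simp add: inner_vec_def ip_def transpose_def fun_eq_iff)
  ultimately show ?thesis by simp
qed

interpretation ip: bounded_bilinear ip by (rule bilinear_ip)

lemma ip_commute: "ip x y = ip y x"
  unfolding ip_def by (subst sum.swap) (simp add: mult.commute)

lemma ip_eq_inner: "y \<in> Sd \<Longrightarrow> ip x y = x \<bullet> y"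
proof -
  assume "y \<in> Sd"
  then have "transpose y = y" by (simp add: Sd_def)
  then have "y$j$i = y$i$j" for i j by (metis transpose_def vec_lambda_beta)
  then show ?thesis by (simp add: ip_def inner_vec_def)
qed

lemma Sd_iff: "x \<in> Sd \<longleftrightarrow> (\<forall>i j. x$i$j = x$j$i)"
  by (auto simp: Sd_def transpose_def vec_eq_iff)

lemma subspace_Sd: "subspace Sd"
  by (auto simp: subspace_def Sd_iff)

lemma Sdp_Sd: "x \<in> Sdp \<Longrightarrow> x \<in> Sd"
  by (simp add: Sdp_def)

lemma outer_Sd: "outer v \<in> Sd"
  by (simp add: Sd_iff outer_def)

lemma ip_outer: "ip x (outer v) = v \<bullet> (x *v v)"
  by (simp add: ip_def outer_def inner_vec_def matrix_vector_mult_def sum_distrib_left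
      algebra_simps)

lemma ip_outer_outer: "ip (outer w) (outer v) = (v \<bullet> w)^2"
  by (simp add: ip_def outer_def inner_vec_def power2_eq_square sum_product algebra_simps)

lemma outer_Sdp: "outer v \<in> Sdp"
  unfolding Sdp_def by (auto simp: outer_Sd ip_outer[symmetric] ip_outer_outer)

lemma Sdp_iff: "x \<in> Sdp \<longleftrightarrow> x \<in> Sd \<and> (\<forall>v. 0 \<le> ip x (outer v))"
  by (simp add: Sdp_def ip_outer)

lemma norm_outer: "norm (outer v) = v \<bullet> v"
proof -
  have "(norm (outer v))^2 = (v \<bullet> v)^2"
    by (simp add: power2_norm_eq_inner ip_eq_inner[OF outer_Sd, symmetric] ip_outer_outer)
  then show ?thesis by (simp add: power2_eq_iff_nonneg)
qed

lemma zero_Sdp [simp]: "0 \<in> Sdp"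
  by (simp add: Sdp_def Sd_iff)

lemma Sdp_add: "x \<in> Sdp \<Longrightarrow> y \<in> Sdp \<Longrightarrow> x + y \<in> Sdp"
  by (auto simp: Sdp_iff ip.add_left intro: subspace_add[OF subspace_Sd])

lemma Sdp_scaleR: "x \<in> Sdp \<Longrightarrow> 0 \<le> r \<Longrightarrow> r *\<^sub>R x \<in> Sdp"
  by (auto simp: Sdp_iff ip.scaleR_left intro: subspace_scale[OF subspace_Sd])

lemma closed_Sdp: "closed (Sdp :: (real^'d^'d) set)"
proof -
  have "(Sdp :: (real^'d^'d) set) = (\<Inter>i. \<Inter>j. {x. x$i$j = x$j$i}) \<inter> (\<Inter>v. {x. 0 \<le> ip x (outer v)})"
    by (auto simp: Sdp_iff Sd_iff)
  also have "closed \<dots>"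
    by (intro closed_Int closed_INT ballI closed_Collect_eq closed_Collect_le
        continuous_intros ip.continuous_on)
  finally show ?thesis .
qed

lemma Sdp_borel [measurable]: "Sdp \<in> sets borel"
  by (rule borel_closed[OF closed_Sdp])

section \<open>Quadratic forms and decomposition into rank-one matrices\<close>

lemma axis_quadratic: "(axis i 1 :: real^'d) \<bullet> (x *v axis j 1) = x$i$j"
  by (simp add: inner_axis' matrix_vector_mult_basis column_def)

lemma axis_combo_quadratic:
  fixes x :: "real^'d^'d"
  assumes "x \<in> Sd"
  shows "(a *\<^sub>R axis i 1 + b *\<^sub>R axis j 1) \<bullet> (x *v (a *\<^sub>R axis i 1 + b *\<^sub>R axis j 1))
    = a^2 * x$i$i + 2 * a * b * x$i$j + b^2 * x$j$j"
proof -
  have "x$j$i = x$i$j" using assms by (simp add: Sd_iff)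
  then show ?thesis
    by (simp add: matrix_vector_right_distrib matrix_vector_mult_scaleR inner_add_left inner_add_right
        axis_quadratic power2_eq_square algebra_simps)
qed

lemma Sdp_diag_nonneg: "x \<in> Sdp \<Longrightarrow> 0 \<le> x$k$k"
  by (metis (mono_tags, lifting) Sdp_def mem_Collect_eq axis_quadratic)

text \<open>With \<open>x$k$k = 0\<close> the form at \<open>axis i 1 + b *\<^sub>R axis k 1\<close>
  is affine in \<open>b\<close>; being bounded below, it has slope zero.\<close>

lemma Sdp_zero_diag:
  fixes x :: "real^'d^'d"
  assumes x: "x \<in> Sdp" and "x$k$k = 0"
  shows "x$i$k = 0"
proof (rule ccontr)
  assume nz: "x$i$k \<noteq> 0"
  have ge: "0 \<le> a^2 * x$i$i + 2 * a * b * x$i$k + b^2 * x$k$k" for a b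
    using x axis_combo_quadratic[OF Sdp_Sd[OF x], of a i b k] by (metis (mono_tags, lifting) Sdp_def mem_Collect_eq)
  \<comment> \<open>This value of \<open>b\<close> turns the form into -1.\<close>
  from ge[of 1 "- (x$i$i + 1) / (2 * x$i$k)"] show False
    using nz assms(2) by (simp add: field_simps)
qed

text \<open>One Cholesky step: the form of \<open>x - outer v\<close> at \<open>w\<close> is the
  minimum of the form of \<open>x\<close> over the line through \<open>w\<close> in direction
  \<open>axis k 1\<close>, that is, the Schur complement of the entry \<open>x$k$k\<close>.\<close>

lemma Sdp_eliminate:
  fixes x :: "real^'d^'d"
  assumes x: "x \<in> Sdp" and pos: "x$k$k > 0"
  defines "v \<equiv> (1 / sqrt (x$k$k)) *\<^sub>R column k x"
  shows "x - outer v \<in> Sdp"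
proof -
  have sym: "x$i$j = x$j$i" for i j using Sdp_Sd[OF x] by (simp add: Sd_iff)
  have "x - outer v \<in> Sd" using Sdp_Sd[OF x] outer_Sd subspace_diff[OF subspace_Sd] by blast
  moreover have "0 \<le> ip (x - outer v) (outer w)" for w
  proof -
    \<comment> \<open>The minimiser of the form along that line.\<close>
    define c where "c = - (w \<bullet> column k x) / x$k$k"
    have a: "axis k 1 \<bullet> (x *v w) = w \<bullet> column k x"
      unfolding inner_axis' by (simp add: matrix_vector_mult_def inner_vec_def column_def sym[of k] mult.commute)
    have b: "w \<bullet> (x *v axis k 1) = w \<bullet> column k x"
      by (simp add: matrix_vector_mult_basis)
    have "0 \<le> (w + c *\<^sub>R axis k 1) \<bullet> (x *v (w + c *\<^sub>R axis k 1))"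
      using x by (auto simp: Sdp_def)
    also have "\<dots> = w \<bullet> (x *v w) + 2 * c * (w \<bullet> column k x) + c^2 * x$k$k"
      using a b by (simp add: matrix_vector_right_distrib matrix_vector_mult_scaleR inner_add_left
          inner_add_right axis_quadratic power2_eq_square algebra_simps)
    also have "\<dots> = w \<bullet> (x *v w) - (w \<bullet> column k x)^2 / x$k$k"
      using pos by (simp add: c_def power2_eq_square field_simps)
    also have "\<dots> = ip (x - outer v) (outer w)"
      using pos by (simp add: ip.diff_left ip_outer_outer v_def power_mult_distrib power_divide
          flip: ip_outer)
    finally show ?thesis .
  qed
  ultimately show ?thesis by (simp add: Sdp_iff)
qed

text \<open>\<open>K\<close> contains all columns that may be nonzero. A Cholesky step clears column
  \<open>k\<close> and, by symmetry, leaves the columns outside \<open>K\<close> zero.\<close>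

lemma Sdp_decompose_aux:
  fixes x :: "real^'d^'d"
  assumes "finite K" "x \<in> Sdp" "\<And>k i. k \<notin> K \<Longrightarrow> x$i$k = 0"
  shows "\<exists>ws. x = sum_list (map outer ws)"
  using assms
proof (induction K arbitrary: x rule: finite_induct)
  case empty
  then have "x = 0" by (simp add: vec_eq_iff)
  then show ?case by (intro exI[of _ "[]"]) auto
next
  case (insert k K)
  \<comment> \<open>If the diagonal entry vanishes, column \<open>k\<close> is already zero by
    \<open>Sdp_zero_diag\<close> and nothing is subtracted.\<close>
  define v where "v = (if x$k$k = 0 then 0 else (1 / sqrt (x$k$k)) *\<^sub>R column k x)"
  have pos: "x$k$k \<ge> 0" by (rule Sdp_diag_nonneg[OF insert.prems(1)])
  have sym: "x$i$j = x$j$i" for i j using Sdp_Sd[OF insert.prems(1)] by (simp add: Sd_iff)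
  have "x - outer v \<in> Sdp"
    using Sdp_eliminate[OF insert.prems(1), of k] pos insert.prems(1)
    by (auto simp: v_def outer_def zero_vec_def[symmetric])
  moreover have "(x - outer v)$i$j = 0" if "j \<notin> K" for i j
  proof (cases "j = k")
    case True
    then show ?thesis
      using Sdp_zero_diag[OF insert.prems(1), of k i] pos by (simp add: v_def outer_def column_def)
  next
    case False
    then have "x$i$j = 0" "x$k$j = 0" using insert.prems(2) that by auto
    then show ?thesis using sym[of j k] by (simp add: v_def outer_def column_def)
  qed
  ultimately obtain ws where ws: "x - outer v = sum_list (map outer ws)"
    using insert.IH by blast
  show ?case by (rule exI[of _ "v # ws"]) (simp add: ws[symmetric])
qed

lemma Sdp_decompose:
  assumes "x \<in> Sdp"
  obtains ws where "x = sum_list (map outer ws)"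
  using Sdp_decompose_aux[OF finite assms, of UNIV] by auto

text \<open>One half of the self-duality of the cone: after decomposing \<open>y\<close>, every
  summand is a value of the quadratic form of \<open>x\<close>.\<close>

lemma ip_Sdp_nonneg:
  assumes "x \<in> Sdp" "y \<in> Sdp"
  shows "0 \<le> ip x y"
proof -
  obtain ws where "y = sum_list (map outer ws)" using Sdp_decompose[OF assms(2)] .
  moreover have "0 \<le> ip x (sum_list (map outer ws))" for ws
    using assms(1) by (induction ws) (auto simp: ip.zero_right ip.add_right Sdp_iff)
  ultimately show ?thesis by simp
qed

text \<open>For a rank-one matrix norm and trace agree; the triangle inequality and additivity of
  the trace do the rest.\<close>

lemma norm_le_trace:
  assumes "x \<in> Sdp"
  shows "norm x \<le> ip (mat 1) x"
proof -
  obtain ws where "x = sum_list (map outer ws)" using Sdp_decompose[OF assms] .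
  moreover have "norm (sum_list (map outer ws)) \<le> ip (mat 1) (sum_list (map outer ws))" for ws :: "(real^'a) list"
  proof (induction ws)
    case (Cons w ws)
    have "norm (sum_list (map outer (w # ws))) \<le> norm (outer w) + norm (sum_list (map outer ws))"
      by (simp add: norm_triangle_ineq)
    also have "\<dots> \<le> ip (mat 1) (sum_list (map outer (w # ws)))"
      using Cons by (simp add: ip.add_right ip_outer norm_outer)
    finally show ?case .
  qed (simp add: ip.zero_right)
  ultimately show ?thesis by simp
qed

lemma mat_scaled_Sd: "mat r \<in> Sd"
  by (auto simp: Sd_iff mat_def)

lemma mat_Sdp: "0 \<le> r \<Longrightarrow> (mat r :: real^'d^'d) \<in> Sdp"
proof -
  assume "0 \<le> r"
  have "mat r *v v = r *\<^sub>R v" for v :: "real^'d"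
    by (simp add: matrix_vector_mult_def mat_def vec_eq_iff if_distrib if_distribR cong: if_cong)
  then show ?thesis using \<open>0 \<le> r\<close> by (simp add: Sdp_def mat_scaled_Sd)
qed

section \<open>Positive definite matrices as interior points of the cone\<close>

lemma Spp_iff:
  fixes x :: "real^'d^'d"
  shows "x \<in> Spp \<longleftrightarrow> x \<in> Sd \<and> (\<exists>\<delta>>0. x - \<delta> *\<^sub>R mat 1 \<in> Sdp)"
proof -
  have "x - \<delta> *\<^sub>R mat 1 \<in> Sd \<longleftrightarrow> x \<in> Sd" for \<delta>
    using subspace_add[OF subspace_Sd, of "x - \<delta> *\<^sub>R mat 1" "\<delta> *\<^sub>R mat 1"] subspace_diff[OF subspace_Sd]
      subspace_scale[OF subspace_Sd mat_scaled_Sd[of 1]] by auto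
  moreover have "ip (x - \<delta> *\<^sub>R mat 1) (outer v) = v \<bullet> (x *v v) - \<delta> * (v \<bullet> v)" for \<delta> v
    unfolding ip.diff_left ip.scaleR_left by (simp add: ip_outer)
  ultimately show ?thesis by (auto simp: Spp_def Sdp_iff)
qed

lemma Spp_Sdp: "x \<in> Spp \<Longrightarrow> x \<in> Sdp"
proof -
  assume "x \<in> Spp"
  then obtain \<delta> where "\<delta> > 0" "x - \<delta> *\<^sub>R mat 1 \<in> Sdp" by (auto simp: Spp_iff)
  then have "(x - \<delta> *\<^sub>R mat 1) + \<delta> *\<^sub>R mat 1 \<in> Sdp"
    by (intro Sdp_add Sdp_scaleR mat_Sdp) auto
  then show ?thesis by simp
qed

lemma Spp_Sdp_add: "x \<in> Spp \<Longrightarrow> y \<in> Sdp \<Longrightarrow> x + y \<in> Spp"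
proof -
  assume x: "x \<in> Spp" and y: "y \<in> Sdp"
  then obtain \<delta> where "\<delta> > 0" "x - \<delta> *\<^sub>R mat 1 \<in> Sdp" by (auto simp: Spp_iff)
  then have "x + y - \<delta> *\<^sub>R mat 1 \<in> Sdp" using y Sdp_add[of "x - \<delta> *\<^sub>R mat 1" y]
    by (simp add: algebra_simps)
  then show ?thesis using \<open>\<delta> > 0\<close> Sdp_Sd[OF Spp_Sdp[OF x]] Sdp_Sd[OF y] subspace_add[OF subspace_Sd]
    by (auto simp: Spp_iff)
qed

lemma mat_Spp: "0 < r \<Longrightarrow> mat r \<in> Spp"
proof -
  assume "0 < r"
  moreover have "mat r - r *\<^sub>R mat 1 = (0 :: real^'a^'a)"
    by (simp add: vec_eq_iff mat_def)
  ultimately show ?thesis using mat_scaled_Sd[of r] unfolding Spp_iff by (metis (no_types) diff_self zero_Sdp)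
qed

text \<open>Comparing \<open>u\<close> with a multiple of the identity reduces this to
  \<open>norm_le_trace\<close>. It is the source of the exponential decay of
  \<open>exp (- ip u x)\<close> on the cone.\<close>

lemma Spp_coercive:
  assumes "u \<in> Spp"
  obtains \<delta> where "\<delta> > 0" "\<And>x. x \<in> Sdp \<Longrightarrow> \<delta> * norm x \<le> ip u x"
proof -
  obtain \<delta> where \<delta>: "\<delta> > 0" "u - \<delta> *\<^sub>R mat 1 \<in> Sdp" using assms by (auto simp: Spp_iff)
  have "\<delta> * norm x \<le> ip u x" if "x \<in> Sdp" for x
  proof -
    have "0 \<le> ip (u - \<delta> *\<^sub>R mat 1) x" by (rule ip_Sdp_nonneg[OF \<delta>(2) that])
    then have "\<delta> * ip (mat 1) x \<le> ip u x" by (simp add: ip.diff_left ip.scaleR_left)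
    moreover have "\<delta> * norm x \<le> \<delta> * ip (mat 1) x"
      using \<delta>(1) norm_le_trace[OF that] by (intro mult_left_mono) auto
    ultimately show ?thesis by simp
  qed
  with \<delta>(1) show ?thesis by (rule that)
qed

text \<open>Coercivity on rank-one matrices absorbs any perturbation of norm at most
  \<delta>.\<close>

lemma Spp_perturb:
  assumes "u \<in> Spp" "w \<in> Sd"
  obtains s where "s > 0" "\<And>r. \<bar>r\<bar> \<le> s \<Longrightarrow> u + r *\<^sub>R w \<in> Sdp"
proof -
  obtain \<delta> where \<delta>: "\<delta> > 0" "\<And>x. x \<in> Sdp \<Longrightarrow> \<delta> * norm x \<le> ip u x" using Spp_coercive[OF assms(1)] by blast
  \<comment> \<open>The summand 1 in the denominator covers \<open>w = 0\<close>.\<close>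
  have "u + r *\<^sub>R w \<in> Sdp" if r: "\<bar>r\<bar> \<le> \<delta> / (norm w + 1)" for r
  proof -
    have "0 \<le> ip (u + r *\<^sub>R w) (outer v)" for v
    proof -
      have "\<bar>r * ip w (outer v)\<bar> \<le> (\<delta> / (norm w + 1)) * (norm w * norm (outer v))"
        unfolding abs_mult ip_eq_inner[OF outer_Sd]
        using r by (intro mult_mono Cauchy_Schwarz_ineq2) auto
      also have "\<dots> \<le> (\<delta> / (norm w + 1)) * ((norm w + 1) * norm (outer v))"
        using \<delta>(1) by (intro mult_left_mono mult_right_mono) auto
      also have "\<dots> = \<delta> * norm (outer v)" by (simp add: add_nonneg_eq_0_iff)
      finally show ?thesis using \<delta>(2)[OF outer_Sdp[of v]] by (simp add: ip.add_left ip.scaleR_left)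
    qed
    moreover have "u + r *\<^sub>R w \<in> Sd"
      using Sdp_Sd[OF Spp_Sdp[OF assms(1)]] assms(2) subspace_Sd by (auto intro: subspace_add subspace_scale)
    ultimately show ?thesis by (simp add: Sdp_iff)
  qed
  then show ?thesis using \<delta>(1) by (intro that[of "\<delta> / (norm w + 1)"]) (auto simp: add_nonneg_pos)
qed

text \<open>By compactness the form attains a minimum on the unit sphere, the smallest eigenvalue.
  Scaling extends this lower bound to all vectors, so a positive minimum would put \<open>w\<close>
  into \<open>Spp\<close>.\<close>

lemma not_Spp_degenerate:
  assumes w: "w \<in> Sdp" "w \<notin> Spp"
  obtains v where "v \<bullet> v = 1" "ip w (outer v) = 0"
proof -
  have "\<exists>v\<in>sphere 0 1. \<forall>v'\<in>sphere 0 1. ip w (outer v) \<le> ip w (outer v')"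
  proof (rule continuous_attains_inf)
    show "sphere (0 :: real^'a) 1 \<noteq> {}" by (metis (no_types, lifting) norm_axis_1 empty_iff mem_sphere_0)
    show "continuous_on (sphere 0 1) (\<lambda>v. ip w (outer v))"
      unfolding ip_outer by (intro continuous_intros)
  qed simp
  then obtain v where v: "norm v = 1" and min: "\<And>v'. norm v' = 1 \<Longrightarrow> ip w (outer v) \<le> ip w (outer v')"
    by auto
  have "ip w (outer v) * (x \<bullet> x) \<le> x \<bullet> (w *v x)" for x
  proof (cases "x = 0")
    case False
    have "ip w (outer v) \<le> ip w (outer ((1 / norm x) *\<^sub>R x))" by (rule min) (simp add: False)
    also have "\<dots> = (x \<bullet> (w *v x)) / (x \<bullet> x)"
      by (simp add: ip_outer matrix_vector_mult_scaleR dot_square_norm power2_eq_square)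
    finally show ?thesis using False by (simp add: field_simps)
  qed simp
  moreover have "0 \<le> ip w (outer v)" by (rule ip_Sdp_nonneg[OF w(1) outer_Sdp])
  ultimately have "ip w (outer v) = 0"
    using w by (auto simp: Spp_def Sdp_Sd less_le)
  then show ?thesis using v by (intro that[of v]) (simp_all add: norm_eq_1)
qed

text \<open>A null direction of a sum of rank-one matrices is orthogonal to each generating vector,
  hence lies in the kernel.\<close>

lemma invertible_Sdp_Spp:
  assumes "w \<in> Sdp" "invertible w"
  shows "w \<in> Spp"
proof (rule ccontr)
  assume "w \<notin> Spp"
  then obtain v where v: "v \<bullet> v = 1" "ip w (outer v) = 0" using not_Spp_degenerate assms(1) by blast
  obtain ws where ws: "w = sum_list (map outer ws)" using Sdp_decompose[OF assms(1)] .
  have "sum_list (map outer ws) *v v = 0" if "ip (sum_list (map outer ws)) (outer v) = 0" for ws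
    using that
  proof (induction ws)
    case (Cons a ws)
    have "0 \<le> ip (sum_list (map outer ws)) (outer v)"
      by (induction ws) (auto simp: ip.zero_left ip.add_left ip_outer_outer)
    then have "v \<bullet> a = 0" "ip (sum_list (map outer ws)) (outer v) = 0"
      using Cons.prems by (auto simp: ip.add_left ip_outer_outer add_nonneg_eq_0_iff)
    moreover have "outer a *v v = (v \<bullet> a) *\<^sub>R a"
      by (simp add: matrix_vector_mult_def outer_def inner_vec_def vec_eq_iff sum_distrib_left algebra_simps)
    ultimately show ?case using Cons.IH by (simp add: matrix_vector_mult_add_rdistrib)
  qed simp
  then have "w *v v = 0" using v ws by blast
  moreover have "v \<noteq> 0" using v(1) by auto
  ultimately show False using assms(2)
    by (metis invertible_def matrix_left_invertible_ker)
qed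

section \<open>The complexified trace pairing\<close>

lemma re_mat_simps [simp]:
  "re_mat (x + y) = re_mat x + re_mat y" "re_mat (x - y) = re_mat x - re_mat y"
  "re_mat (r *\<^sub>R x) = r *\<^sub>R re_mat x" "re_mat (cmat z) = z" "re_mat 0 = 0"
  by (simp_all add: re_mat_def cmat_def vec_eq_iff)

lemma im_mat_simps [simp]:
  "im_mat (x + y) = im_mat x + im_mat y" "im_mat (x - y) = im_mat x - im_mat y"
  "im_mat (r *\<^sub>R x) = r *\<^sub>R im_mat x" "im_mat (cmat z) = 0" "im_mat 0 = 0"
  by (simp_all add: im_mat_def cmat_def vec_eq_iff)

lemma linear_re_mat: "linear re_mat" and linear_im_mat: "linear im_mat"
  by (auto intro!: linearI)

lemma bounded_linear_re_mat: "bounded_linear re_mat"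
  and bounded_linear_im_mat: "bounded_linear im_mat"
  using linear_re_mat linear_im_mat by (simp_all add: linear_conv_bounded_linear)

lemma Re_cip: "Re (cip u x) = ip (re_mat u) x"
  and Im_cip: "Im (cip u x) = ip (im_mat u) x"
  by (simp_all add: cip_def ip_def re_mat_def im_mat_def)

lemma cip_eq: "cip u x = complex_of_real (ip (re_mat u) x) + \<i> * complex_of_real (ip (im_mat u) x)"
  by (simp add: complex_eq_iff Re_cip Im_cip)

lemma cip_cmat: "cip (cmat v) x = complex_of_real (ip v x)"
  by (simp add: cip_def cmat_def ip_def)

lemma bilinear_cip: "bounded_bilinear (cip :: complex^'d^'d \<Rightarrow> real^'d^'d \<Rightarrow> complex)"
  unfolding bilinear_conv_bounded_bilinear[symmetric] bilinear_def
  by (auto intro!: linearI simp: cip_eq ip.add_left ip.add_right ip.scaleR_left ip.scaleR_right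
      complex_eq_iff)

interpretation cip: bounded_bilinear cip by (rule bilinear_cip)

lemma CSdp_iff: "u \<in> CSdp \<longleftrightarrow> re_mat u \<in> Sdp \<and> im_mat u \<in> Sd"
  by (simp add: CSdp_def)

lemma Re_cip_nonneg: "u \<in> CSdp \<Longrightarrow> x \<in> Sdp \<Longrightarrow> 0 \<le> Re (cip u x)"
  by (simp add: Re_cip CSdp_iff ip_Sdp_nonneg)

lemma closed_CSdp: "closed (CSdp :: (complex^'d^'d) set)"
proof -
  have "closed (Sd :: (real^'d^'d) set)"
    by (rule closed_subspace[OF subspace_Sd])
  then have "closed ((re_mat -` Sdp) \<inter> (im_mat -` Sd) :: (complex^'d^'d) set)"
    by (intro closed_Int continuous_closed_vimage closed_Sdp)
       (auto intro!: linear_continuous_at bounded_linear_re_mat bounded_linear_im_mat)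
  then show ?thesis by (simp add: CSdp_def vimage_def Collect_conj_eq)
qed

text \<open>Projection onto \<open>Sd\<close>; composing with it turns maps that are linear only on
  \<open>Sd\<close> into linear maps on all matrices.\<close>

definition sym_part :: "real^'d^'d \<Rightarrow> real^'d^'d" where
  "sym_part z = (1/2) *\<^sub>R (z + transpose z)"

lemma linear_sym_part: "linear sym_part"
  by (rule linearI) (simp_all add: sym_part_def transpose_def vec_eq_iff algebra_simps)

lemma sym_part_Sd: "sym_part z \<in> Sd"
  by (simp add: Sd_iff sym_part_def transpose_def)

lemma sym_part_id: "z \<in> Sd \<Longrightarrow> sym_part z = z"
  by (simp add: Sd_iff sym_part_def transpose_def vec_eq_iff)

section \<open>Coordinates and linear functionals on symmetric matrices\<close>

lemma Esym_Sd: "Esym k l \<in> Sd"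
  unfolding Sd_iff Esym_def by (simp add: add.commute conj_commute)

lemma Ediag_eq_outer: "Ediag k = outer (axis k 1)"
  by (simp add: Ediag_def outer_def axis_def vec_eq_iff)

lemma Epair_eq_outer: "k \<noteq> l \<Longrightarrow> Epair k l = outer (axis k 1 + axis l 1)"
  by (simp add: Epair_def outer_def axis_def vec_eq_iff)

lemma Ediag_Sdp: "Ediag k \<in> Sdp"
  by (simp add: Ediag_eq_outer outer_Sdp)

lemma Epair_Sdp: "k \<noteq> l \<Longrightarrow> Epair k l \<in> Sdp"
  by (simp add: Epair_eq_outer outer_Sdp)

lemma Esym_diag: "Esym k k = Ediag k"
  by (auto simp: Esym_def Ediag_def vec_eq_iff)

lemma Esym_offdiag: "k \<noteq> l \<Longrightarrow> Esym k l = (1/2) *\<^sub>R (Epair k l - Ediag k - Ediag l)"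
  by (auto simp: Esym_def Ediag_def Epair_def vec_eq_iff)

lemma sum_sum_delta:
  fixes g :: "'a::finite \<Rightarrow> 'b::finite \<Rightarrow> 'c::comm_monoid_add"
  shows "(\<Sum>i\<in>UNIV. \<Sum>j\<in>UNIV. if i = k then if j = l then g i j else 0 else 0) = g k l"
proof -
  have "(\<Sum>i\<in>UNIV. \<Sum>j\<in>UNIV. if i = k then if j = l then g i j else 0 else 0)
      = (\<Sum>i\<in>UNIV. if i = k then g k l else 0)"
    by (intro sum.cong) auto
  then show ?thesis by simp
qed

text \<open>For symmetric \<open>u\<close> this is the entry itself, so pairings determine such
  matrices entrywise.\<close>

lemma cip_Esym: "cip u (Esym k l) = (u$k$l + u$l$k) / 2"
proof -
  have eq: "u$i$j * complex_of_real (Esym k l $ j $ i)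
    = (if i = l then (if j = k then u$i$j / 2 else 0) else 0)
      + (if i = k then (if j = l then u$i$j / 2 else 0) else 0)" for i j
    by (auto simp: Esym_def)
  show ?thesis
    unfolding cip_def eq sum.distrib sum_sum_delta by (simp add: add_divide_distrib)
qed

lemma Sd_expansion:
  fixes x :: "real^'d^'d"
  assumes "x \<in> Sd"
  shows "x = (\<Sum>k\<in>UNIV. \<Sum>l\<in>UNIV. x$l$k *\<^sub>R Esym k l)"
proof -
  have "(\<Sum>k\<in>UNIV. \<Sum>l\<in>UNIV. x$l$k *\<^sub>R Esym k l) $ i $ j = x$i$j" for i j
  proof -
    have eq: "x$l$k * Esym k l $ i $ j = (if k = i then (if l = j then x$l$k / 2 else 0) else 0)
        + (if k = j then (if l = i then x$l$k / 2 else 0) else 0)" for k l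
      by (auto simp: Esym_def)
    have "(\<Sum>k\<in>UNIV. \<Sum>l\<in>UNIV. x$l$k *\<^sub>R Esym k l) $ i $ j = (\<Sum>k\<in>UNIV. \<Sum>l\<in>UNIV. x$l$k * Esym k l $ i $ j)"
      by (simp add: sum_component)
    also have "\<dots> = x$j$i / 2 + x$i$j / 2"
      unfolding eq sum.distrib sum_sum_delta ..
    finally show ?thesis using assms by (simp add: Sd_iff)
  qed
  then show ?thesis by (simp add: vec_eq_iff)
qed

text \<open>Representation of a functional through the trace pairing: the coefficients of
  \<open>x\<close> with respect to the matrices \<open>Esym k l\<close> are its own entries.\<close>

lemma cip_linear_expansion:
  fixes T :: "real^'d^'d \<Rightarrow> complex"
  assumes "linear T" "x \<in> Sd"
  shows "cip (\<chi> k l. T (Esym k l)) x = T x"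
proof -
  have "T x = (\<Sum>k\<in>UNIV. \<Sum>l\<in>UNIV. x$l$k *\<^sub>R T (Esym k l))"
    by (subst Sd_expansion[OF assms(2)])
       (simp add: linear_sum[OF assms(1)] linear_scale[OF assms(1)])
  then show ?thesis by (simp add: cip_def scaleR_conv_of_real mult.commute)
qed

lemma sym_part_Esym [simp]: "sym_part (Esym k l) = Esym k l"
  by (rule sym_part_id[OF Esym_Sd])

text \<open>By Cauchy-Schwarz the form of \<open>z\<close> at \<open>v\<close> is at least
  \<open>- norm z * (v \<bullet> v)\<close>. Consequently every symmetric matrix is a difference of
  two cone elements.\<close>

lemma Sd_shift_Sdp:
  assumes "z \<in> Sd"
  shows "z + norm z *\<^sub>R mat 1 \<in> Sdp"
proof -
  have "0 \<le> ip (z + norm z *\<^sub>R mat 1) (outer v)" for v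
  proof -
    have "\<bar>ip z (outer v)\<bar> \<le> norm z * (v \<bullet> v)"
      unfolding norm_outer[symmetric] ip_eq_inner[OF outer_Sd] by (rule Cauchy_Schwarz_ineq2)
    moreover have "ip (mat 1) (outer v) = v \<bullet> v" by (simp add: ip_outer)
    ultimately show ?thesis by (simp add: ip.add_left ip.scaleR_left)
  qed
  then show ?thesis using assms mat_scaled_Sd subspace_Sd
    by (auto simp: Sdp_iff intro: subspace_add subspace_scale)
qed

text \<open>The cone spans \<open>Sd\<close>, so \<open>a P - a Q\<close> is the only possible value
  at \<open>P - Q\<close>. The extension uses the fixed splitting of \<open>z\<close> into
  \<open>z + N z\<close> and \<open>N z\<close>, preceded by \<open>sym_part\<close>.\<close>

lemma cone_additive_extends:
  fixes a :: "real^'d^'d \<Rightarrow> 'v::real_vector"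
  assumes add: "\<And>x y. x \<in> Sdp \<Longrightarrow> y \<in> Sdp \<Longrightarrow> a (x + y) = a x + a y"
    and scale: "\<And>x r. x \<in> Sdp \<Longrightarrow> 0 \<le> r \<Longrightarrow> a (r *\<^sub>R x) = r *\<^sub>R a x"
  obtains T where "linear T" "\<And>x. x \<in> Sdp \<Longrightarrow> T x = a x"
proof -
  define N :: "real^'d^'d \<Rightarrow> real^'d^'d" where "N z = norm z *\<^sub>R mat 1" for z
  define T0 where "T0 z = a (z + N z) - a (N z)" for z
  have N: "N z \<in> Sdp" for z by (simp add: N_def Sdp_scaleR mat_Sdp)
  have zN: "z + N z \<in> Sdp" if "z \<in> Sd" for z using Sd_shift_Sdp[OF that] by (simp add: N_def)
  \<comment> \<open>Independence of the splitting: \<open>a\<close> is evaluated in two ways at the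
    single matrix \<open>z + N z + Q = P + N z\<close>.\<close>
  have T0: "T0 z = a P - a Q" if "P \<in> Sdp" "Q \<in> Sdp" "z = P - Q" for z P Q
  proof -
    have "z \<in> Sd" using that subspace_diff[OF subspace_Sd] Sdp_Sd by blast
    have "a (z + N z) + a Q = a (z + N z + Q)" by (rule add[symmetric]) (use zN \<open>z \<in> Sd\<close> that in auto)
    also have "z + N z + Q = P + N z" by (simp add: that)
    also have "a \<dots> = a P + a (N z)" by (rule add) (use N that in auto)
    finally show ?thesis by (simp add: T0_def algebra_simps)
  qed
  have T0_add: "T0 (z + w) = T0 z + T0 w" if "z \<in> Sd" "w \<in> Sd" for z w
  proof -
    have "T0 (z + w) = a ((z + N z) + (w + N w)) - a (N z + N w)"
      by (rule T0) (auto intro: Sdp_add zN N that)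
    then show ?thesis by (simp add: add zN N that T0_def)
  qed
  have T0_scale_nonneg: "T0 (r *\<^sub>R z) = r *\<^sub>R T0 z" if "z \<in> Sd" "0 \<le> r" for r z
  proof -
    have "T0 (r *\<^sub>R z) = a (r *\<^sub>R (z + N z)) - a (r *\<^sub>R N z)"
      by (rule T0) (simp_all add: Sdp_scaleR zN N that scaleR_diff_right[symmetric])
    then show ?thesis by (simp add: scale zN N that T0_def scaleR_diff_right)
  qed
  have T0_minus: "T0 (- z) = - T0 z" if "z \<in> Sd" for z
    using T0[of "N z" "z + N z" "- z"] zN[OF that] N by (simp add: T0_def)
  have T0_scale: "T0 (r *\<^sub>R z) = r *\<^sub>R T0 z" if "z \<in> Sd" for r z
  proof (cases "0 \<le> r")
    case False
    then have "T0 ((- r) *\<^sub>R z) = (- r) *\<^sub>R T0 z" by (intro T0_scale_nonneg that) simp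
    moreover have "T0 (- (r *\<^sub>R z)) = - T0 (r *\<^sub>R z)"
      by (rule T0_minus[OF subspace_scale[OF subspace_Sd that]])
    ultimately show ?thesis by simp
  qed (rule T0_scale_nonneg[OF that])
  have "linear (\<lambda>z. T0 (sym_part z))"
    by (rule linearI) (simp_all add: linear_add[OF linear_sym_part] linear_scale[OF linear_sym_part]
        T0_add T0_scale sym_part_Sd)
  moreover have "T0 (sym_part x) = a x" if "x \<in> Sdp" for x
  proof -
    have "a 0 = 0" using scale[of 0 0] by simp
    then show ?thesis using T0[of x 0 x] that by (simp add: sym_part_id Sdp_Sd)
  qed
  ultimately show ?thesis by (rule that)
qed

text \<open>Polarisation recovers the off-diagonal values of the linear extension from cone
  elements. The entry formula is that of \<open>mat_integral\<close>; it also assembles the complex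
  exponent from its values on rays.\<close>

lemma cone_additive_representation:
  fixes a :: "real^'d^'d \<Rightarrow> complex"
  assumes add: "\<And>x y. x \<in> Sdp \<Longrightarrow> y \<in> Sdp \<Longrightarrow> a (x + y) = a x + a y"
    and scale: "\<And>x r. x \<in> Sdp \<Longrightarrow> 0 \<le> r \<Longrightarrow> a (r *\<^sub>R x) = r *\<^sub>R a x"
    and x: "x \<in> Sdp"
  shows "cip (\<chi> k l. if k = l then a (Ediag k) else (a (Epair k l) - a (Ediag k) - a (Ediag l)) / 2) x = a x"
proof -
  obtain T where T: "linear T" "\<And>x. x \<in> Sdp \<Longrightarrow> T x = a x"
    using cone_additive_extends[of a, OF add scale] by blast
  have "T (Esym k l) = (if k = l then a (Ediag k) else (a (Epair k l) - a (Ediag k) - a (Ediag l)) / 2)" for k l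
    by (cases "k = l") (simp_all add: T(2) Esym_diag Esym_offdiag Ediag_Sdp Epair_Sdp
        linear_scale[OF T(1)] linear_diff[OF T(1)] complex_eq_iff diff_divide_distrib)
  then show ?thesis
    using cip_linear_expansion[OF T(1) Sdp_Sd[OF x]] T(2)[OF x] by simp
qed

text \<open>The cone elements \<open>Ediag k\<close> and \<open>Epair k l\<close> already determine
  all entries of a symmetric matrix.\<close>

lemma cip_eqI:
  assumes "\<And>k l. u$k$l = u$l$k" "\<And>k l. v$k$l = v$l$k" "\<And>x. x \<in> Sdp \<Longrightarrow> cip u x = cip v x"
  shows "u = v"
proof -
  have "cip u (Esym k l) = cip v (Esym k l)" for k l
    by (cases "k = l") (simp_all add: assms(3) Ediag_Sdp Epair_Sdp Esym_diag Esym_offdiag cip.scaleR_right cip.diff_right)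
  then show ?thesis using assms(1,2) by (simp add: vec_eq_iff cip_Esym)
qed

lemma cip_CSdp_I:
  assumes "\<And>k l. u$k$l = u$l$k" "\<And>x. x \<in> Sdp \<Longrightarrow> 0 \<le> Re (cip u x)"
  shows "u \<in> CSdp"
proof -
  have "0 \<le> ip (re_mat u) (outer v)" for v
    using assms(2)[OF outer_Sdp] by (simp add: Re_cip)
  then show ?thesis using assms(1) by (auto simp: CSdp_iff Sdp_iff Sd_iff re_mat_def im_mat_def)
qed

text \<open>Both summands are dominated by \<open>M\<close> and inherit integrability, so the
  induction from indicators to limits runs for the three measures at once. This makes integrals
  against \<open>mu_pair \<mu> x\<close> additive in \<open>x\<close>.\<close>

lemma integral_additive_measure:
  fixes f :: "'a \<Rightarrow> 'b::{banach, second_countable_topology}"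
  assumes sets: "sets M1 = sets M" "sets M2 = sets M"
    and eq: "\<And>A. A \<in> sets M \<Longrightarrow> emeasure M A = emeasure M1 A + emeasure M2 A"
    and f: "integrable M f"
  shows "integral\<^sup>L M f = integral\<^sup>L M1 f + integral\<^sup>L M2 f"
proof -
  have le: "M1 \<le> M" "M2 \<le> M"
    using sets eq by (simp_all add: le_measure)
  have int: "integrable M1 g \<and> integrable M2 g" if "integrable M g" for g :: "'a \<Rightarrow> 'b"
    using that nn_integral_mono_measure[OF sets(1) le(1), of "\<lambda>x. norm (g x)"]
      nn_integral_mono_measure[OF sets(2) le(2), of "\<lambda>x. norm (g x)"]
    by (auto simp: integrable_iff_bounded measurable_cong_sets[OF sets(1) refl]
        measurable_cong_sets[OF sets(2) refl] intro: le_less_trans)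
  show ?thesis using f
  proof (induction rule: integrable_induct)
    case (base A c)
    have "emeasure M1 A \<le> emeasure M A" "emeasure M2 A \<le> emeasure M A"
      unfolding eq[OF base(1)] by simp_all
    then have fin: "emeasure M1 A < \<infinity>" "emeasure M2 A < \<infinity>"
      using base(2) le_less_trans by blast+
    have "measure M A = measure M1 A + measure M2 A"
      using fin by (simp add: measure_def eq[OF base(1)] enn2real_plus)
    moreover have "integral\<^sup>L N (\<lambda>x. indicator A x *\<^sub>R c) = measure N A *\<^sub>R c"
      if "A \<in> sets N" "emeasure N A < \<infinity>" for N
      using that by simp
    ultimately show ?case using base fin sets by (metis scaleR_add_left)
  next
    case (add f g)
    then show ?case using int[OF add.hyps(1)] int[OF add.hyps(2)] by simp
  next
    case (lim f s)
    have "(\<lambda>i. integral\<^sup>L M (s i)) \<longlonglongrightarrow> integral\<^sup>L M f"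
      by (rule integral_dominated_convergence[where w="\<lambda>x. 2 * norm (f x)"]) (use lim.hyps in auto)
    moreover have "(\<lambda>i. integral\<^sup>L M' (s i)) \<longlonglongrightarrow> integral\<^sup>L M' f"
      if M': "sets M' = sets M" and "integrable M' f" "\<And>i. integrable M' (s i)" for M'
    proof (rule integral_dominated_convergence[where w="\<lambda>x. 2 * norm (f x)"])
      show "AE x in M'. (\<lambda>i. s i x) \<longlonglongrightarrow> f x" "AE x in M'. norm (s i x) \<le> 2 * norm (f x)" for i
        using lim.hyps(2,3) sets_eq_imp_space_eq[OF M'] by (auto intro!: AE_I2)
    qed (use that in \<open>simp_all add: borel_measurable_integrable\<close>)
    then have "(\<lambda>i. integral\<^sup>L M1 (s i) + integral\<^sup>L M2 (s i)) \<longlonglongrightarrow> integral\<^sup>L M1 f + integral\<^sup>L M2 f"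
      using int lim.hyps(1,4) sets by (intro tendsto_add) blast+
    ultimately show ?case unfolding lim.IH by (rule LIMSEQ_unique)
  qed
qed

section \<open>Jump measures and admissible parameters\<close>

text \<open>The derivative of \<open>exp\<close> has modulus at most 1 on the left half plane, which
  gives the Lipschitz part; the bound 2 is the triangle inequality.\<close>

lemma norm_exp_minus_one_le:
  fixes z :: complex
  assumes "0 \<le> Re z"
  shows "norm (exp (- z) - 1) \<le> min (norm z) 2"
proof -
  have "norm (exp (- z) - exp 0) \<le> 1 * norm (- z - 0)"
  proof (rule field_differentiable_bound[of "{z. Re z \<le> 0}" exp exp 1])
    show "convex {z. Re z \<le> 0}" by (rule convex_halfspace_Re_le)
    show "(exp has_field_derivative exp z) (at z within {z. Re z \<le> 0})" for z :: complex
      by (rule DERIV_exp[THEN has_field_derivative_at_within])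
  qed (use assms in \<open>auto simp: norm_exp_eq_Re\<close>)
  moreover have "norm (exp (- z) - 1) \<le> norm (exp (- z)) + norm (1::complex)"
    by (rule norm_triangle_ineq4)
  moreover have "exp (- Re z) \<le> 1" using assms by simp
  ultimately show ?thesis by (simp add: norm_exp_eq_Re del: exp_le_one_iff)
qed

text \<open>Common interface for \<open>m\<close> and for the measures
  \<open>mu_pair \<mu> x\<close> with \<open>x\<close> in the cone.\<close>

definition jump_measure :: "(real^'d^'d) measure \<Rightarrow> bool" where
  "jump_measure N \<longleftrightarrow> sets N = sets borel \<and> emeasure N (UNIV - (Sdp - {0})) = 0 \<and>
     (\<integral>\<^sup>+ \<xi>. ennreal (min (norm \<xi>) 1) \<partial>N) < \<infinity>"

definition jump_transform :: "(real^'d^'d) measure \<Rightarrow> complex^'d^'d \<Rightarrow> complex" where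
  "jump_transform N u = (\<integral>\<xi>. exp (- cip u \<xi>) - 1 \<partial>N)"

lemma jump_measure_AE:
  fixes N :: "(real^'d^'d) measure"
  assumes "jump_measure N"
  shows "AE \<xi> in N. \<xi> \<in> Sdp - {0}"
proof (rule AE_I)
  have "space N = UNIV" using sets_eq_imp_space_eq[of N borel] assms by (simp add: jump_measure_def)
  then show "{\<xi> \<in> space N. \<xi> \<notin> Sdp - {0}} \<subseteq> UNIV - (Sdp - {0})" by auto
qed (use assms in \<open>auto simp: jump_measure_def\<close>)

lemma jump_measure_integrable_min:
  fixes N :: "(real^'d^'d) measure"
  assumes "jump_measure N"
  shows "integrable N (\<lambda>\<xi>. min (norm \<xi>) 1)"
  using assms by (auto simp: jump_measure_def integrable_iff_bounded measurable_cong_sets[of N borel])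

lemma jump_measure_set_integral:
  fixes N :: "(real^'d^'d) measure" and f :: "_ \<Rightarrow> 'b::{banach, second_countable_topology}"
  assumes "jump_measure N" "f \<in> borel_measurable borel"
  shows "set_lebesgue_integral N (Sdp - {0}) f = integral\<^sup>L N f"
  unfolding set_lebesgue_integral_def
proof (rule integral_cong_AE)
  have N: "sets N = sets borel" using assms(1) by (simp add: jump_measure_def)
  show "AE \<xi> in N. indicator (Sdp - {0}) \<xi> *\<^sub>R f \<xi> = f \<xi>"
    using jump_measure_AE[OF assms(1)] by eventually_elim simp
  show "(\<lambda>\<xi>. indicator (Sdp - {0}) \<xi> *\<^sub>R f \<xi>) \<in> borel_measurable N" "f \<in> borel_measurable N"
    using assms(2) unfolding measurable_cong_sets[OF N refl] by measurable
qed

lemma jump_integrable_bound: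
  fixes N :: "(real^'d^'d) measure" and f :: "_ \<Rightarrow> 'b::{banach, second_countable_topology}"
  assumes N: "jump_measure N" and f: "f \<in> borel_measurable borel"
    and bd: "\<And>\<xi>. \<xi> \<in> Sdp \<Longrightarrow> norm (f \<xi>) \<le> K * min (norm \<xi>) 1"
  shows "integrable N f" "norm (integral\<^sup>L N f) \<le> K * (\<integral>\<xi>. min (norm \<xi>) 1 \<partial>N)"
proof -
  have int: "integrable N (\<lambda>\<xi>. K * min (norm \<xi>) 1)"
    using jump_measure_integrable_min[OF N] by simp
  have AE: "AE \<xi> in N. norm (f \<xi>) \<le> K * min (norm \<xi>) 1"
    using jump_measure_AE[OF N] by eventually_elim (use bd in auto)
  have "f \<in> borel_measurable N" using f N by (simp add: jump_measure_def measurable_cong_sets[of N borel])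
  moreover have "AE \<xi> in N. norm (f \<xi>) \<le> norm (K * min (norm \<xi>) 1)"
    using AE by eventually_elim auto
  ultimately show "integrable N f" by (rule Bochner_Integration.integrable_bound[OF int])
  have "norm (integral\<^sup>L N f) \<le> (\<integral>\<xi>. K * min (norm \<xi>) 1 \<partial>N)"
    by (rule order_trans[OF integral_norm_bound integral_mono_AE[OF integrable_norm[OF \<open>integrable N f\<close>] int AE]])
  then show "norm (integral\<^sup>L N f) \<le> K * (\<integral>\<xi>. min (norm \<xi>) 1 \<partial>N)" by simp
qed

lemma cip_bound:
  obtains k where "k > 0" "\<And>(u::complex^'d^'d) (x::real^'d^'d). norm (cip u x) \<le> k * (norm u * norm x)"
  using cip.pos_bounded by (metis mult.commute)

lemma measurable_exp_cip [measurable]: "(\<lambda>\<xi>. exp (- cip u \<xi>)) \<in> borel_measurable borel"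
  by (intro borel_measurable_continuous_onI continuous_intros cip.continuous_on)

text \<open>Small jumps use the Lipschitz bound, large ones the bound 2; one constant covers
  both.\<close>

lemma exp_cip_bound:
  fixes u :: "complex^'d^'d"
  assumes k: "k > 0" "\<And>(u::complex^'d^'d) x. norm (cip u x) \<le> k * (norm u * norm x)"
    and u: "u \<in> CSdp" and x: "x \<in> Sdp"
  shows "norm (exp (- cip u x) - 1) \<le> (2 + k * norm u) * min (norm x) 1"
proof (cases "norm x \<le> 1")
  case True
  have "norm (exp (- cip u x) - 1) \<le> k * (norm u * norm x)"
    using norm_exp_minus_one_le[OF Re_cip_nonneg[OF u x]] k(2)[of u x] by simp
  also have "\<dots> \<le> (2 + k * norm u) * norm x" by (simp add: algebra_simps)
  finally show ?thesis using True by simp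
next
  case False
  have "norm (exp (- cip u x) - 1) \<le> 2"
    using norm_exp_minus_one_le[OF Re_cip_nonneg[OF u x]] by simp
  moreover have "0 \<le> k * norm u" using k(1) by simp
  ultimately show ?thesis using False by simp
qed

text \<open>\<open>K\<close> is uniform in the measure and the argument, since it comes from the
  bound of the bilinear map \<open>cip\<close> alone. Linear growth in \<open>u\<close> prevents the
  jump part from causing explosion.\<close>

lemma jump_transform_bound:
  obtains K where "K \<ge> 0"
    "\<And>N (u::complex^'d^'d). jump_measure N \<Longrightarrow> u \<in> CSdp \<Longrightarrow>
      norm (jump_transform N u) \<le> K * (1 + norm u) * (\<integral>\<xi>. min (norm \<xi>) 1 \<partial>N)"
proof -
  obtain k where k: "k > 0" "\<And>(u::complex^'d^'d) x. norm (cip u x) \<le> k * (norm u * norm x)"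
    using cip_bound by blast
  have "norm (jump_transform N u) \<le> (2 + k) * (1 + norm u) * (\<integral>\<xi>. min (norm \<xi>) 1 \<partial>N)"
    if "jump_measure N" "u \<in> CSdp" for N and u :: "complex^'d^'d"
    unfolding jump_transform_def
  proof (rule jump_integrable_bound(2)[OF that(1)])
    fix \<xi> :: "real^'d^'d" assume "\<xi> \<in> Sdp"
    then have "norm (exp (- cip u \<xi>) - 1) \<le> (2 + k * norm u) * min (norm \<xi>) 1"
      by (rule exp_cip_bound[OF k that(2)])
    also have "\<dots> \<le> ((2 + k) * (1 + norm u)) * min (norm \<xi>) 1"
      using k(1) by (intro mult_right_mono) (auto simp: algebra_simps)
    finally show "norm (exp (- cip u \<xi>) - 1) \<le> ((2 + k) * (1 + norm u)) * min (norm \<xi>) 1" .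
  qed simp
  then show ?thesis using k(1) by (intro that[of "2 + k"]) auto
qed

text \<open>A convergent sequence of arguments is bounded, so a single multiple of
  \<open>min (norm \<xi>) 1\<close> dominates all integrands.\<close>

lemma continuous_on_jump_transform:
  fixes N :: "(real^'d^'d) measure"
  assumes N: "jump_measure N"
  shows "continuous_on CSdp (jump_transform N)"
  unfolding continuous_on_sequentially
proof safe
  fix U :: "nat \<Rightarrow> complex^'d^'d" and u
  assume u: "u \<in> CSdp" and U: "\<forall>n. U n \<in> CSdp" and lim: "U \<longlonglongrightarrow> u"
  obtain k where k: "k > 0" "\<And>(u::complex^'d^'d) x. norm (cip u x) \<le> k * (norm u * norm x)"
    using cip_bound by blast
  obtain K where K: "\<And>n. norm (U n) \<le> K"
    using convergent_imp_Bseq[of U] lim by (auto simp: convergent_def Bseq_def)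
  have N': "sets N = sets borel" using N by (simp add: jump_measure_def)
  show "(jump_transform N \<circ> U) \<longlonglongrightarrow> jump_transform N u"
    unfolding jump_transform_def o_def
  proof (rule integral_dominated_convergence[where w="\<lambda>\<xi>. (2 + k * K) * min (norm \<xi>) 1"])
    show "integrable N (\<lambda>\<xi>. (2 + k * K) * min (norm \<xi>) 1)"
      using jump_measure_integrable_min[OF N] by simp
    show "AE \<xi> in N. (\<lambda>n. exp (- cip (U n) \<xi>) - 1) \<longlonglongrightarrow> exp (- cip u \<xi>) - 1"
      by (intro AE_I2 tendsto_intros cip.tendsto lim)
    show "AE \<xi> in N. norm (exp (- cip (U n) \<xi>) - 1) \<le> (2 + k * K) * min (norm \<xi>) 1" for n
      using jump_measure_AE[OF N]
    proof eventually_elim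
      case (elim \<xi>)
      then have "norm (exp (- cip (U n) \<xi>) - 1) \<le> (2 + k * norm (U n)) * min (norm \<xi>) 1"
        using U by (intro exp_cip_bound[OF k]) auto
      also have "\<dots> \<le> (2 + k * K) * min (norm \<xi>) 1"
        using k(1) K by (intro mult_right_mono add_left_mono mult_left_mono) auto
      finally show ?case .
    qed
  qed (simp_all add: measurable_cong_sets[OF N' refl])
qed

locale admissible_parameters =
  fixes \<alpha> b \<gamma> :: "real^'d^'d" and B :: "real^'d^'d \<Rightarrow> real^'d^'d" and c :: real
    and m :: "(real^'d^'d) measure" and \<mu> :: "(real^'d^'d) set \<Rightarrow> real^'d^'d"
  assumes adm: "admissible \<alpha> b B c \<gamma> m \<mu>"
begin

text \<open>The closed sets used by \<open>mu_pair\<close> to exhaust \<open>Sdp - {0}\<close>. A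
  Borel subset of some \<open>C n\<close> has its closure in \<open>Sdp - {0}\<close>, where \<mu>
  is known to be cone-valued and additive.\<close>

definition C :: "nat \<Rightarrow> (real^'d^'d) set" where
  "C n = Sdp \<inter> {\<xi>. 1 / real (Suc n) \<le> norm \<xi>}"

lemma \<alpha>_Sdp: "\<alpha> \<in> Sdp" and \<gamma>_Sdp: "\<gamma> \<in> Sdp" and b_Sdp: "b \<in> Sdp" and c_nonneg: "0 \<le> c"
  and sets_m: "sets m = sets borel" and m_null: "emeasure m (UNIV - (Sdp - {0})) = 0"
  and m_fin: "(\<integral>\<^sup>+ \<xi>. ennreal (min (norm \<xi>) 1) \<partial>m) < \<infinity>"
  and \<mu>_Sdp: "E \<in> sets borel \<Longrightarrow> closure E \<subseteq> Sdp - {0} \<Longrightarrow> \<mu> E \<in> Sdp"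
  and \<mu>_sums: "(\<And>n. A n \<in> sets borel) \<Longrightarrow> disjoint_family A \<Longrightarrow> closure (\<Union>n::nat. A n) \<subseteq> Sdp - {0}
    \<Longrightarrow> (\<lambda>n. \<mu> (A n)) sums \<mu> (\<Union>n. A n)"
  and \<mu>_fin: "x \<in> Sdp \<Longrightarrow> (\<integral>\<^sup>+ \<xi>. ennreal (min (norm \<xi>) 1) \<partial>(mu_pair \<mu> x)) < \<infinity>"
  and B_add: "x \<in> Sd \<Longrightarrow> y \<in> Sd \<Longrightarrow> B (x + y) = B x + B y"
  and B_scale: "x \<in> Sd \<Longrightarrow> B (r *\<^sub>R x) = r *\<^sub>R B x"
  using adm unfolding admissible_def by blast+

section \<open>The scalar measures induced by the matrix-valued measure\<close>

lemma closed_C: "closed (C n)"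
  unfolding C_def by (intro closed_Int closed_Sdp closed_Collect_le continuous_intros)

lemma C_subset: "C n \<subseteq> Sdp - {0}"
  by (auto simp: C_def divide_le_0_iff)

lemma C_borel [measurable]: "C n \<in> sets borel"
  by (rule borel_closed[OF closed_C])

lemma C_mono: "n \<le> k \<Longrightarrow> C n \<subseteq> C k"
proof -
  assume "n \<le> k"
  then have "1 / real (Suc k) \<le> 1 / real (Suc n)" by (simp add: field_simps)
  then show ?thesis by (auto simp: C_def)
qed

lemma closure_in_C: "E \<subseteq> C n \<Longrightarrow> closure E \<subseteq> Sdp - {0}"
  using closure_minimal[OF _ closed_C] C_subset by blast

text \<open>A convergent constant series has zero terms.\<close>

lemma \<mu>_empty: "\<mu> {} = 0"
proof -
  have "(\<lambda>n::nat. \<mu> {}) sums \<mu> {}"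
    using \<mu>_sums[of "\<lambda>_. {}"] by (simp add: disjoint_family_on_def)
  then have "(\<lambda>n::nat. \<mu> {}) \<longlonglongrightarrow> 0" by (rule summable_LIMSEQ_zero[OF sums_summable])
  then show ?thesis by (simp add: LIMSEQ_const_iff)
qed

text \<open>Countable additivity on the sequence \<open>E\<close>, \<open>E'\<close> continued by
  empty sets, whose values vanish.\<close>

lemma \<mu>_union:
  assumes "E \<in> sets borel" "E' \<in> sets borel" "E \<inter> E' = {}" "E \<subseteq> C n" "E' \<subseteq> C n"
  shows "\<mu> (E \<union> E') = \<mu> E + \<mu> E'"
proof -
  define A where "A k = (if k = 0 then E else if k = 1 then E' else {})" for k :: nat
  have U: "(\<Union>k. A k) = E \<union> E'"
    by (auto simp: A_def split: if_splits)
  have "(\<lambda>k. \<mu> (A k)) sums \<mu> (\<Union>k. A k)"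
  proof (rule \<mu>_sums)
    show "closure (\<Union>k. A k) \<subseteq> Sdp - {0}" unfolding U using assms by (intro closure_in_C) auto
    show "disjoint_family A" using assms(3) by (auto simp: disjoint_family_on_def A_def)
  qed (use assms in \<open>auto simp: A_def\<close>)
  moreover have "(\<lambda>k. \<mu> (A k)) sums (\<Sum>k<2. \<mu> (A k))"
    by (rule sums_finite) (auto simp: A_def \<mu>_empty)
  ultimately have "\<mu> (\<Union>k. A k) = (\<Sum>k<2. \<mu> (A k))" by (rule sums_unique2)
  then show ?thesis unfolding U by (simp add: A_def eval_nat_numeral)
qed

lemma ip_\<mu>_nonneg: "x \<in> Sdp \<Longrightarrow> E \<in> sets borel \<Longrightarrow> 0 \<le> ip (\<mu> (E \<inter> C n)) x"
  by (intro ip_Sdp_nonneg \<mu>_Sdp closure_in_C[of _ n]) auto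

lemma ip_\<mu>_incseq:
  assumes "x \<in> Sdp" "E \<in> sets borel"
  shows "incseq (\<lambda>n. ennreal (ip (\<mu> (E \<inter> C n)) x))"
proof (rule incseq_SucI, rule ennreal_leI)
  fix n
  have "E \<inter> C (Suc n) = (E \<inter> C n) \<union> ((E - C n) \<inter> C (Suc n))"
    using C_mono[of n "Suc n"] by auto
  moreover have "\<mu> \<dots> = \<mu> (E \<inter> C n) + \<mu> ((E - C n) \<inter> C (Suc n))"
    by (rule \<mu>_union[of _ _ "Suc n"]) (use assms(2) C_mono[of n "Suc n"] in auto)
  moreover have "0 \<le> ip (\<mu> ((E - C n) \<inter> C (Suc n))) x"
    using assms by (intro ip_\<mu>_nonneg) auto
  ultimately show "ip (\<mu> (E \<inter> C n)) x \<le> ip (\<mu> (E \<inter> C (Suc n))) x"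
    by (simp add: ip.add_left)
qed

lemma sets_mu_pair [measurable_cong]: "sets (mu_pair \<mu> x) = sets borel"
  unfolding mu_pair_def using sets.sigma_sets_eq[of "borel :: (real^'d^'d) measure"]
  by (simp add: sets_measure_of)

text \<open>\<open>measure_of\<close> takes the prescribed values once the set function is countably
  additive. Series and supremum commute because the values increase in \<open>n\<close>; for fixed
  \<open>n\<close> the additivity is that of \<mu> inside \<open>C n\<close>.\<close>

lemma emeasure_mu_pair:
  assumes x: "x \<in> Sdp" and E: "E \<in> sets borel"
  shows "emeasure (mu_pair \<mu> x) E = (SUP n. ennreal (ip (\<mu> (E \<inter> C n)) x))"
proof -
  let ?f = "\<lambda>E. SUP n. ennreal (ip (\<mu> (E \<inter> C n)) x)"
  have "mu_pair \<mu> x = measure_of UNIV (sets borel) ?f"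
    by (simp add: mu_pair_def C_def Int_assoc)
  moreover have "countably_additive (sets borel) ?f"
  proof (rule countably_additiveI)
    fix A :: "nat \<Rightarrow> (real^'d^'d) set"
    assume A: "range A \<subseteq> sets borel" "disjoint_family A"
    have "(\<Sum>i. ?f (A i)) = (SUP n. \<Sum>i. ennreal (ip (\<mu> (A i \<inter> C n)) x))"
      by (rule ennreal_suminf_SUP_eq, rule ip_\<mu>_incseq) (use A x in auto)
    also have "\<dots> = ?f (\<Union>i. A i)"
    proof (intro SUP_cong refl suminf_ennreal_eq)
      fix n
      show "0 \<le> ip (\<mu> (A i \<inter> C n)) x" for i using A x by (intro ip_\<mu>_nonneg) auto
      have "(\<lambda>i. \<mu> (A i \<inter> C n)) sums \<mu> (\<Union>i. A i \<inter> C n)"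
      proof (rule \<mu>_sums)
        show "disjoint_family (\<lambda>i. A i \<inter> C n)" using A(2) by (auto simp: disjoint_family_on_def)
        show "closure (\<Union>i. A i \<inter> C n) \<subseteq> Sdp - {0}" by (rule closure_in_C[of _ n]) auto
      qed (use A in auto)
      then show "(\<lambda>i. ip (\<mu> (A i \<inter> C n)) x) sums ip (\<mu> ((\<Union>i. A i) \<inter> C n)) x"
        by (simp add: bounded_linear.sums[OF ip.bounded_linear_left])
    qed
    finally show "(\<Sum>i. ?f (A i)) = ?f (\<Union>i. A i)" .
  qed
  moreover have "positive (sets borel) ?f"
    by (simp add: positive_def \<mu>_empty ip.zero_left)
  moreover have "sigma_algebra UNIV (sets (borel :: (real^'d^'d) measure))"
    using sets.sigma_algebra_axioms[of "borel :: (real^'d^'d) measure"] by simp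
  ultimately show ?thesis using E by (simp add: emeasure_measure_of_sigma)
qed

lemma emeasure_mu_pair_add:
  assumes "x \<in> Sdp" "y \<in> Sdp" "E \<in> sets borel"
  shows "emeasure (mu_pair \<mu> (x + y)) E = emeasure (mu_pair \<mu> x) E + emeasure (mu_pair \<mu> y) E"
proof -
  have "emeasure (mu_pair \<mu> (x + y)) E
      = (SUP n. ennreal (ip (\<mu> (E \<inter> C n)) x) + ennreal (ip (\<mu> (E \<inter> C n)) y))"
    using assms by (simp add: emeasure_mu_pair Sdp_add ip.add_right ennreal_plus ip_\<mu>_nonneg)
  also have "\<dots> = (SUP n. ennreal (ip (\<mu> (E \<inter> C n)) x)) + (SUP n. ennreal (ip (\<mu> (E \<inter> C n)) y))"
    by (rule ennreal_SUP_add) (use ip_\<mu>_incseq assms in auto)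
  finally show ?thesis using assms by (simp add: emeasure_mu_pair)
qed

lemma mu_pair_scaleR:
  assumes "x \<in> Sdp" "0 \<le> r"
  shows "mu_pair \<mu> (r *\<^sub>R x) = density (mu_pair \<mu> x) (\<lambda>_. ennreal r)"
proof (rule measure_eqI)
  fix E assume "E \<in> sets (mu_pair \<mu> (r *\<^sub>R x))"
  then have E: "E \<in> sets borel" by (simp add: sets_mu_pair)
  have "emeasure (mu_pair \<mu> (r *\<^sub>R x)) E = (SUP n. ennreal r * ennreal (ip (\<mu> (E \<inter> C n)) x))"
    using assms E by (simp add: emeasure_mu_pair Sdp_scaleR ip.scaleR_right ennreal_mult ip_\<mu>_nonneg)
  also have "\<dots> = ennreal r * emeasure (mu_pair \<mu> x) E"
    using assms E by (simp add: emeasure_mu_pair SUP_mult_left_ennreal)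
  finally show "emeasure (mu_pair \<mu> (r *\<^sub>R x)) E = emeasure (density (mu_pair \<mu> x) (\<lambda>_. ennreal r)) E"
    using E by (simp add: emeasure_density_const sets_mu_pair)
qed (simp add: sets_mu_pair)

lemma mu_pair_null:
  assumes "x \<in> Sdp"
  shows "emeasure (mu_pair \<mu> x) (UNIV - (Sdp - {0})) = 0"
proof -
  have "(UNIV - (Sdp - {0})) \<inter> C n = {}" for n using C_subset by blast
  then show ?thesis using assms by (subst emeasure_mu_pair) (simp_all add: \<mu>_empty ip.zero_left)
qed

lemma jump_measure_m: "jump_measure m"
  using sets_m m_null m_fin by (simp add: jump_measure_def)

lemma jump_measure_mu_pair: "x \<in> Sdp \<Longrightarrow> jump_measure (mu_pair \<mu> x)"
  using mu_pair_null \<mu>_fin by (simp add: jump_measure_def sets_mu_pair)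

text \<open>For fixed \<open>u\<close> the jump integral is additive and positively homogeneous in
  \<open>x\<close>, so its polarised entries represent it on the cone.\<close>

lemma cip_mat_integral:
  assumes x: "x \<in> Sdp" and u: "u \<in> CSdp"
  shows "cip (mat_integral \<mu> (\<lambda>\<xi>. exp (- cip u \<xi>) - 1)) x = jump_transform (mu_pair \<mu> x) u"
proof -
  let ?g = "\<lambda>\<xi>. exp (- cip u \<xi>) - 1"
  obtain k where k: "k > 0" "\<And>(u::complex^'d^'d) x. norm (cip u x) \<le> k * (norm u * norm x)"
    using cip_bound by blast
  have int: "integrable (mu_pair \<mu> x) ?g" if "x \<in> Sdp" for x
    by (rule jump_integrable_bound(1)[OF jump_measure_mu_pair[OF that]])
       (use exp_cip_bound[OF k u] in auto)
  show ?thesis unfolding mat_integral_def jump_transform_def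
  proof (rule cone_additive_representation[OF _ _ x])
    show "integral\<^sup>L (mu_pair \<mu> (x + y)) ?g = integral\<^sup>L (mu_pair \<mu> x) ?g + integral\<^sup>L (mu_pair \<mu> y) ?g"
      if "x \<in> Sdp" "y \<in> Sdp" for x y
      by (rule integral_additive_measure[OF _ _ _ int])
         (use that in \<open>auto simp: sets_mu_pair emeasure_mu_pair_add Sdp_add\<close>)
    show "integral\<^sup>L (mu_pair \<mu> (r *\<^sub>R x)) ?g = r *\<^sub>R integral\<^sup>L (mu_pair \<mu> x) ?g"
      if "x \<in> Sdp" "0 \<le> r" for x r
      unfolding mu_pair_scaleR[OF that] using that
      by (subst integral_density) (auto simp: measurable_cong_sets[OF sets_mu_pair refl])
  qed
qed

text \<open>\<open>B\<close> is linear only on \<open>Sd\<close>; composition with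
  \<open>sym_part\<close> makes the representation of functionals applicable.\<close>

lemma cip_adj_c:
  assumes "x \<in> Sd"
  shows "cip (adj_c B u) x = cip u (B x)"
proof -
  have "linear (\<lambda>x. cip u (B (sym_part x)))"
    by (rule linearI) (simp_all add: linear_add[OF linear_sym_part] linear_scale[OF linear_sym_part]
        B_add B_scale sym_part_Sd cip.add_right cip.scaleR_right)
  moreover have "adj_c B u = (\<chi> k l. cip u (B (sym_part (Esym k l))))"
  proof -
    have "(\<Sum>i\<in>UNIV. \<Sum>j\<in>UNIV. complex_of_real (M$i$j) * u$j$i) = cip u M" for M :: "real^'d^'d"
      unfolding cip_def by (subst sum.swap) (simp add: mult.commute)
    then show ?thesis by (simp add: adj_c_def)
  qed
  ultimately show ?thesis using cip_linear_expansion[of "\<lambda>x. cip u (B (sym_part x))" x] assms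
    by (simp add: sym_part_id)
qed

section \<open>Right-hand sides of the Riccati equations\<close>

definition F :: "complex^'d^'d \<Rightarrow> complex" where
  "F u = cip u b + complex_of_real c - set_lebesgue_integral m (Sdp - {0}) (\<lambda>\<xi>. exp (- cip u \<xi>) - 1)"

text \<open>What remains of \<open>R\<close> without the quadratic term; this part grows at most
  linearly.\<close>

definition L :: "complex^'d^'d \<Rightarrow> complex^'d^'d" where
  "L u = adj_c B u + cmat \<gamma> - mat_integral \<mu> (\<lambda>\<xi>. exp (- cip u \<xi>) - 1)"

text \<open>Spelled, like \<open>F\<close>, exactly as the right-hand side in the theorem, so that
  the goal can be folded back into \<open>F\<close> and \<open>R\<close>.\<close>

definition R :: "complex^'d^'d \<Rightarrow> complex^'d^'d" where
  "R u = - 2 *\<^sub>R (u ** cmat \<alpha> ** u) + adj_c B u + cmat \<gamma>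
      - mat_integral \<mu> (\<lambda>\<xi>. exp (- cip u \<xi>) - 1)"

lemma R_eq: "R u = - 2 *\<^sub>R (u ** cmat \<alpha> ** u) + L u"
  by (simp add: R_def L_def)

lemma F_eq: "F u = cip u b + complex_of_real c - jump_transform m u"
  unfolding F_def jump_transform_def by (subst jump_measure_set_integral[OF jump_measure_m]) simp_all

lemma cip_R:
  assumes "u \<in> CSdp" "x \<in> Sdp"
  shows "cip (R u) x = - 2 * cip (u ** cmat \<alpha> ** u) x + cip u (B x) + complex_of_real (ip \<gamma> x)
    - jump_transform (mu_pair \<mu> x) u"
  unfolding R_def cip.add_left cip.diff_left cip.scaleR_left cip_adj_c[OF Sdp_Sd[OF assms(2)]] cip_cmat
      cip_mat_integral[OF assms(2,1)] by (simp add: scaleR_conv_of_real)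

lemma mat_integral_nth:
  "mat_integral \<mu> (\<lambda>\<xi>. exp (- cip u \<xi>) - 1) $ k $ l = (if k = l then jump_transform (mu_pair \<mu> (Ediag k)) u
     else (jump_transform (mu_pair \<mu> (Epair k l)) u - jump_transform (mu_pair \<mu> (Ediag k)) u
       - jump_transform (mu_pair \<mu> (Ediag l)) u) / 2)"
  by (simp add: mat_integral_def jump_transform_def)

lemma linear_adj_c: "linear (adj_c B :: complex^'d^'d \<Rightarrow> _)"
  by (rule linearI) (simp_all add: adj_c_def vec_eq_iff sum.distrib ring_distribs scaleR_sum_right)

lemma continuous_on_F: "continuous_on CSdp F"
  unfolding F_eq by (intro continuous_intros cip.continuous_on continuous_on_jump_transform jump_measure_m)

lemma continuous_on_L: "continuous_on CSdp L"
proof -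
  have "continuous_on CSdp (\<lambda>u. if k = l then jump_transform (mu_pair \<mu> (Ediag k)) u
     else (jump_transform (mu_pair \<mu> (Epair k l)) u - jump_transform (mu_pair \<mu> (Ediag k)) u
       - jump_transform (mu_pair \<mu> (Ediag l)) u) / 2)" for k l
    by (cases "k = l") (auto intro!: continuous_intros continuous_on_jump_transform jump_measure_mu_pair
        Ediag_Sdp Epair_Sdp)
  then have "continuous_on CSdp (\<lambda>u. mat_integral \<mu> (\<lambda>\<xi>. exp (- cip u \<xi>) - 1))"
    unfolding mat_integral_def jump_transform_def[symmetric]
    by (intro continuous_on_vec_lambda)
  moreover have "continuous_on CSdp (adj_c B)"
    by (rule linear_continuous_on) (simp add: linear_conv_bounded_linear[symmetric] linear_adj_c)
  ultimately show ?thesis unfolding L_def by (intro continuous_intros)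
qed

lemma continuous_on_R: "continuous_on CSdp R"
  unfolding R_eq matrix_matrix_mult_def
  by (intro continuous_intros continuous_on_vec_lambda continuous_on_L)

lemma F_growth: obtains K where "K \<ge> 0" "\<And>u. u \<in> CSdp \<Longrightarrow> norm (F u) \<le> K * (1 + norm u)"
proof -
  obtain k where k: "k > 0" "\<And>(u::complex^'d^'d) x. norm (cip u x) \<le> k * (norm u * norm x)"
    using cip_bound by blast
  obtain K where K: "K \<ge> 0" "\<And>N (u::complex^'d^'d). jump_measure N \<Longrightarrow> u \<in> CSdp \<Longrightarrow>
      norm (jump_transform N u) \<le> K * (1 + norm u) * (\<integral>\<xi>. min (norm \<xi>) 1 \<partial>N)"
    using jump_transform_bound by blast
  define I where "I = (\<integral>\<xi>. min (norm \<xi>) 1 \<partial>m)"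
  have I: "0 \<le> I" unfolding I_def by (intro integral_nonneg_AE) auto
  have "norm (F u) \<le> (k * norm b + c + K * I) * (1 + norm u)" if "u \<in> CSdp" for u
  proof -
    have "norm (F u) \<le> norm (cip u b) + c + norm (jump_transform m u)"
    proof -
      have "norm (F u) \<le> norm (cip u b) + norm (complex_of_real c) + norm (jump_transform m u)"
        unfolding F_eq by norm
      then show ?thesis using c_nonneg by simp
    qed
    also have "\<dots> \<le> k * (norm u * norm b) + c + K * (1 + norm u) * I"
      using k(2)[of u b] K(2)[OF jump_measure_m that] by (simp add: I_def)
    also have "\<dots> \<le> (k * norm b + c + K * I) * (1 + norm u)"
      using k(1) K(1) c_nonneg by (simp add: algebra_simps)
    finally show ?thesis .
  qed
  then show ?thesis using k(1) K(1) I c_nonneg by (intro that[of "k * norm b + c + K * I"]) auto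
qed

lemma norm_le_sum_entries: "norm (u :: complex^'d^'d) \<le> (\<Sum>k\<in>UNIV. \<Sum>l\<in>UNIV. norm (u$k$l))"
  unfolding norm_vec_def by (rule order_trans[OF L2_set_le_sum] sum_mono L2_set_le_sum | simp)+

text \<open>Each entry of the matrix integral combines at most three jump transforms of linear
  growth, and the norm is at most the sum of the moduli of the entries.\<close>

lemma L_growth: obtains K where "K \<ge> 0" "\<And>u. u \<in> CSdp \<Longrightarrow> norm (L u) \<le> K * (1 + norm u)"
proof -
  obtain k where k: "\<And>u. norm (adj_c B u) \<le> norm u * k" "k \<ge> 0"
    using linear_adj_c unfolding linear_conv_bounded_linear
    using bounded_linear.nonneg_bounded by blast
  obtain K where K: "K \<ge> 0" "\<And>N (u::complex^'d^'d). jump_measure N \<Longrightarrow> u \<in> CSdp \<Longrightarrow>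
      norm (jump_transform N u) \<le> K * (1 + norm u) * (\<integral>\<xi>. min (norm \<xi>) 1 \<partial>N)"
    using jump_transform_bound by blast
  define I where "I x = (\<integral>\<xi>. min (norm \<xi>) 1 \<partial>mu_pair \<mu> x)" for x
  have I: "0 \<le> I x" for x unfolding I_def by (intro integral_nonneg_AE) auto
  \<comment> \<open>Covers the diagonal and the off-diagonal entry formula at once.\<close>
  define J where "J k l = I (Ediag k) + I (Ediag l) + I (Epair k l)" for k l
  have entry: "norm (mat_integral \<mu> (\<lambda>\<xi>. exp (- cip u \<xi>) - 1) $ k $ l) \<le> K * (1 + norm u) * J k l"
    if u: "u \<in> CSdp" for u k l
  proof -
    have j: "norm (jump_transform (mu_pair \<mu> x) u) \<le> K * (1 + norm u) * I x" if "x \<in> Sdp" for x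
      using K(2)[OF jump_measure_mu_pair[OF that] u] by (simp add: I_def)
    have nn: "0 \<le> K * (1 + norm u) * I x" for x using K(1) I by simp
    show ?thesis
    proof (cases "k = l")
      case True
      have "norm (jump_transform (mu_pair \<mu> (Ediag k)) u) \<le> K * (1 + norm u) * J k k"
        unfolding J_def distrib_left[of "K * (1 + norm u)"]
        using j[OF Ediag_Sdp[of k]] nn[of "Ediag k"] nn[of "Epair k k"] by linarith
      then show ?thesis using True by (simp add: mat_integral_nth)
    next
      case False
      have "norm (mat_integral \<mu> (\<lambda>\<xi>. exp (- cip u \<xi>) - 1) $ k $ l)
        = norm (jump_transform (mu_pair \<mu> (Epair k l)) u - jump_transform (mu_pair \<mu> (Ediag k)) u
       - jump_transform (mu_pair \<mu> (Ediag l)) u) / 2"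
        using False by (simp add: mat_integral_nth norm_divide)
      also have "\<dots> \<le> norm (jump_transform (mu_pair \<mu> (Epair k l)) u) + norm (jump_transform (mu_pair \<mu> (Ediag k)) u)
       + norm (jump_transform (mu_pair \<mu> (Ediag l)) u)" by norm
      also have "\<dots> \<le> K * (1 + norm u) * J k l"
        using j[OF Ediag_Sdp[of k]] j[OF Ediag_Sdp[of l]] j[OF Epair_Sdp[OF False]]
        by (simp add: J_def distrib_left)
      finally show ?thesis .
    qed
  qed
  define S where "S = (\<Sum>k\<in>UNIV. \<Sum>l\<in>UNIV. J k l)"
  have S: "0 \<le> S" unfolding S_def J_def using I by (intro sum_nonneg add_nonneg_nonneg)
  have "norm (L u) \<le> (k + norm (cmat \<gamma>) + K * S) * (1 + norm u)" if u: "u \<in> CSdp" for u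
  proof -
    have "norm (mat_integral \<mu> (\<lambda>\<xi>. exp (- cip u \<xi>) - 1)) \<le> (\<Sum>k\<in>UNIV. \<Sum>l\<in>UNIV. K * (1 + norm u) * J k l)"
      by (rule order_trans[OF norm_le_sum_entries]) (intro sum_mono entry[OF u])
    also have "\<dots> = K * (1 + norm u) * S" by (simp add: S_def sum_distrib_left)
    finally have "norm (L u) \<le> norm u * k + norm (cmat \<gamma>) + K * (1 + norm u) * S"
    proof -
      assume m: "norm (mat_integral \<mu> (\<lambda>\<xi>. exp (- cip u \<xi>) - 1)) \<le> K * (1 + norm u) * S"
      have "norm (L u) \<le> norm (adj_c B u) + norm (cmat \<gamma>) + norm (mat_integral \<mu> (\<lambda>\<xi>. exp (- cip u \<xi>) - 1))"
        unfolding L_def by norm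
      then show ?thesis using k(1)[of u] m by linarith
    qed
    also have "\<dots> \<le> (k + norm (cmat \<gamma>) + K * S) * (1 + norm u)"
      using k(2) by (simp add: algebra_simps)
    finally show ?thesis .
  qed
  then show ?thesis using k(2) K(1) S by (intro that[of "k + norm (cmat \<gamma>) + K * S"]) auto
qed

text \<open>Transposing \<open>u ** cmat \<alpha> ** u\<close> reverses symmetric factors, and the
  other terms have symmetric entry formulas. Symmetry is what lets the integral of \<open>R\<close>
  be identified by its pairings with the cone.\<close>

lemma R_sym:
  assumes u: "\<And>k l. u$k$l = u$l$k"
  shows "R u $ k $ l = R u $ l $ k"
proof -
  have \<alpha>: "\<alpha>$k$l = \<alpha>$l$k" and \<gamma>: "\<gamma>$k$l = \<gamma>$l$k" for k l
    using Sdp_Sd[OF \<alpha>_Sdp] Sdp_Sd[OF \<gamma>_Sdp] by (simp_all add: Sd_iff)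
  have "(u ** cmat \<alpha> ** u) $ k $ l = (\<Sum>j\<in>UNIV. \<Sum>i\<in>UNIV. u$k$i * complex_of_real (\<alpha>$i$j) * u$j$l)" for k l
    by (simp add: matrix_matrix_mult_def cmat_def sum_distrib_right)
  moreover have "(\<Sum>j\<in>UNIV. \<Sum>i\<in>UNIV. u$k$i * complex_of_real (\<alpha>$i$j) * u$j$l)
      = (\<Sum>j\<in>UNIV. \<Sum>i\<in>UNIV. u$l$i * complex_of_real (\<alpha>$i$j) * u$j$k)"
  proof (subst sum.swap, intro sum.cong refl)
    show "u$k$i * complex_of_real (\<alpha>$i$j) * u$j$l = u$l$j * complex_of_real (\<alpha>$j$i) * u$i$k" for i j
      using u[of k i] u[of j l] \<alpha>[of i j] by simp
  qed
  ultimately have 1: "(u ** cmat \<alpha> ** u) $ k $ l = (u ** cmat \<alpha> ** u) $ l $ k" by simp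
  have "Esym k l = Esym l k" by (simp add: Esym_def vec_eq_iff add.commute)
  then have 2: "adj_c B u $ k $ l = adj_c B u $ l $ k" by (simp add: adj_c_def)
  have "Epair k l = Epair l k" by (simp add: Epair_def vec_eq_iff disj_commute)
  then have 3: "mat_integral \<mu> (\<lambda>\<xi>. exp (- cip u \<xi>) - 1) $ k $ l
      = mat_integral \<mu> (\<lambda>\<xi>. exp (- cip u \<xi>) - 1) $ l $ k"
    by (simp add: mat_integral_nth)
  show ?thesis using 1 2 3 \<gamma>[of k l] by (simp add: R_def cmat_def)
qed

end

section \<open>Affine transition kernels\<close>

text \<open>The bound \<open>C\<close> makes the inner and outer integrals finite, so
  \<open>nn_integral_bind\<close> passes to real-valued integrals.\<close>

lemma integral_bind_nonneg:
  fixes f :: "'b \<Rightarrow> real"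
  assumes M: "subprob_space M" and sp: "space M \<noteq> {}" and K: "K \<in> measurable M (subprob_algebra N)"
    and f: "f \<in> borel_measurable N" "\<And>x. 0 \<le> f x" "\<And>x. f x \<le> C"
  shows "integral\<^sup>L (M \<bind> K) f = (\<integral>y. integral\<^sup>L (K y) f \<partial>M)"
proof -
  interpret subprob_space M by (rule M)
  have sets: "sets (M \<bind> K) = sets N" by (rule sets_bind[OF _ sp]) (use K in \<open>simp add: sets_kernel\<close>)
  have C: "0 \<le> C" using f(2,3) order_trans by blast
  have K_space: "K y \<in> space (subprob_algebra N)" if "y \<in> space M" for y
    using measurable_space[OF K that] .
  have inner: "(\<integral>\<^sup>+x. f x \<partial>K y) = ennreal (integral\<^sup>L (K y) f)" and
    le: "integral\<^sup>L (K y) f \<le> C" if "y \<in> space M" for y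
  proof -
    interpret K: subprob_space "K y" using K_space[OF that] by (simp add: space_subprob_algebra)
    have [measurable]: "f \<in> borel_measurable (K y)"
      using f(1) K_space[OF that] by (simp add: space_subprob_algebra measurable_cong_sets[of "K y" N])
    have int: "integrable (K y) f"
      by (rule K.integrable_const_bound[where B=C]) (use f in auto)
    then show "(\<integral>\<^sup>+x. f x \<partial>K y) = ennreal (integral\<^sup>L (K y) f)"
      by (rule nn_integral_eq_integral) (simp add: f)
    have "integral\<^sup>L (K y) f \<le> integral\<^sup>L (K y) (\<lambda>_. C)"
      by (rule integral_mono[OF int]) (use f in auto)
    also have "\<dots> \<le> C" using K.subprob_measure_le_1[of "space (K y)"] C
      by (simp add: mult_left_le_one_le)
    finally show "integral\<^sup>L (K y) f \<le> C" .
  qed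
  have hm: "(\<lambda>y. integral\<^sup>L (K y) f) \<in> borel_measurable M"
    using measurable_compose[OF K integral_measurable_subprob_algebra[OF f(1)]] .
  have hpos: "0 \<le> integral\<^sup>L (K y) f" for y using f by simp
  have "integrable M (\<lambda>y. integral\<^sup>L (K y) f)"
    by (rule integrable_const_bound[where B=C]) (use hm hpos le in \<open>auto intro!: AE_I2\<close>)
  then have "ennreal (\<integral>y. integral\<^sup>L (K y) f \<partial>M) = (\<integral>\<^sup>+y. ennreal (integral\<^sup>L (K y) f) \<partial>M)"
    by (intro nn_integral_eq_integral[symmetric]) (auto simp: hpos)
  also have "\<dots> = (\<integral>\<^sup>+y. \<integral>\<^sup>+x. f x \<partial>K y \<partial>M)"
    by (intro nn_integral_cong) (simp add: inner)
  also have "\<dots> = (\<integral>\<^sup>+x. f x \<partial>(M \<bind> K))"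
    by (rule nn_integral_bind[symmetric]) (use K f(1) in auto)
  finally have "integral\<^sup>L (M \<bind> K) f = enn2real (ennreal (\<integral>y. integral\<^sup>L (K y) f \<partial>M))"
    using f by (subst integral_eq_nn_integral) (simp_all add: measurable_cong_sets[OF sets refl])
  then show ?thesis using hpos by simp
qed

text \<open>Positive and negative parts share the bound \<open>C\<close> and are treated
  separately.\<close>

lemma integral_bind_bounded:
  fixes f :: "'b \<Rightarrow> real"
  assumes M: "subprob_space M" and sp: "space M \<noteq> {}" and K: "K \<in> measurable M (subprob_algebra N)"
    and f: "f \<in> borel_measurable N" "\<And>x. \<bar>f x\<bar> \<le> C"
  shows "integral\<^sup>L (M \<bind> K) f = (\<integral>y. integral\<^sup>L (K y) f \<partial>M)"
proof -
  interpret subprob_space M by (rule M)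
  have sets: "sets (M \<bind> K) = sets N" by (rule sets_bind[OF _ sp]) (use K in \<open>simp add: sets_kernel\<close>)
  have C: "0 \<le> C" using f(2) abs_ge_zero order_trans by blast
  have sub: "subprob_space (K y)" "sets (K y) = sets N" if "y \<in> space M" for y
    using measurable_space[OF K that] by (simp_all add: space_subprob_algebra)
  have fb: "f x \<le> C" "- f x \<le> C" for x using f(2)[of x] by auto
  have split: "integral\<^sup>L Q f = integral\<^sup>L Q (\<lambda>x. max 0 (f x)) - integral\<^sup>L Q (\<lambda>x. max 0 (- f x))"
    if "finite_measure Q" "sets Q = sets N" for Q
  proof -
    interpret Q: finite_measure Q by fact
    have [measurable]: "f \<in> borel_measurable Q" using f(1) that(2) by (simp add: measurable_cong_sets[of Q N])
    have 1: "integrable Q (\<lambda>x. max 0 (f x))"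
      by (rule Q.integrable_const_bound[where B=C]) (use fb C in \<open>auto intro!: AE_I2\<close>)
    have 2: "integrable Q (\<lambda>x. max 0 (- f x))"
      by (rule Q.integrable_const_bound[where B=C]) (use fb C in \<open>auto intro!: AE_I2\<close>)
    show ?thesis
      by (subst Bochner_Integration.integral_diff[OF 1 2, symmetric]) (auto intro!: Bochner_Integration.integral_cong)
  qed
  have bind: "integral\<^sup>L (M \<bind> K) h = (\<integral>y. integral\<^sup>L (K y) h \<partial>M)"
      "integrable M (\<lambda>y. integral\<^sup>L (K y) h)"
    if h: "h \<in> borel_measurable N" "\<And>x. 0 \<le> h x" "\<And>x. h x \<le> C" for h
  proof -
    show "integral\<^sup>L (M \<bind> K) h = (\<integral>y. integral\<^sup>L (K y) h \<partial>M)"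
      by (rule integral_bind_nonneg[OF M sp K h])
    show "integrable M (\<lambda>y. integral\<^sup>L (K y) h)"
    proof (rule integrable_const_bound[where B=C])
      show "AE y in M. norm (integral\<^sup>L (K y) h) \<le> C"
      proof (rule AE_I2)
        fix y assume y: "y \<in> space M"
        interpret K: subprob_space "K y" using sub(1)[OF y] .
        have [measurable]: "h \<in> borel_measurable (K y)" using h(1) sub(2)[OF y] by (simp add: measurable_cong_sets[of "K y" N])
        have "integral\<^sup>L (K y) h \<le> integral\<^sup>L (K y) (\<lambda>_. C)"
          by (rule integral_mono[OF K.integrable_const_bound[where B=C]]) (use h in auto)
        also have "\<dots> \<le> C" using K.subprob_measure_le_1[of "space (K y)"] C
          by (simp add: mult_left_le_one_le)
        finally show "norm (integral\<^sup>L (K y) h) \<le> C" using h by simp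
      qed
    qed (rule measurable_compose[OF K integral_measurable_subprob_algebra[OF h(1)]])
  qed
  have 1: "(\<lambda>x. max 0 (f x)) \<in> borel_measurable N" and 2: "(\<lambda>x. max 0 (- f x)) \<in> borel_measurable N"
    using f(1) by measurable
  have b1: "max 0 (f x) \<le> C" and b2: "max 0 (- f x) \<le> C" for x using f(2)[of x] C by auto
  have "finite_measure (M \<bind> K)"
    using subprob_space_bind[OF M K] subprob_space.axioms(1) by blast
  then have "integral\<^sup>L (M \<bind> K) f = (\<integral>y. integral\<^sup>L (K y) (\<lambda>x. max 0 (f x)) \<partial>M) - (\<integral>y. integral\<^sup>L (K y) (\<lambda>x. max 0 (- f x)) \<partial>M)"
    using split[of "M \<bind> K"] sets bind(1)[OF 1 _ b1] bind(1)[OF 2 _ b2] by simp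
  also have "\<dots> = (\<integral>y. integral\<^sup>L (K y) (\<lambda>x. max 0 (f x)) - integral\<^sup>L (K y) (\<lambda>x. max 0 (- f x)) \<partial>M)"
    using bind(2)[OF 1 _ b1] bind(2)[OF 2 _ b2] by (intro Bochner_Integration.integral_diff[symmetric]) auto
  also have "\<dots> = (\<integral>y. integral\<^sup>L (K y) f \<partial>M)"
    by (intro Bochner_Integration.integral_cong refl, rule split[symmetric])
       (simp_all add: sub subprob_space.axioms(1))
  finally show ?thesis .
qed

lemma continuous_cexp_cip: "continuous_on S (\<lambda>\<xi>. exp (- cip u \<xi>))"
  by (intro continuous_intros cip.continuous_on)

lemma norm_exp_cip_le: "u \<in> CSdp \<Longrightarrow> \<xi> \<in> Sdp \<Longrightarrow> norm (exp (- cip u \<xi>)) \<le> 1"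
  using Re_cip_nonneg[of u \<xi>] by simp

lemma cmat_CSdp: "v \<in> Sdp \<Longrightarrow> cmat v \<in> CSdp"
  using subspace_0[OF subspace_Sd] by (simp add: CSdp_iff)

text \<open>The content of \<open>affine_transition\<close> with its existential opened, so that the
  real exponents \<open>\<phi>0\<close> and \<open>\<psi>0\<close> are named.\<close>

locale affine_kernel =
  fixes p :: "real \<Rightarrow> real^'d^'d \<Rightarrow> (real^'d^'d) measure"
    and \<phi>0 :: "real \<Rightarrow> real^'d^'d \<Rightarrow> real" and \<psi>0 :: "real \<Rightarrow> real^'d^'d \<Rightarrow> real^'d^'d"
  assumes sets_p: "0 \<le> t \<Longrightarrow> x \<in> Sdp \<Longrightarrow> sets (p t x) = sets borel"
    and mass_p: "0 \<le> t \<Longrightarrow> x \<in> Sdp \<Longrightarrow> emeasure (p t x) UNIV \<le> 1"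
    and null_p: "0 \<le> t \<Longrightarrow> x \<in> Sdp \<Longrightarrow> emeasure (p t x) (UNIV - Sdp) = 0"
    and measurable_p: "0 \<le> t \<Longrightarrow> A \<in> sets borel \<Longrightarrow>
      (\<lambda>x. emeasure (p t x) A) \<in> borel_measurable (restrict_space borel Sdp)"
    and p_0: "x \<in> Sdp \<Longrightarrow> A \<in> sets borel \<Longrightarrow> emeasure (p 0 x) A = indicator A x"
    and chapman_kolmogorov: "0 \<le> s \<Longrightarrow> 0 \<le> t \<Longrightarrow> x \<in> Sdp \<Longrightarrow> A \<in> sets borel \<Longrightarrow>
      emeasure (p (s + t) x) A = (\<integral>\<^sup>+ y. emeasure (p t y) A * indicator Sdp y \<partial>(p s x))"
    and stoch_cont: "x \<in> Sdp \<Longrightarrow> 0 \<le> s \<Longrightarrow> continuous_on Sdp f \<Longrightarrow> bounded (f ` Sdp) \<Longrightarrow>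
      ((\<lambda>t. set_lebesgue_integral (p t x) Sdp f) \<longlongrightarrow> set_lebesgue_integral (p s x) Sdp (f :: _ \<Rightarrow> real))
        (at s within {0..})"
    and \<psi>0_Sdp: "0 \<le> t \<Longrightarrow> u \<in> Sdp \<Longrightarrow> \<psi>0 t u \<in> Sdp"
    and affine: "0 \<le> t \<Longrightarrow> x \<in> Sdp \<Longrightarrow> u \<in> Sdp \<Longrightarrow>
      set_lebesgue_integral (p t x) Sdp (\<lambda>\<xi>. exp (- ip u \<xi>)) = exp (- \<phi>0 t u - ip (\<psi>0 t u) x)"
begin

definition g :: "real \<Rightarrow> real^'d^'d \<Rightarrow> complex^'d^'d \<Rightarrow> complex" where
  "g t x u = set_lebesgue_integral (p t x) Sdp (\<lambda>\<xi>. exp (- cip u \<xi>))"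

lemma space_p: "0 \<le> t \<Longrightarrow> x \<in> Sdp \<Longrightarrow> space (p t x) = UNIV"
  using sets_eq_imp_space_eq[OF sets_p] by simp

lemma measurable_p_iff: "0 \<le> t \<Longrightarrow> x \<in> Sdp \<Longrightarrow> measurable (p t x) N = measurable borel N"
  by (rule measurable_cong_sets[OF sets_p refl])

lemma subprob_p: "0 \<le> t \<Longrightarrow> x \<in> Sdp \<Longrightarrow> subprob_space (p t x)"
  by (rule subprob_spaceI) (simp_all add: space_p mass_p)

lemma finite_p: "0 \<le> t \<Longrightarrow> x \<in> Sdp \<Longrightarrow> finite_measure (p t x)"
  using subprob_p subprob_space.axioms(1) by blast

lemma measure_p_le: "0 \<le> t \<Longrightarrow> x \<in> Sdp \<Longrightarrow> measure (p t x) UNIV \<le> 1"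
  using subprob_space.subprob_measure_le_1[OF subprob_p] by blast

lemma AE_p: "0 \<le> t \<Longrightarrow> x \<in> Sdp \<Longrightarrow> AE \<xi> in p t x. \<xi> \<in> Sdp"
  by (rule AE_I[of _ _ "UNIV - Sdp"]) (auto simp: null_p sets_p)

lemma set_integral_p:
  fixes f :: "_ \<Rightarrow> 'b::{banach, second_countable_topology}"
  assumes "0 \<le> t" "x \<in> Sdp" "f \<in> borel_measurable borel"
  shows "set_lebesgue_integral (p t x) Sdp f = integral\<^sup>L (p t x) f"
  unfolding set_lebesgue_integral_def
proof (rule integral_cong_AE)
  show "AE \<xi> in p t x. indicat_real Sdp \<xi> *\<^sub>R f \<xi> = f \<xi>"
    using AE_p[OF assms(1,2)] by eventually_elim simp
  show "(\<lambda>\<xi>. indicat_real Sdp \<xi> *\<^sub>R f \<xi>) \<in> borel_measurable (p t x)" "f \<in> borel_measurable (p t x)"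
    using assms(3) unfolding measurable_p_iff[OF assms(1,2)] by measurable
qed

lemma integrable_p:
  fixes f :: "_ \<Rightarrow> 'b::{banach, second_countable_topology}"
  assumes "0 \<le> t" "x \<in> Sdp" "f \<in> borel_measurable borel" "\<And>\<xi>. \<xi> \<in> Sdp \<Longrightarrow> norm (f \<xi>) \<le> C"
  shows "integrable (p t x) f"
proof (rule finite_measure.integrable_const_bound[OF finite_p[OF assms(1,2)], where B=C])
  show "AE \<xi> in p t x. norm (f \<xi>) \<le> C"
    using AE_p[OF assms(1,2)] by eventually_elim (rule assms(4))
qed (use assms in \<open>simp add: measurable_p_iff\<close>)

lemma integral_p_norm_le:
  fixes f :: "_ \<Rightarrow> 'b::{banach, second_countable_topology}"
  assumes t: "0 \<le> t" "x \<in> Sdp" and f: "f \<in> borel_measurable borel"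
    and le: "\<And>\<xi>. \<xi> \<in> Sdp \<Longrightarrow> norm (f \<xi>) \<le> h \<xi>" and h: "integrable (p t x) h"
  shows "norm (integral\<^sup>L (p t x) f) \<le> integral\<^sup>L (p t x) h"
proof -
  have AE: "AE \<xi> in p t x. norm (f \<xi>) \<le> h \<xi>"
    using AE_p[OF t] by eventually_elim (rule le)
  have "integrable (p t x) f"
  proof (rule Bochner_Integration.integrable_bound[OF h])
    show "AE \<xi> in p t x. norm (f \<xi>) \<le> norm (h \<xi>)" using AE by eventually_elim auto
  qed (use t f in \<open>simp add: measurable_p_iff\<close>)
  then show ?thesis
    by (rule order_trans[OF integral_norm_bound integral_mono_AE[OF integrable_norm h AE]])
qed

lemma integral_p_norm_le_const:
  fixes f :: "_ \<Rightarrow> 'b::{banach, second_countable_topology}"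
  assumes t: "0 \<le> t" "x \<in> Sdp" and f: "f \<in> borel_measurable borel"
    and le: "\<And>\<xi>. \<xi> \<in> Sdp \<Longrightarrow> norm (f \<xi>) \<le> C" and C: "0 \<le> C"
  shows "norm (integral\<^sup>L (p t x) f) \<le> C"
proof -
  interpret finite_measure "p t x" by (rule finite_p[OF t])
  have "norm (integral\<^sup>L (p t x) f) \<le> (\<integral>_. C \<partial>p t x)"
    by (rule integral_p_norm_le[OF t f le]) auto
  also have "\<dots> \<le> C" using measure_p_le[OF t] C by (simp add: space_p[OF t] mult_left_le_one_le)
  finally show ?thesis .
qed

lemma g_eq: "0 \<le> t \<Longrightarrow> x \<in> Sdp \<Longrightarrow> g t x u = (\<integral>\<xi>. exp (- cip u \<xi>) \<partial>p t x)"
  unfolding g_def by (rule set_integral_p) simp_all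

lemma integrable_exp_cip: "0 \<le> t \<Longrightarrow> x \<in> Sdp \<Longrightarrow> u \<in> CSdp \<Longrightarrow> integrable (p t x) (\<lambda>\<xi>. exp (- cip u \<xi>))"
  by (rule integrable_p[where C=1]) (auto simp: norm_exp_cip_le simp del: norm_exp_eq_Re)

lemma norm_g_le_1: "0 \<le> t \<Longrightarrow> x \<in> Sdp \<Longrightarrow> u \<in> CSdp \<Longrightarrow> norm (g t x u) \<le> 1"
  unfolding g_eq by (rule integral_p_norm_le_const) (auto simp: norm_exp_cip_le simp del: norm_exp_eq_Re)

lemma real_transform:
  assumes "0 \<le> t" "x \<in> Sdp" "v \<in> Sdp"
  shows "(\<integral>\<xi>. exp (- ip v \<xi>) \<partial>p t x) = exp (- \<phi>0 t v - ip (\<psi>0 t v) x)"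
proof -
  have "(\<lambda>\<xi>. exp (- ip v \<xi>)) \<in> borel_measurable borel"
    by (intro borel_measurable_continuous_onI continuous_intros ip.continuous_on)
  then show ?thesis using affine[OF assms] set_integral_p[OF assms(1,2), of "\<lambda>\<xi>. exp (- ip v \<xi>)"] by simp
qed

lemma g_cmat:
  assumes "0 \<le> t" "x \<in> Sdp" "v \<in> Sdp"
  shows "g t x (cmat v) = complex_of_real (exp (- \<phi>0 t v - ip (\<psi>0 t v) x))"
proof -
  have "g t x (cmat v) = (\<integral>\<xi>. complex_of_real (exp (- ip v \<xi>)) \<partial>p t x)"
    using assms by (simp add: g_eq cip_cmat exp_of_real[symmetric])
  also have "\<dots> = complex_of_real (\<integral>\<xi>. exp (- ip v \<xi>) \<partial>p t x)" by (rule integral_complex_of_real)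
  finally show ?thesis by (simp add: real_transform[OF assms])
qed

text \<open>The modulus of the integrand is the real exponential at \<open>re_mat u\<close>, whose
  transform is known. This controls the decay of the complex transform in \<open>x\<close>.\<close>

lemma norm_g_le:
  assumes "0 \<le> t" "x \<in> Sdp" "u \<in> CSdp"
  shows "norm (g t x u) \<le> exp (- \<phi>0 t (re_mat u) - ip (\<psi>0 t (re_mat u)) x)"
proof -
  have v: "re_mat u \<in> Sdp" using assms(3) by (simp add: CSdp_iff)
  have "norm (g t x u) \<le> (\<integral>\<xi>. exp (- ip (re_mat u) \<xi>) \<partial>p t x)"
    unfolding g_eq[OF assms(1,2)]
  proof (rule integral_p_norm_le[OF assms(1,2)])
    show "integrable (p t x) (\<lambda>\<xi>. exp (- ip (re_mat u) \<xi>))"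
      by (rule integrable_p[OF assms(1,2), where C=1])
         (auto intro!: borel_measurable_continuous_onI continuous_intros ip.continuous_on ip_Sdp_nonneg[OF v])
  qed (simp_all add: Re_cip)
  then show ?thesis by (simp add: real_transform[OF assms(1,2) v])
qed

lemma integral_p_0:
  fixes f :: "_ \<Rightarrow> complex"
  assumes x: "x \<in> Sdp" and f: "f \<in> borel_measurable borel"
  shows "integral\<^sup>L (p 0 x) f = f x"
proof -
  have "p 0 x = return borel x"
    by (rule measure_eqI) (use x sets_p[of 0 x] p_0 in \<open>auto simp: emeasure_return\<close>)
  then show ?thesis using f by (simp add: integral_return)
qed

lemma g_0: "x \<in> Sdp \<Longrightarrow> g 0 x u = exp (- cip u x)"
  using integral_p_0[of x "\<lambda>\<xi>. exp (- cip u \<xi>)"] by (simp add: g_eq)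

lemma integral_p_complex_eq:
  fixes f :: "_ \<Rightarrow> complex"
  assumes "0 \<le> t" "x \<in> Sdp" "f \<in> borel_measurable borel" "\<And>\<xi>. \<xi> \<in> Sdp \<Longrightarrow> norm (f \<xi>) \<le> C"
  shows "integral\<^sup>L (p t x) f = Complex (\<integral>\<xi>. Re (f \<xi>) \<partial>p t x) (\<integral>\<xi>. Im (f \<xi>) \<partial>p t x)"
  using integrable_p[OF assms] by (simp add: complex_eq_iff)

text \<open>Stochastic continuity speaks of real functions bounded on the cone, so real and
  imaginary parts are handled separately.\<close>

lemma continuous_on_time:
  fixes f :: "_ \<Rightarrow> complex"
  assumes x: "x \<in> Sdp" and f: "continuous_on UNIV f" and C: "\<And>\<xi>. \<xi> \<in> Sdp \<Longrightarrow> norm (f \<xi>) \<le> C"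
  shows "continuous_on {0..} (\<lambda>t. integral\<^sup>L (p t x) f)"
proof -
  have fm: "f \<in> borel_measurable borel" by (rule borel_measurable_continuous_onI[OF f])
  have cont: "continuous_on {0..} (\<lambda>t. integral\<^sup>L (p t x) h)"
    if h: "continuous_on UNIV h" "\<And>\<xi>. \<xi> \<in> Sdp \<Longrightarrow> \<bar>h \<xi>\<bar> \<le> C" for h :: "_ \<Rightarrow> real"
    unfolding continuous_on_def
  proof
    fix s :: real assume s: "s \<in> {0..}"
    have "((\<lambda>t. set_lebesgue_integral (p t x) Sdp h) \<longlongrightarrow> set_lebesgue_integral (p s x) Sdp h) (at s within {0..})"
      using s h by (intro stoch_cont[OF x]) (auto intro: continuous_on_subset simp: bounded_iff)
    moreover have "\<forall>\<^sub>F t in at s within {0..}. set_lebesgue_integral (p t x) Sdp h = integral\<^sup>L (p t x) h"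
      unfolding eventually_at_filter
      by (rule always_eventually)
        (auto intro!: set_integral_p x borel_measurable_continuous_onI h)
    ultimately show "((\<lambda>t. integral\<^sup>L (p t x) h) \<longlongrightarrow> integral\<^sup>L (p s x) h) (at s within {0..})"
      using s x set_integral_p[of s x h] borel_measurable_continuous_onI[OF h(1)]
      by (simp add: tendsto_cong)
  qed
  have "continuous_on {0..} (\<lambda>t. Complex (\<integral>\<xi>. Re (f \<xi>) \<partial>p t x) (\<integral>\<xi>. Im (f \<xi>) \<partial>p t x))"
    using C abs_Re_le_cmod abs_Im_le_cmod
    by (intro continuous_on_Complex cont continuous_intros f) (meson order_trans)+
  then show ?thesis
    by (rule continuous_on_eq) (use integral_p_complex_eq[OF _ x fm C] in auto)
qed

lemma continuous_on_g: "x \<in> Sdp \<Longrightarrow> u \<in> CSdp \<Longrightarrow> continuous_on {0..} (\<lambda>t. g t x u)"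
  by (rule continuous_on_eq[OF continuous_on_time[of x "\<lambda>\<xi>. exp (- cip u \<xi>)" 1]])
     (auto simp: g_eq norm_exp_cip_le continuous_cexp_cip simp del: norm_exp_eq_Re)

lemma tendsto_g_param:
  assumes t: "0 \<le> t" "x \<in> Sdp" and U: "\<And>n. U n \<in> CSdp" "U \<longlonglongrightarrow> u"
  shows "(\<lambda>n. g t x (U n)) \<longlonglongrightarrow> g t x u"
proof -
  interpret finite_measure "p t x" by (rule finite_p[OF t])
  show ?thesis unfolding g_eq[OF t]
  proof (rule integral_dominated_convergence[where w="\<lambda>_. 1"])
    show "AE \<xi> in p t x. (\<lambda>n. exp (- cip (U n) \<xi>)) \<longlonglongrightarrow> exp (- cip u \<xi>)"
      by (intro AE_I2 tendsto_intros cip.tendsto U)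
    show "AE \<xi> in p t x. norm (exp (- cip (U n) \<xi>)) \<le> 1" for n
      using AE_p[OF t] by eventually_elim (rule norm_exp_cip_le[OF U(1)])
  qed (simp_all add: measurable_p_iff[OF t])
qed

text \<open>Extension by the null measure outside the cone, which makes the kernel a measurable map
  from all matrices into \<open>subprob_algebra borel\<close>.\<close>

definition kernel :: "real \<Rightarrow> real^'d^'d \<Rightarrow> (real^'d^'d) measure" where
  "kernel t y = (if y \<in> Sdp then p t y else null_measure borel)"

lemma kernel_measurable:
  assumes "0 \<le> t"
  shows "kernel t \<in> measurable borel (subprob_algebra borel)"
proof (rule measurable_subprob_algebra)
  show "subprob_space (kernel t a)" for a
    using subprob_p[OF assms] by (auto simp: kernel_def intro!: subprob_spaceI)
  show "sets (kernel t a) = sets borel" for a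
    using sets_p[OF assms] by (simp add: kernel_def)
  show "(\<lambda>a. emeasure (kernel t a) A) \<in> borel_measurable borel" if "A \<in> sets borel" for A
  proof -
    have "(\<lambda>x. emeasure (p t x) A * indicator Sdp x) \<in> borel_measurable borel"
      using measurable_p[OF assms that] by (subst (asm) borel_measurable_restrict_space_iff_ennreal) auto
    moreover have "emeasure (kernel t a) A = emeasure (p t a) A * indicator Sdp a" for a
      by (simp add: kernel_def)
    ultimately show ?thesis by simp
  qed
qed

lemma p_bind:
  assumes "0 \<le> s" "0 \<le> t" "x \<in> Sdp"
  shows "p (s + t) x = p s x \<bind> kernel t"
proof (rule measure_eqI)
  have K: "kernel t \<in> measurable (p s x) (subprob_algebra borel)"
    using kernel_measurable[OF assms(2)] by (simp add: measurable_p_iff assms)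
  have sp: "space (p s x) \<noteq> {}" by (simp add: space_p assms)
  show "sets (p (s + t) x) = sets (p s x \<bind> kernel t)"
    using sets_bind[of "p s x" "kernel t" borel] K sp assms by (simp add: sets_p sets_kernel[OF K])
  fix A assume "A \<in> sets (p (s + t) x)"
  then have A: "A \<in> sets borel" using assms by (simp add: sets_p)
  have "emeasure (p (s + t) x) A = (\<integral>\<^sup>+ y. emeasure (kernel t y) A \<partial>(p s x))"
    unfolding chapman_kolmogorov[OF assms A] by (intro nn_integral_cong) (simp add: kernel_def)
  also have "\<dots> = emeasure (p s x \<bind> kernel t) A"
    by (rule emeasure_bind[OF sp K A, symmetric])
  finally show "emeasure (p (s + t) x) A = emeasure (p s x \<bind> kernel t) A" .
qed

text \<open>\<open>h\<close> is any version of the transform \<open>g t y u\<close>, as a function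
  of \<open>y\<close>, that is measurable on all matrices; \<open>p s x\<close> sees only its values
  on the cone.\<close>

lemma g_chapman_kolmogorov:
  assumes st: "0 \<le> s" "0 \<le> t" and x: "x \<in> Sdp" and u: "u \<in> CSdp"
    and h: "h \<in> borel_measurable borel" "\<And>y. y \<in> Sdp \<Longrightarrow> g t y u = h y"
  shows "g (s + t) x u = integral\<^sup>L (p s x) h"
proof -
  \<comment> \<open>Cut off outside the cone, where the exponential may be unbounded, because
    \<open>integral_bind_bounded\<close> asks for a global bound.\<close>
  define f where "f \<xi> = (if \<xi> \<in> Sdp then exp (- cip u \<xi>) else 0)" for \<xi>
  have f: "f \<in> borel_measurable borel" unfolding f_def by measurable
  have f1: "norm (f \<xi>) \<le> 1" for \<xi> using norm_exp_cip_le[OF u] by (simp add: f_def del: norm_exp_eq_Re)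
  have gf: "g r y u = integral\<^sup>L (p r y) f" if "0 \<le> r" "y \<in> Sdp" for r y
    unfolding g_eq[OF that]
  proof (rule integral_cong_AE)
    show "AE \<xi> in p r y. exp (- cip u \<xi>) = f \<xi>" using AE_p[OF that] by eventually_elim (simp add: f_def)
  qed (use f in \<open>simp_all add: measurable_p_iff[OF that]\<close>)
  have h1: "norm (h y) \<le> 1" if "y \<in> Sdp" for y using norm_g_le_1[OF st(2) that u] h(2)[OF that] by simp
  have K: "kernel t \<in> measurable (p s x) (subprob_algebra borel)"
    using kernel_measurable[OF st(2)] by (simp add: measurable_p_iff st x)
  have sp: "space (p s x) \<noteq> {}" by (simp add: space_p st x)
  \<comment> \<open>A real-linear \<open>r\<close> of norm at most 1 covers real and imaginary part
    together.\<close>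
  have real_part: "(\<integral>\<xi>. r (f \<xi>) \<partial>p (s + t) x) = (\<integral>y. r (h y) \<partial>p s x)"
    if r: "bounded_linear r" "\<And>z. \<bar>r z\<bar> \<le> cmod z" for r :: "complex \<Rightarrow> real"
  proof -
    have rm: "r \<in> borel_measurable borel"
      using r(1) by (intro borel_measurable_continuous_onI linear_continuous_on)
    have "(\<integral>\<xi>. r (f \<xi>) \<partial>p (s + t) x) = (\<integral>y. integral\<^sup>L (kernel t y) (\<lambda>\<xi>. r (f \<xi>)) \<partial>p s x)"
      unfolding p_bind[OF st x]
    proof (rule integral_bind_bounded[OF subprob_p[OF st(1) x] sp K])
      show "(\<lambda>\<xi>. r (f \<xi>)) \<in> borel_measurable borel" by (rule measurable_compose[OF f rm])
      show "\<bar>r (f \<xi>)\<bar> \<le> 1" for \<xi> using r(2) f1 order_trans by blast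
    qed
    also have "\<dots> = (\<integral>y. r (h y) \<partial>p s x)"
    proof (rule integral_cong_AE)
      show "AE y in p s x. integral\<^sup>L (kernel t y) (\<lambda>\<xi>. r (f \<xi>)) = r (h y)"
        using AE_p[OF st(1) x]
      proof eventually_elim
        case (elim y)
        have "integrable (p t y) f" by (rule integrable_p[OF st(2) elim f]) (rule f1)
        then show ?case using elim by (simp add: kernel_def integral_bounded_linear[OF r(1)] gf[OF st(2) elim, symmetric] h(2)[OF elim])
      qed
      show "(\<lambda>y. integral\<^sup>L (kernel t y) (\<lambda>\<xi>. r (f \<xi>))) \<in> borel_measurable (p s x)"
        by (intro measurable_compose[OF K integral_measurable_subprob_algebra] measurable_compose[OF f rm])
      show "(\<lambda>y. r (h y)) \<in> borel_measurable (p s x)"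
        using rm h(1) by (simp add: measurable_p_iff st x)
    qed
    finally show ?thesis .
  qed
  have "g (s + t) x u = Complex (\<integral>\<xi>. Re (f \<xi>) \<partial>p (s + t) x) (\<integral>\<xi>. Im (f \<xi>) \<partial>p (s + t) x)"
    using gf[of "s + t" x] integral_p_complex_eq[of "s + t" x f 1] st x f f1 by simp
  also have "\<dots> = Complex (\<integral>y. Re (h y) \<partial>p s x) (\<integral>y. Im (h y) \<partial>p s x)"
    by (simp add: real_part bounded_linear_Re bounded_linear_Im abs_Re_le_cmod abs_Im_le_cmod)
  also have "\<dots> = integral\<^sup>L (p s x) h"
    using integral_p_complex_eq[OF st(1) x h(1) h1] by simp
  finally show ?thesis .
qed

end

section \<open>Laplace transforms and the real exponent\<close>

text \<open>Divide by \<open>l\<close> and let it grow. On rays \<open>l *\<^sub>R x\<close> this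
  compares exponents while discarding all constants independent of \<open>x\<close>.\<close>

lemma affine_le_imp_slope_le:
  fixes a a' A A' :: real
  assumes "\<And>l. 0 \<le> l \<Longrightarrow> A' + l * a' \<le> A + l * a"
  shows "a' \<le> a"
proof (rule ccontr)
  assume "\<not> a' \<le> a"
  then have d: "a' - a > 0" by simp
  \<comment> \<open>Large enough for the slope gap to exceed the difference of the
    constants.\<close>
  define l where "l = (\<bar>A - A'\<bar> + 1) / (a' - a)"
  have "A' + l * a' \<le> A + l * a" by (rule assms) (use d in \<open>simp add: l_def\<close>)
  moreover have "l * (a' - a) = \<bar>A - A'\<bar> + 1" using d by (simp add: l_def)
  ultimately show False by (simp add: algebra_simps)
qed

lemma CSdp_sym: "u \<in> CSdp \<Longrightarrow> u$k$l = u$l$k"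
  using Sdp_Sd[of "re_mat u"] by (auto simp: CSdp_iff Sd_iff re_mat_def im_mat_def complex_eq_iff)

lemma tendsto_cip_imp_tendsto:
  fixes U :: "'a \<Rightarrow> complex^'d^'d"
  assumes sym: "\<And>n k l. U n $ k $ l = U n $ l $ k" "\<And>k l. u$k$l = u$l$k"
    and lim: "\<And>x. x \<in> Sdp \<Longrightarrow> ((\<lambda>n. cip (U n) x) \<longlongrightarrow> cip u x) Fl"
  shows "(U \<longlongrightarrow> u) Fl"
proof (intro vec_tendstoI)
  fix k l
  have "((\<lambda>n. cip (U n) (Esym k l)) \<longlongrightarrow> cip u (Esym k l)) Fl"
    by (cases "k = l") (auto simp: Esym_diag Esym_offdiag cip.scaleR_right cip.diff_right
        intro!: tendsto_intros lim Ediag_Sdp Epair_Sdp)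
  moreover have "cip (U n) (Esym k l) = U n $ k $ l" for n using sym(1)[of n k l] by (simp add: cip_Esym)
  moreover have "cip u (Esym k l) = u $ k $ l" using sym(2)[of k l] by (simp add: cip_Esym)
  ultimately show "((\<lambda>n. U n $ k $ l) \<longlongrightarrow> u $ k $ l) Fl" by simp
qed

text \<open>Finite complex combinations of real exponentials, the functions on which the affine
  formula can be applied directly; \<open>v = 0\<close> gives the constants.\<close>

inductive laplace_comb :: "(real^'d^'d \<Rightarrow> complex) \<Rightarrow> bool" where
  exp: "v \<in> Sdp \<Longrightarrow> laplace_comb (\<lambda>\<xi>. a * exp (- cip (cmat v) \<xi>))"
| add: "laplace_comb f \<Longrightarrow> laplace_comb h \<Longrightarrow> laplace_comb (\<lambda>\<xi>. f \<xi> + h \<xi>)"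

lemma exp_cip_add: "exp (- cip u (x + y)) = exp (- cip u x) * exp (- cip u y)"
  by (simp add: cip.add_right exp_add[symmetric])

lemma laplace_comb_const: "laplace_comb (\<lambda>_. a)"
  using laplace_comb.exp[of 0 a] by (simp add: cip_cmat ip.zero_left)

text \<open>Exponentials multiply by adding their parameters, and the cone is closed under addition;
  so these functions form an algebra.\<close>

lemma laplace_comb_mult:
  assumes "laplace_comb f" "laplace_comb h"
  shows "laplace_comb (\<lambda>\<xi>. f \<xi> * h \<xi>)"
  using assms(1)
proof induction
  case (exp v a)
  show ?case using assms(2)
  proof induction
    case (exp w b)
    have "laplace_comb (\<lambda>\<xi>. (a * b) * exp (- cip (cmat (v + w)) \<xi>))"
      using exp \<open>v \<in> Sdp\<close> by (intro laplace_comb.exp Sdp_add)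
    then show ?case by (simp add: cip_cmat ip.add_left exp_diff exp_minus field_simps exp_add)
  next
    case (add f h)
    then show ?case using laplace_comb.add by (fastforce simp: ring_distribs)
  qed
next
  case (add f g)
  then show ?case using laplace_comb.add by (fastforce simp: ring_distribs)
qed

lemma laplace_comb_continuous: "laplace_comb f \<Longrightarrow> continuous_on UNIV f"
  by (induction rule: laplace_comb.induct) (intro continuous_intros cip.continuous_on; assumption?)+

lemma laplace_comb_measurable: "laplace_comb f \<Longrightarrow> f \<in> borel_measurable borel"
  by (intro borel_measurable_continuous_onI laplace_comb_continuous)

lemma laplace_comb_bounded: "laplace_comb f \<Longrightarrow> \<exists>C\<ge>0. \<forall>\<xi>\<in>Sdp. norm (f \<xi>) \<le> C"
proof (induction rule: laplace_comb.induct)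
  case (exp v a)
  have "norm (a * exp (- cip (cmat v) \<xi>)) \<le> norm a" if "\<xi> \<in> Sdp" for \<xi>
    using norm_exp_cip_le[OF cmat_CSdp[OF exp] that]
    by (simp add: norm_mult mult_left_le del: norm_exp_eq_Re)
  then show ?case by (intro exI[of _ "norm a"]) auto
next
  case (add f h)
  then obtain C D where "C \<ge> 0" "D \<ge> 0" "\<forall>\<xi>\<in>Sdp. norm (f \<xi>) \<le> C" "\<forall>\<xi>\<in>Sdp. norm (h \<xi>) \<le> D" by blast
  then show ?case by (intro exI[of _ "C + D"]) (auto intro!: norm_triangle_mono)
qed

lemma laplace_comb_real_polynomial:
  assumes "real_polynomial_function q" "v \<in> Sdp" "w \<in> Sdp"
  shows "laplace_comb (\<lambda>\<xi>. complex_of_real (q (exp (- ip v \<xi>), exp (- ip w \<xi>))))"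
  using assms(1)
proof induction
  case (linear f)
  have f: "f (x, y) = x * f (1, 0) + y * f (0, 1)" for x y
    using linear_add[OF bounded_linear.linear[OF linear], of "(x, 0)" "(0, y)"]
      linear_scale[OF bounded_linear.linear[OF linear], of x "(1, 0)"]
      linear_scale[OF bounded_linear.linear[OF linear], of y "(0, 1)"] by simp
  have "laplace_comb (\<lambda>\<xi>. complex_of_real (f (1, 0)) * exp (- cip (cmat v) \<xi>)
      + complex_of_real (f (0, 1)) * exp (- cip (cmat w) \<xi>))"
    by (intro laplace_comb.intros assms)
  moreover have "complex_of_real (f (exp (- ip v \<xi>), exp (- ip w \<xi>)))
      = complex_of_real (f (1, 0)) * exp (- cip (cmat v) \<xi>)
        + complex_of_real (f (0, 1)) * exp (- cip (cmat w) \<xi>)" for \<xi>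
    by (subst f) (simp only: of_real_add of_real_mult exp_of_real cip_cmat of_real_minus[symmetric] mult.commute)
  ultimately show ?case by simp
next
  case (const c)
  then show ?case by (rule laplace_comb_const)
next
  case (add f g)
  then show ?case using laplace_comb.add[OF add.IH] by simp
next
  case (mult f g)
  then show ?case using laplace_comb_mult[OF mult.IH] by simp
qed

text \<open>The power of \<open>a\<close> with complex exponent
  \<open>1/2 + \<i> * \<kappa>\<close>. The square root forces continuity at 0, where the phase may
  oscillate.\<close>

definition half_power :: "real \<Rightarrow> real \<Rightarrow> complex" where
  "half_power \<kappa> a = complex_of_real (sqrt a) * exp (\<i> * complex_of_real (\<kappa> * ln a))"

lemma norm_half_power: "norm (half_power \<kappa> a) = sqrt \<bar>a\<bar>"
  by (cases "0 \<le> a") (simp_all add: half_power_def norm_mult real_sqrt_minus)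

lemma continuous_on_half_power: "continuous_on {0..} (half_power \<kappa>)"
  unfolding continuous_on_def
proof
  fix a :: real assume a: "a \<in> {0..}"
  show "(half_power \<kappa> \<longlongrightarrow> half_power \<kappa> a) (at a within {0..})"
  proof (cases "a = 0")
    case True
    have "((\<lambda>a. norm (half_power \<kappa> a)) \<longlongrightarrow> sqrt \<bar>0\<bar>) (at 0 within {0..})"
      unfolding norm_half_power by (intro tendsto_intros)
    then show ?thesis using True tendsto_norm_zero_iff[of "half_power \<kappa>"] by (simp add: half_power_def)
  next
    case False
    then show ?thesis using a unfolding half_power_def by (intro tendsto_intros) auto
  qed
qed

lemma half_power_exp:
  "half_power \<kappa> (exp x) = exp (complex_of_real (x / 2) + \<i> * complex_of_real (\<kappa> * x))"
proof -
  have "sqrt (exp x) = exp (x / 2)"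
    by (rule real_sqrt_unique) (simp_all add: power2_eq_square flip: exp_add)
  then show ?thesis by (simp only: half_power_def exp_add exp_of_real ln_exp)
qed

text \<open>With \<open>a = exp (- ip (v + s w) \<xi>)\<close> and \<open>b = exp (- ip (v - s w) \<xi>)\<close>, the function
  \<open>exp (- cip (v + \<i> w) \<xi>)\<close> is continuous in \<open>(a, b)\<close> on the unit square, and
  monomials in \<open>(a, b)\<close> are real exponentials.\<close>
lemma laplace_comb_dense:
  fixes u :: "complex^'d^'d"
  assumes u: "re_mat u \<in> Spp" "im_mat u \<in> Sd" and e: "e > 0"
  obtains f where "laplace_comb f" "\<And>\<xi>. \<xi> \<in> Sdp \<Longrightarrow> norm (exp (- cip u \<xi>) - f \<xi>) \<le> e"
proof -
  obtain s where s: "s > 0" "\<And>r. \<bar>r\<bar> \<le> s \<Longrightarrow> re_mat u + r *\<^sub>R im_mat u \<in> Sdp"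
    using Spp_perturb[OF u] by blast
  define v where "v = re_mat u + s *\<^sub>R im_mat u"
  define w where "w = re_mat u + (- s) *\<^sub>R im_mat u"
  have vw: "v \<in> Sdp" "w \<in> Sdp" using s(1) s(2)[of s] s(2)[of "-s"] by (auto simp: v_def w_def)
  \<comment> \<open>\<open>v - w\<close> is \<open>2 * s\<close> times the imaginary part, so this
    \<kappa> turns the quotient of the two real exponentials into the phase of
    \<open>exp (- cip u \<xi>)\<close>.\<close>
  define \<kappa> where "\<kappa> = 1 / (2 * s)"
  define \<Psi> where "\<Psi> z = half_power \<kappa> (fst z) * half_power (- \<kappa>) (snd z)" for z
  have "continuous_on ({0..1} \<times> {0..1}) \<Psi>"
    unfolding \<Psi>_def
    by (intro continuous_intros continuous_on_compose2[OF continuous_on_half_power]) auto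
  moreover have "compact ({0..1::real} \<times> {0..1::real})" by (intro compact_Times compact_Icc)
  ultimately obtain q where q: "polynomial_function q" "\<And>z. z \<in> {0..1} \<times> {0..1} \<Longrightarrow> norm (\<Psi> z - q z) < e"
    using Stone_Weierstrass_polynomial_function[of "{0..1} \<times> {0..1}" \<Psi> e] e by blast
  define f where "f \<xi> = q (exp (- ip v \<xi>), exp (- ip w \<xi>))" for \<xi>
  have "real_polynomial_function (Re \<circ> q)" "real_polynomial_function (Im \<circ> q)"
    using q(1) bounded_linear_Re bounded_linear_Im unfolding polynomial_function_def by blast+
  from this[THEN laplace_comb_real_polynomial[OF _ vw]]
  have "laplace_comb (\<lambda>\<xi>. complex_of_real (Re (f \<xi>)))" "laplace_comb (\<lambda>\<xi>. complex_of_real (Im (f \<xi>)))"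
    by (simp_all add: f_def)
  then have "laplace_comb (\<lambda>\<xi>. complex_of_real (Re (f \<xi>)) + \<i> * complex_of_real (Im (f \<xi>)))"
    by (intro laplace_comb.add laplace_comb_mult laplace_comb_const)
  then have "laplace_comb f" by (simp add: complex_eq[symmetric])
  moreover have "norm (exp (- cip u \<xi>) - f \<xi>) \<le> e" if \<xi>: "\<xi> \<in> Sdp" for \<xi>
  proof -
    have "complex_of_real (- ip v \<xi> / 2) + \<i> * complex_of_real (\<kappa> * - ip v \<xi>)
        + (complex_of_real (- ip w \<xi> / 2) + \<i> * complex_of_real (- \<kappa> * - ip w \<xi>)) = - cip u \<xi>"
      using s(1) by (simp add: v_def w_def ip.add_left ip.diff_left ip.scaleR_left complex_eq_iff Re_cip Im_cip
          \<kappa>_def field_simps)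
    then have "\<Psi> (exp (- ip v \<xi>), exp (- ip w \<xi>)) = exp (- cip u \<xi>)"
      by (simp only: \<Psi>_def fst_conv snd_conv half_power_exp exp_add[symmetric])
    then show ?thesis
      using q(2)[of "(exp (- ip v \<xi>), exp (- ip w \<xi>))"] ip_Sdp_nonneg[OF vw(1) \<xi>] ip_Sdp_nonneg[OF vw(2) \<xi>]
      by (simp add: f_def)
  qed
  ultimately show ?thesis by (rule that)
qed

section \<open>Multiplicativity of the complex transform in the starting point\<close>

context affine_kernel
begin

lemma integrable_laplace_comb: "laplace_comb f \<Longrightarrow> 0 \<le> t \<Longrightarrow> x \<in> Sdp \<Longrightarrow> integrable (p t x) f"
proof -
  assume f: "laplace_comb f" and t: "0 \<le> t" "x \<in> Sdp"
  obtain K where "\<And>\<xi>. \<xi> \<in> Sdp \<Longrightarrow> norm (f \<xi>) \<le> K" using laplace_comb_bounded[OF f] by blast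
  then show ?thesis by (rule integrable_p[OF t laplace_comb_measurable[OF f]])
qed

lemma shifted_exp_integral:
  assumes "0 \<le> t" "x \<in> Sdp"
  shows "(\<integral>\<eta>. a * exp (- cip u (\<xi> + \<eta>)) \<partial>p t x) = (a * g t x u) * exp (- cip u \<xi>)"
  unfolding exp_cip_add g_eq[OF assms] by (simp add: mult.commute)

text \<open>Integrating over a shift multiplies each exponential by a constant, its transform. Inner
  integrals of double integrals are thus again Laplace combinations, with no measurability question
  left.\<close>

lemma laplace_comb_convolve:
  assumes "laplace_comb f" and t: "0 \<le> t" "x \<in> Sdp"
  shows "laplace_comb (\<lambda>\<xi>. \<integral>\<eta>. f (\<xi> + \<eta>) \<partial>p t x)"
    and "integrable (p t x) (\<lambda>\<eta>. f (\<xi> + \<eta>))"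
proof -
  have int: "integrable (p t x) (\<lambda>\<eta>. f (\<xi> + \<eta>))" if "laplace_comb f" for f \<xi>
    using that
  proof induction
    case (exp v a)
    have "integrable (p t x) (\<lambda>\<eta>. (a * exp (- cip (cmat v) \<xi>)) * exp (- cip (cmat v) \<eta>))"
      by (intro integrable_mult_right integrable_exp_cip t cmat_CSdp exp)
    then show ?case by (simp add: exp_cip_add mult.assoc)
  qed auto
  show "integrable (p t x) (\<lambda>\<eta>. f (\<xi> + \<eta>))" by (rule int[OF assms(1)])
  show "laplace_comb (\<lambda>\<xi>. \<integral>\<eta>. f (\<xi> + \<eta>) \<partial>p t x)" using assms(1)
  proof induction
    case (exp v a)
    show ?case unfolding shifted_exp_integral[OF t] by (rule laplace_comb.exp[OF exp])
  next
    case (add f h)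
    then show ?case using laplace_comb.add[OF add.IH] by (simp add: int)
  qed
qed

text \<open>Compares two convolutions, of \<open>p t (x + y)\<close> with \<open>p t 0\<close> and
  of \<open>p t x\<close> with \<open>p t y\<close>. On a single exponential both give a product of
  affine transforms with the same total exponent.\<close>

lemma laplace_comb_functional_equation:
  assumes "laplace_comb f" and t: "0 \<le> t" and xy: "x \<in> Sdp" "y \<in> Sdp"
  shows "(\<integral>\<xi>. (\<integral>\<eta>. f (\<xi> + \<eta>) \<partial>p t 0) \<partial>p t (x + y)) = (\<integral>\<xi>. (\<integral>\<eta>. f (\<xi> + \<eta>) \<partial>p t y) \<partial>p t x)"
  using assms(1)
proof induction
  case (exp v a)
  have "g t 0 (cmat v) * g t (x + y) (cmat v) = g t y (cmat v) * g t x (cmat v)"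
    using t xy exp by (simp add: g_cmat Sdp_add ip.zero_right ip.add_right of_real_mult[symmetric]
        exp_add[symmetric] del: of_real_mult)
  then show ?case
    unfolding shifted_exp_integral[OF t xy(2)] shifted_exp_integral[OF t zero_Sdp]
    by (simp add: xy g_eq[OF t Sdp_add[OF xy], symmetric] g_eq[OF t xy(1), symmetric])
next
  case (add f h)
  note conv = laplace_comb_convolve[OF add.hyps(1) t] laplace_comb_convolve[OF add.hyps(2) t]
  have "(\<integral>\<xi>. (\<integral>\<eta>. f (\<xi> + \<eta>) + h (\<xi> + \<eta>) \<partial>p t z) \<partial>p t z')
      = (\<integral>\<xi>. (\<integral>\<eta>. f (\<xi> + \<eta>) \<partial>p t z) \<partial>p t z') + (\<integral>\<xi>. (\<integral>\<eta>. h (\<xi> + \<eta>) \<partial>p t z) \<partial>p t z')"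
    if z: "z \<in> Sdp" "z' \<in> Sdp" for z z'
  proof -
    have "(\<integral>\<xi>. (\<integral>\<eta>. f (\<xi> + \<eta>) + h (\<xi> + \<eta>) \<partial>p t z) \<partial>p t z')
      = (\<integral>\<xi>. (\<integral>\<eta>. f (\<xi> + \<eta>) \<partial>p t z) + (\<integral>\<eta>. h (\<xi> + \<eta>) \<partial>p t z) \<partial>p t z')"
    proof (rule integral_cong_AE)
      show "AE \<xi> in p t z'. (\<integral>\<eta>. f (\<xi> + \<eta>) + h (\<xi> + \<eta>) \<partial>p t z) = (\<integral>\<eta>. f (\<xi> + \<eta>) \<partial>p t z) + (\<integral>\<eta>. h (\<xi> + \<eta>) \<partial>p t z)"
        using AE_p[OF t z(2)] by eventually_elim (use conv[OF z(1)] in simp)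
      show "(\<lambda>\<xi>. \<integral>\<eta>. f (\<xi> + \<eta>) + h (\<xi> + \<eta>) \<partial>p t z) \<in> borel_measurable (p t z')"
        using laplace_comb_measurable[OF laplace_comb_convolve(1)[OF laplace_comb.add[OF add.hyps] t z(1)]]
        by (simp add: measurable_p_iff t z)
      show "(\<lambda>\<xi>. (\<integral>\<eta>. f (\<xi> + \<eta>) \<partial>p t z) + (\<integral>\<eta>. h (\<xi> + \<eta>) \<partial>p t z)) \<in> borel_measurable (p t z')"
        using laplace_comb_measurable[OF conv(1)[OF z(1)]] laplace_comb_measurable[OF conv(3)[OF z(1)]]
        by (simp add: measurable_p_iff t z)
    qed
    also have "\<dots> = (\<integral>\<xi>. (\<integral>\<eta>. f (\<xi> + \<eta>) \<partial>p t z) \<partial>p t z') + (\<integral>\<xi>. (\<integral>\<eta>. h (\<xi> + \<eta>) \<partial>p t z) \<partial>p t z')"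
      using conv[OF z(1)] by (intro Bochner_Integration.integral_add integrable_laplace_comb t z) auto
    finally show ?thesis .
  qed
  then show ?case using add.IH xy by (simp add: Sdp_add)
qed

text \<open>A product of two transforms is the double integral of
  \<open>exp (- cip u (\<xi> + \<eta>))\<close>. Replacing this integrand by a uniformly close
  Laplace combination costs at most \<open>e\<close>, because all masses are at most 1 and
  \<open>\<xi> + \<eta>\<close> stays in the cone.\<close>

lemma g_functional_equation_interior:
  assumes t: "0 \<le> t" and xy: "x \<in> Sdp" "y \<in> Sdp" and u: "re_mat u \<in> Spp" "im_mat u \<in> Sd"
  shows "g t (x + y) u * g t 0 u = g t x u * g t y u"
proof -
  have uC: "u \<in> CSdp" using u Spp_Sdp by (auto simp: CSdp_iff)
  have approx: "norm (g t z u * g t z' u - (\<integral>\<xi>. (\<integral>\<eta>. f (\<xi> + \<eta>) \<partial>p t z') \<partial>p t z)) \<le> e"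
    if f: "laplace_comb f" "\<And>\<xi>. \<xi> \<in> Sdp \<Longrightarrow> norm (exp (- cip u \<xi>) - f \<xi>) \<le> e" and z: "z \<in> Sdp" "z' \<in> Sdp" and e: "0 \<le> e"
    for f e z z'
  proof -
    note conv = laplace_comb_convolve[OF f(1) t z(2)]
    have "g t z u * g t z' u - (\<integral>\<xi>. (\<integral>\<eta>. f (\<xi> + \<eta>) \<partial>p t z') \<partial>p t z)
        = (\<integral>\<xi>. exp (- cip u \<xi>) * g t z' u - (\<integral>\<eta>. f (\<xi> + \<eta>) \<partial>p t z') \<partial>p t z)"
      using conv by (subst Bochner_Integration.integral_diff)
        (auto intro!: integrable_laplace_comb t z integrable_mult_left integrable_exp_cip uC simp: g_eq[OF t z(1)])
    also have "norm \<dots> \<le> e"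
    proof (rule integral_p_norm_le_const[OF t z(1) _ _ e])
      show "(\<lambda>\<xi>. exp (- cip u \<xi>) * g t z' u - (\<integral>\<eta>. f (\<xi> + \<eta>) \<partial>p t z')) \<in> borel_measurable borel"
        using laplace_comb_measurable[OF conv(1)] by (intro borel_measurable_diff borel_measurable_times) auto
      fix \<xi> :: "real^'d^'d" assume \<xi>: "\<xi> \<in> Sdp"
      have "exp (- cip u \<xi>) * g t z' u - (\<integral>\<eta>. f (\<xi> + \<eta>) \<partial>p t z')
          = (\<integral>\<eta>. exp (- cip u \<xi>) * exp (- cip u \<eta>) - f (\<xi> + \<eta>) \<partial>p t z')"
        using conv \<xi> by (subst Bochner_Integration.integral_diff)
          (auto intro!: integrable_mult_right integrable_exp_cip t z uC simp: g_eq[OF t z(2)])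
      also have "norm \<dots> \<le> e"
      proof (rule integral_p_norm_le_const[OF t z(2) _ _ e])
        have "f \<in> borel_measurable borel" by (rule laplace_comb_measurable[OF f(1)])
        then show "(\<lambda>\<eta>. exp (- cip u \<xi>) * exp (- cip u \<eta>) - f (\<xi> + \<eta>)) \<in> borel_measurable borel"
          by measurable
        show "norm (exp (- cip u \<xi>) * exp (- cip u \<eta>) - f (\<xi> + \<eta>)) \<le> e" if "\<eta> \<in> Sdp" for \<eta>
          using f(2)[OF Sdp_add[OF \<xi> that]] by (simp add: cip.add_right exp_add[symmetric])
      qed
      finally show "norm (exp (- cip u \<xi>) * g t z' u - (\<integral>\<eta>. f (\<xi> + \<eta>) \<partial>p t z')) \<le> e" .
    qed
    finally show ?thesis .
  qed
  have "norm (g t (x + y) u * g t 0 u - g t x u * g t y u) \<le> 2 * e" if e: "e > 0" for e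
  proof -
    obtain f where f: "laplace_comb f" "\<And>\<xi>. \<xi> \<in> Sdp \<Longrightarrow> norm (exp (- cip u \<xi>) - f \<xi>) \<le> e"
      using laplace_comb_dense[OF u e] by blast
    have "norm (g t (x + y) u * g t 0 u - (\<integral>\<xi>. (\<integral>\<eta>. f (\<xi> + \<eta>) \<partial>p t 0) \<partial>p t (x + y))) \<le> e"
      by (rule approx[OF f]) (use xy e Sdp_add in auto)
    moreover have "norm (g t x u * g t y u - (\<integral>\<xi>. (\<integral>\<eta>. f (\<xi> + \<eta>) \<partial>p t y) \<partial>p t x)) \<le> e"
      by (rule approx[OF f]) (use xy e in auto)
    ultimately show ?thesis unfolding laplace_comb_functional_equation[OF f(1) t xy] by norm
  qed
  note bound = this
  have "norm (g t (x + y) u * g t 0 u - g t x u * g t y u) \<le> 0"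
  proof (rule field_le_epsilon)
    fix e :: real assume "0 < e"
    then show "norm (g t (x + y) u * g t 0 u - g t x u * g t y u) \<le> 0 + e" using bound[of "e / 2"] by simp
  qed
  then show ?thesis by simp
qed

text \<open>Transforms of Laplace combinations are explicit and continuous in \<open>x\<close>;
  since masses are at most 1, uniform approximation of the integrand is inherited by the transforms
  uniformly in \<open>x\<close>.\<close>

lemma continuous_on_g_space:
  assumes t: "0 \<le> t" and u: "re_mat u \<in> Spp" "im_mat u \<in> Sd"
  shows "continuous_on Sdp (\<lambda>x. g t x u)"
proof -
  have uC: "u \<in> CSdp" using u Spp_Sdp by (auto simp: CSdp_iff)
  have "\<exists>f. laplace_comb f \<and> (\<forall>\<xi>\<in>Sdp. norm (exp (- cip u \<xi>) - f \<xi>) \<le> inverse (real (Suc n)))" for n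
    using laplace_comb_dense[OF u, of "inverse (real (Suc n))"] by (metis inverse_positive_iff_positive of_nat_0_less_iff zero_less_Suc)
  then obtain f where f: "\<And>n. laplace_comb (f n)"
    "\<And>n \<xi>. \<xi> \<in> Sdp \<Longrightarrow> norm (exp (- cip u \<xi>) - f n \<xi>) \<le> inverse (real (Suc n))" by metis
  have cont: "continuous_on Sdp (\<lambda>x. integral\<^sup>L (p t x) h)" if "laplace_comb h" for h
    using that
  proof induction
    case (exp v a)
    have "continuous_on Sdp (\<lambda>x. a * complex_of_real (exp (- \<phi>0 t v - ip (\<psi>0 t v) x)))"
      by (intro continuous_intros ip.continuous_on)
    then show ?case by (rule continuous_on_eq) (use g_cmat[OF t _ exp] g_eq[OF t] in simp)
  next
    case (add f h)
    show ?case by (rule continuous_on_eq[OF continuous_on_add[OF add.IH]])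
        (simp add: integrable_laplace_comb[OF add.hyps(1) t] integrable_laplace_comb[OF add.hyps(2) t])
  qed
  have "uniform_limit Sdp (\<lambda>n x. integral\<^sup>L (p t x) (f n)) (\<lambda>x. g t x u) sequentially"
  proof (rule uniform_limitI)
    fix e :: real assume "e > 0"
    then have "\<forall>\<^sub>F n in sequentially. inverse (real (Suc n)) < e"
      using LIMSEQ_inverse_real_of_nat by (rule order_tendstoD(2)[rotated])
    then show "\<forall>\<^sub>F n in sequentially. \<forall>x\<in>Sdp. dist (integral\<^sup>L (p t x) (f n)) (g t x u) < e"
    proof eventually_elim
      case (elim n)
      show ?case
      proof
        fix x :: "real^'d^'d" assume x: "x \<in> Sdp"
        have "norm (g t x u - integral\<^sup>L (p t x) (f n)) = norm (\<integral>\<xi>. exp (- cip u \<xi>) - f n \<xi> \<partial>p t x)"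
          by (simp add: g_eq[OF t x] integrable_exp_cip[OF t x uC] integrable_laplace_comb[OF f(1) t x])
        also have "\<dots> \<le> inverse (real (Suc n))"
          by (rule integral_p_norm_le_const[OF t x])
            (use f borel_measurable_diff[OF measurable_exp_cip laplace_comb_measurable[OF f(1)]] in auto)
        finally show "dist (integral\<^sup>L (p t x) (f n)) (g t x u) < e"
          using elim by (simp add: dist_norm norm_minus_commute)
      qed
    qed
  qed
  then show ?thesis
    by (rule uniform_limit_theorem[rotated]) (auto intro: always_eventually cont f)
qed

text \<open>The assumed inequality is used on the whole ray through \<open>x\<close>, where the
  constants \<open>A\<close> and \<open>A'\<close> wash out.\<close>

lemma \<psi>0_compare:
  assumes "0 \<le> t" "0 \<le> s" "v \<in> Sdp" "w \<in> Sdp" "x \<in> Sdp"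
    and le: "\<And>x. x \<in> Sdp \<Longrightarrow> exp (- A - ip (\<psi>0 s w) x) \<le> exp (- A' - k * ip (\<psi>0 t v) x)"
  shows "k * ip (\<psi>0 t v) x \<le> ip (\<psi>0 s w) x"
proof (rule affine_le_imp_slope_le[of A' _ A])
  fix l :: real assume "0 \<le> l"
  then show "A' + l * (k * ip (\<psi>0 t v) x) \<le> A + l * ip (\<psi>0 s w) x"
    using le[OF Sdp_scaleR[OF assms(5), of l]] by (simp add: ip.scaleR_right algebra_simps)
qed

lemma integrable_real_exp:
  assumes "0 \<le> t" "x \<in> Sdp" "v \<in> Sdp"
  shows "integrable (p t x) (\<lambda>\<xi>. exp (- ip v \<xi>))"
  by (rule integrable_p[OF assms(1,2), where C=1])
     (auto intro!: borel_measurable_continuous_onI continuous_intros ip.continuous_on ip_Sdp_nonneg[OF assms(3)])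

text \<open>A larger argument gives a smaller exponential and a smaller transform; comparison along
  rays then removes \<open>\<phi>0\<close>.\<close>

lemma \<psi>0_mono:
  assumes t: "0 \<le> t" and vw: "v \<in> Sdp" "w \<in> Sdp" "w - v \<in> Sdp" and x: "x \<in> Sdp"
  shows "ip (\<psi>0 t v) x \<le> ip (\<psi>0 t w) x"
proof -
  have "1 * ip (\<psi>0 t v) x \<le> ip (\<psi>0 t w) x"
  proof (rule \<psi>0_compare[OF t t vw(1,2) x, of "\<phi>0 t w" "\<phi>0 t v"])
    fix x :: "real^'d^'d" assume x: "x \<in> Sdp"
    have "(\<integral>\<xi>. exp (- ip w \<xi>) \<partial>p t x) \<le> (\<integral>\<xi>. exp (- ip v \<xi>) \<partial>p t x)"
    proof (rule integral_mono_AE[OF integrable_real_exp[OF t x vw(2)] integrable_real_exp[OF t x vw(1)]])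
      show "AE \<xi> in p t x. exp (- ip w \<xi>) \<le> exp (- ip v \<xi>)"
        using AE_p[OF t x]
      proof eventually_elim
        case (elim \<xi>)
        then show ?case using ip_Sdp_nonneg[OF vw(3) elim] by (simp add: ip.diff_left)
      qed
    qed
    then show "exp (- \<phi>0 t w - ip (\<psi>0 t w) x) \<le> exp (- \<phi>0 t v - 1 * ip (\<psi>0 t v) x)"
      using real_transform[OF t x] vw by simp
  qed
  then show ?thesis by simp
qed

text \<open>Jensen's inequality for mass at most 1: the squared integral of an exponential is at
  most the integral of its square.\<close>

lemma \<psi>0_double:
  assumes t: "0 \<le> t" and v: "v \<in> Sdp" and x: "x \<in> Sdp"
  shows "ip (\<psi>0 t (2 *\<^sub>R v)) x \<le> 2 * ip (\<psi>0 t v) x"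
proof -
  have v2: "2 *\<^sub>R v \<in> Sdp" by (rule Sdp_scaleR[OF v]) simp
  have key: "(exp (- \<phi>0 t v - ip (\<psi>0 t v) x))\<^sup>2 \<le> exp (- \<phi>0 t (2 *\<^sub>R v) - ip (\<psi>0 t (2 *\<^sub>R v)) x)"
    if x: "x \<in> Sdp" for x
  proof -
    interpret finite_measure "p t x" by (rule finite_p[OF t x])
    define a where "a = exp (- \<phi>0 t v - ip (\<psi>0 t v) x)"
    have int: "(\<integral>\<xi>. exp (- ip v \<xi>) \<partial>p t x) = a"
      using real_transform[OF t x v] by (simp add: a_def)
    have int2: "(\<integral>\<xi>. exp (- ip (2 *\<^sub>R v) \<xi>) \<partial>p t x) = exp (- \<phi>0 t (2 *\<^sub>R v) - ip (\<psi>0 t (2 *\<^sub>R v)) x)"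
      by (rule real_transform[OF t x v2])
    note i = integrable_real_exp[OF t x v] integrable_real_exp[OF t x v2]
    \<comment> \<open>Second moment about \<open>a\<close>: expanding it bounds
      \<open>a\<^sup>2\<close> times 2 minus the mass, a factor of at least 1.\<close>
    have "0 \<le> (\<integral>\<xi>. (exp (- ip v \<xi>) - a)\<^sup>2 \<partial>p t x)" by (rule integral_nonneg_AE) simp
    also have "(\<lambda>\<xi>. (exp (- ip v \<xi>) - a)\<^sup>2) = (\<lambda>\<xi>. exp (- ip (2 *\<^sub>R v) \<xi>) - (2 * a) * exp (- ip v \<xi>) + a\<^sup>2)"
    proof
      fix \<xi>
      have "exp (- ip (2 *\<^sub>R v) \<xi>) = (exp (- ip v \<xi>))\<^sup>2"
        by (simp add: ip.scaleR_left exp_double[symmetric])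
      then show "(exp (- ip v \<xi>) - a)\<^sup>2 = exp (- ip (2 *\<^sub>R v) \<xi>) - (2 * a) * exp (- ip v \<xi>) + a\<^sup>2"
        by (simp add: power2_diff algebra_simps)
    qed
    also have "(\<integral>\<xi>. exp (- ip (2 *\<^sub>R v) \<xi>) - (2 * a) * exp (- ip v \<xi>) + a\<^sup>2 \<partial>p t x)
        = exp (- \<phi>0 t (2 *\<^sub>R v) - ip (\<psi>0 t (2 *\<^sub>R v)) x) - 2 * a * a + a\<^sup>2 * measure (p t x) UNIV"
      using i by (simp add: int int2 space_p[OF t x])
    finally have "2 * a\<^sup>2 - a\<^sup>2 * measure (p t x) UNIV \<le> exp (- \<phi>0 t (2 *\<^sub>R v) - ip (\<psi>0 t (2 *\<^sub>R v)) x)"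
      by (simp add: power2_eq_square)
    moreover have "a\<^sup>2 * measure (p t x) UNIV \<le> a\<^sup>2" using measure_p_le[OF t x] by (simp add: mult_left_le)
    ultimately have "a\<^sup>2 \<le> exp (- \<phi>0 t (2 *\<^sub>R v) - ip (\<psi>0 t (2 *\<^sub>R v)) x)" by linarith
    then show ?thesis by (simp add: a_def)
  qed
  show ?thesis
  proof (rule affine_le_imp_slope_le[of "\<phi>0 t (2 *\<^sub>R v)" _ "2 * \<phi>0 t v"])
    fix l :: real assume "0 \<le> l"
    then show "\<phi>0 t (2 *\<^sub>R v) + l * ip (\<psi>0 t (2 *\<^sub>R v)) x \<le> 2 * \<phi>0 t v + l * (2 * ip (\<psi>0 t v) x)"
      using key[OF Sdp_scaleR[OF x, of l]]
      by (simp add: ip.scaleR_right power2_eq_square exp_add[symmetric] algebra_simps)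
  qed
qed

text \<open>Doubling keeps the pairing at zero, hence it vanishes at all
  \<open>2 ^ n *\<^sub>R u\<close>. As \<open>u\<close> is interior, one of these dominates
  \<open>w\<close> in the cone order, and monotonicity concludes.\<close>

lemma \<psi>0_degenerate:
  assumes t: "0 \<le> t" and u: "u \<in> Spp" and w: "w \<in> Sdp" and x: "x \<in> Sdp" and z: "ip (\<psi>0 t u) x = 0"
  shows "ip (\<psi>0 t w) x = 0"
proof -
  have pow: "ip (\<psi>0 t (2 ^ n *\<^sub>R u)) x \<le> 0" for n
  proof (induction n)
    case (Suc n)
    have "ip (\<psi>0 t (2 *\<^sub>R (2 ^ n *\<^sub>R u))) x \<le> 2 * ip (\<psi>0 t (2 ^ n *\<^sub>R u)) x"
      by (rule \<psi>0_double[OF t Sdp_scaleR[OF Spp_Sdp[OF u]] x]) simp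
    with Suc show ?case by simp
  qed (simp add: z)
  obtain s where s: "s > 0" "\<And>r. \<bar>r\<bar> \<le> s \<Longrightarrow> u + r *\<^sub>R w \<in> Sdp"
    using Spp_perturb[OF u Sdp_Sd[OF w]] by blast
  obtain n where n: "inverse (2 ^ n) < s" using s(1) reals_power_lt_ex[of s 2] by (auto simp: inverse_eq_divide power_one_over)
  have "u + (- inverse (2 ^ n)) *\<^sub>R w \<in> Sdp" using s(2)[of "- inverse (2 ^ n)"] n by simp
  then have "2 ^ n *\<^sub>R (u + (- inverse (2 ^ n)) *\<^sub>R w) \<in> Sdp" by (intro Sdp_scaleR) auto
  then have "2 ^ n *\<^sub>R u - w \<in> Sdp" by (simp add: scaleR_diff_right)
  then have "ip (\<psi>0 t w) x \<le> ip (\<psi>0 t (2 ^ n *\<^sub>R u)) x"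
    by (intro \<psi>0_mono t w x Sdp_scaleR[OF Spp_Sdp[OF u]]) auto
  moreover have "0 \<le> ip (\<psi>0 t w) x" by (intro ip_Sdp_nonneg \<psi>0_Sdp t w x)
  ultimately show ?thesis using pow[of n] by simp
qed

text \<open>By Chapman-Kolmogorov both sides are exponents of the same transform, and equal
  transforms have equal slopes along rays.\<close>

lemma \<psi>0_semigroup:
  assumes st: "0 \<le> s" "0 \<le> t" and v: "v \<in> Sdp" and x: "x \<in> Sdp"
  shows "ip (\<psi>0 (s + t) v) x = ip (\<psi>0 s (\<psi>0 t v)) x"
proof -
  have w: "\<psi>0 t v \<in> Sdp" by (rule \<psi>0_Sdp[OF st(2) v])
  have eq: "exp (- \<phi>0 (s + t) v - ip (\<psi>0 (s + t) v) x) = exp (- (\<phi>0 t v + \<phi>0 s (\<psi>0 t v)) - ip (\<psi>0 s (\<psi>0 t v)) x)"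
    if x: "x \<in> Sdp" for x
  proof -
    let ?h = "\<lambda>y. complex_of_real (exp (- \<phi>0 t v)) * exp (- cip (cmat (\<psi>0 t v)) y)"
    have "g (s + t) x (cmat v) = integral\<^sup>L (p s x) ?h"
    proof (rule g_chapman_kolmogorov[OF st x cmat_CSdp[OF v]])
      show "g t y (cmat v) = ?h y" if "y \<in> Sdp" for y
        using g_cmat[OF st(2) that v] by (simp add: cip_cmat exp_diff exp_minus exp_of_real field_simps)
    qed measurable
    also have "\<dots> = complex_of_real (exp (- \<phi>0 t v)) * g s x (cmat (\<psi>0 t v))"
      by (simp add: g_eq[OF st(1) x])
    finally have "exp (- \<phi>0 (s + t) v - ip (\<psi>0 (s + t) v) x) = exp (- \<phi>0 t v) * exp (- \<phi>0 s (\<psi>0 t v) - ip (\<psi>0 s (\<psi>0 t v)) x)"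
      using st x v w by (simp add: g_cmat flip: of_real_mult)
    then show ?thesis by (simp add: exp_add[symmetric] algebra_simps)
  qed
  have "1 * ip (\<psi>0 (s + t) v) x \<le> ip (\<psi>0 s (\<psi>0 t v)) x"
    using eq by (intro \<psi>0_compare[of "s + t" s v "\<psi>0 t v" x "\<phi>0 t v + \<phi>0 s (\<psi>0 t v)" "\<phi>0 (s + t) v"]) (use st v w x in auto)
  moreover have "1 * ip (\<psi>0 s (\<psi>0 t v)) x \<le> ip (\<psi>0 (s + t) v) x"
    using eq by (intro \<psi>0_compare[of s "s + t" "\<psi>0 t v" v x "\<phi>0 (s + t) v" "\<phi>0 t v + \<phi>0 s (\<psi>0 t v)"]) (use st v w x in auto)
  ultimately show ?thesis by simp
qed

text \<open>Stochastic continuity gives the limit of the two exponents together; subtracting the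
  case \<open>x = 0\<close> isolates \<open>\<psi>0\<close>.\<close>

lemma \<psi>0_tendsto:
  assumes v: "v \<in> Sdp" and \<tau>: "\<And>n. 0 \<le> \<tau> n" "\<tau> \<longlonglongrightarrow> 0"
  shows "(\<lambda>n. \<psi>0 (\<tau> n) v) \<longlonglongrightarrow> v"
proof -
  have lim: "(\<lambda>n. \<phi>0 (\<tau> n) v + ip (\<psi>0 (\<tau> n) v) x) \<longlonglongrightarrow> ip v x" if x: "x \<in> Sdp" for x
  proof -
    have "(\<lambda>n. g (\<tau> n) x (cmat v)) \<longlonglongrightarrow> g 0 x (cmat v)"
      using continuous_on_g[OF x cmat_CSdp[OF v]] \<tau>
      by (intro continuous_on_tendsto_compose[of "{0..}" "\<lambda>t. g t x (cmat v)"]) auto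
    then have "(\<lambda>n. Re (g (\<tau> n) x (cmat v))) \<longlonglongrightarrow> Re (g 0 x (cmat v))" by (rule tendsto_Re)
    then have "(\<lambda>n. exp (- \<phi>0 (\<tau> n) v - ip (\<psi>0 (\<tau> n) v) x)) \<longlonglongrightarrow> exp (- ip v x)"
      unfolding g_0[OF x] cip_cmat of_real_minus[symmetric] exp_of_real
      using x v by (simp add: g_cmat \<tau>)
    from tendsto_minus[OF tendsto_ln[OF this]] show ?thesis by (simp add: algebra_simps)
  qed
  have "(\<lambda>n. ip (\<psi>0 (\<tau> n) v) x) \<longlonglongrightarrow> ip v x" if "x \<in> Sdp" for x
    using tendsto_diff[OF lim[OF that] lim[of 0]] by (simp add: ip.zero_right)
  then have "(\<lambda>n. cip (cmat (\<psi>0 (\<tau> n) v)) x) \<longlonglongrightarrow> cip (cmat v) x" if "x \<in> Sdp" for x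
    using that unfolding cip_cmat by (intro tendsto_of_real)
  then have "(\<lambda>n. cmat (\<psi>0 (\<tau> n) v)) \<longlonglongrightarrow> cmat v"
    by (intro tendsto_cip_imp_tendsto CSdp_sym cmat_CSdp \<psi>0_Sdp \<tau> v)
  from bounded_linear.tendsto[OF bounded_linear_re_mat this] show ?thesis by simp
qed

text \<open>Degeneracy of \<open>\<psi>0\<close> at time \<open>2 s\<close> forces degeneracy at time \<open>s\<close>, hence arbitrarily close to
  time \<open>0\<close>.\<close>
lemma \<psi>0_Spp:
  assumes t: "0 \<le> t" and u: "u \<in> Spp"
  shows "\<psi>0 t u \<in> Spp"
proof (rule ccontr)
  assume bad: "\<psi>0 t u \<notin> Spp"
  have uS: "u \<in> Sdp" by (rule Spp_Sdp[OF u])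
  have step: "\<psi>0 s u \<notin> Spp" if s: "0 \<le> s" "\<psi>0 (s + s) u \<notin> Spp" for s
  proof
    assume int: "\<psi>0 s u \<in> Spp"
    obtain v where v: "v \<bullet> v = 1" "ip (\<psi>0 (s + s) u) (outer v) = 0"
      by (rule not_Spp_degenerate[OF \<psi>0_Sdp s(2)]) (use s uS in auto)
    then have "ip (\<psi>0 s (\<psi>0 s u)) (outer v) = 0"
      using \<psi>0_semigroup[OF s(1) s(1) uS outer_Sdp] by simp
    then have "ip (\<psi>0 s u) (outer v) = 0"
      by (rule \<psi>0_degenerate[OF s(1) int uS outer_Sdp])
    moreover obtain \<delta> where "\<delta> > 0" "\<And>x. x \<in> Sdp \<Longrightarrow> \<delta> * norm x \<le> ip (\<psi>0 s u) x"
      using Spp_coercive[OF int] by blast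
    ultimately show False using outer_Sdp[of v] v(1) by (force simp: norm_outer)
  qed
  have bad_n: "\<psi>0 (t / 2 ^ n) u \<notin> Spp" for n
  proof (induction n)
    case (Suc n)
    show ?case by (rule step) (use t Suc in \<open>auto simp: field_simps\<close>)
  qed (simp add: bad)
  have nn: "0 \<le> t / 2 ^ n" for n using t by simp
  have "(\<lambda>n. t / 2 ^ n) \<longlonglongrightarrow> 0" by real_asymp
  then have "(\<lambda>n. \<psi>0 (t / 2 ^ n) u) \<longlonglongrightarrow> u" by (rule \<psi>0_tendsto[OF uS nn])
  moreover obtain \<delta> where \<delta>: "\<delta> > 0" "\<And>x. x \<in> Sdp \<Longrightarrow> \<delta> * norm x \<le> ip u x"
    using Spp_coercive[OF u] by blast
  ultimately obtain n where n: "dist (\<psi>0 (t / 2 ^ n) u) u < \<delta>"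
    using LIMSEQ_D by (metis dist_norm order_refl)
  obtain v where v: "v \<bullet> v = 1" "ip (\<psi>0 (t / 2 ^ n) u) (outer v) = 0"
    by (rule not_Spp_degenerate[OF \<psi>0_Sdp[OF nn uS] bad_n])
  \<comment> \<open>The degenerate direction has pairing 0 with \<open>\<psi>0 (t / 2 ^ n) u\<close>
    but at least \<delta> with \<open>u\<close>, although the two are closer than \<delta>.\<close>
  have "\<bar>ip (\<psi>0 (t / 2 ^ n) u - u) (outer v)\<bar> \<le> norm (\<psi>0 (t / 2 ^ n) u - u) * norm (outer v)"
    unfolding ip_eq_inner[OF outer_Sd] by (rule Cauchy_Schwarz_ineq2)
  then show False using n v \<delta>(2)[OF outer_Sdp[of v]]
    by (simp add: norm_outer dist_norm ip.diff_left)
qed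

end

section \<open>Characters of the cone and the complex exponent\<close>

text \<open>For small \<epsilon> the integral differs from \<epsilon> by at most
  \<open>\<epsilon> / 2\<close>. It serves as divisor both for recovering exponents and for
  smoothing characters.\<close>

lemma integral_near_one_nonzero:
  fixes f :: "real \<Rightarrow> complex"
  assumes f: "continuous_on {0..} f" and "f 0 = 1"
  obtains \<epsilon> where "\<epsilon> > 0" "integral {0..\<epsilon>} f \<noteq> 0"
proof -
  obtain d where d: "d > 0" "\<And>s. s \<in> {0..} \<Longrightarrow> dist s 0 < d \<Longrightarrow> dist (f s) (f 0) < 1/2"
    using f[unfolded continuous_on_iff, rule_format, of 0 "1/2"] by auto
  define \<epsilon> where "\<epsilon> = d / 2"
  have \<epsilon>: "\<epsilon> > 0" "\<epsilon> < d" using d(1) by (auto simp: \<epsilon>_def)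
  have cont: "continuous_on {0..\<epsilon>} f" by (rule continuous_on_subset[OF f]) auto
  have "norm (integral {0..\<epsilon>} (\<lambda>s. f s - 1)) \<le> (1/2) * (\<epsilon> - 0)"
  proof (rule integral_bound)
    show "norm (f s - 1) \<le> 1/2" if "s \<in> {0..\<epsilon>}" for s
      using d(2)[of s] that \<epsilon> assms(2) by (simp add: dist_norm)
  qed (use \<epsilon> cont in \<open>auto intro!: continuous_intros\<close>)
  moreover have "integral {0..\<epsilon>} (\<lambda>s. f s - 1) = integral {0..\<epsilon>} f - of_real \<epsilon>"
    using \<epsilon>(1) by (subst Henstock_Kurzweil_Integration.integral_diff)
      (auto intro!: integrable_continuous_real cont simp: scaleR_conv_of_real)
  ultimately have "norm (integral {0..\<epsilon>} f - of_real \<epsilon>) \<le> \<epsilon> / 2" by simp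
  then have "integral {0..\<epsilon>} f \<noteq> 0" using \<epsilon>(1) by auto
  with \<epsilon>(1) show ?thesis by (rule that)
qed

text \<open>Stated as a product, so that \<open>a = 0\<close> is included.\<close>

lemma integral_exp_ray:
  fixes a :: complex
  assumes "0 \<le> \<epsilon>"
  shows "a * integral {0..\<epsilon>} (\<lambda>s. exp (- (s *\<^sub>R a))) = 1 - exp (- (\<epsilon> *\<^sub>R a))"
proof -
  have "((\<lambda>s. - exp (s *\<^sub>R (- a))) has_vector_derivative a * exp (- (s *\<^sub>R a))) (at s within {0..\<epsilon>})" for s
    using has_vector_derivative_minus[OF exp_scaleR_has_vector_derivative_right[of "- a" s "{0..\<epsilon>}"]]
    by (simp add: mult.commute)
  then have "((\<lambda>s. a * exp (- (s *\<^sub>R a))) has_integral (- exp (\<epsilon> *\<^sub>R (- a)) - - exp (0 *\<^sub>R (- a)))) {0..\<epsilon>}"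
    by (intro fundamental_theorem_of_calculus[OF assms])
  from integral_unique[OF this] show ?thesis by simp
qed

text \<open>The exponent is recovered from the exponential without choosing a logarithm, through
  \<open>a = (1 - exp (- \<epsilon> a)) / integral {0..\<epsilon>} (\<lambda>s. exp (- s a))\<close>.\<close>
lemma tendsto_of_exp_ray_tendsto:
  fixes a :: complex
  assumes pos: "\<And>n. 0 \<le> Re (A n)"
    and lim: "\<And>s. 0 \<le> s \<Longrightarrow> (\<lambda>n. exp (- (s *\<^sub>R A n))) \<longlonglongrightarrow> exp (- (s *\<^sub>R a))"
  shows "A \<longlonglongrightarrow> a"
proof -
  define J where "J z \<epsilon> = integral {0..\<epsilon>} (\<lambda>s. exp (- (s *\<^sub>R z)))" for z :: complex and \<epsilon>
  have cont: "continuous_on S (\<lambda>s. exp (- (s *\<^sub>R z)))" for z :: complex and S by (intro continuous_intros)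
  \<comment> \<open>\<epsilon> is chosen for the limit \<open>a\<close> only; the integrals for
    \<open>A n\<close> converge and are therefore eventually nonzero as well.\<close>
  obtain \<epsilon> where \<epsilon>: "\<epsilon> > 0" "J a \<epsilon> \<noteq> 0"
    using integral_near_one_nonzero[OF cont[of _ a]] unfolding J_def by auto
  have J: "(\<lambda>n. J (A n) \<epsilon>) \<longlonglongrightarrow> J a \<epsilon>"
    unfolding J_def
  proof (rule dominated_convergence(2)[where h="\<lambda>_. 1"])
    show "norm (exp (- (s *\<^sub>R A n))) \<le> 1" if "s \<in> {0..\<epsilon>}" for n s
      using pos[of n] that by simp
  qed (auto intro!: integrable_continuous_real cont lim)
  have "(\<lambda>n. (1 - exp (- (\<epsilon> *\<^sub>R A n))) / J (A n) \<epsilon>) \<longlonglongrightarrow> (1 - exp (- (\<epsilon> *\<^sub>R a))) / J a \<epsilon>"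
    using \<epsilon> by (intro tendsto_intros lim J) auto
  moreover have "(1 - exp (- (\<epsilon> *\<^sub>R a))) / J a \<epsilon> = a"
    using integral_exp_ray[of \<epsilon> a] \<epsilon> by (simp add: J_def field_simps)
  moreover have "\<forall>\<^sub>F n in sequentially. (1 - exp (- (\<epsilon> *\<^sub>R A n))) / J (A n) \<epsilon> = A n"
    using tendsto_imp_eventually_ne[OF J \<epsilon>(2)]
  proof eventually_elim
    case (elim n)
    then show ?case using integral_exp_ray[of \<epsilon> "A n"] \<epsilon>(1) by (simp add: J_def field_simps)
  qed
  ultimately show ?thesis by (simp add: tendsto_cong)
qed

lemma exp_ray_inj:
  fixes a b :: complex
  assumes "0 \<le> Re a" "\<And>s. 0 \<le> s \<Longrightarrow> exp (- (s *\<^sub>R a)) = exp (- (s *\<^sub>R b))"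
  shows "a = b"
  using tendsto_of_exp_ray_tendsto[of "\<lambda>_. a" b] assms by (simp add: LIMSEQ_const_iff)

text \<open>Integrating the functional equation over \<open>s\<close> expresses \<rho> through its
  own primitive, which makes it differentiable; the resulting linear differential equation forces an
  exponential.\<close>

lemma continuous_ray_character:
  fixes \<rho> :: "real \<Rightarrow> complex"
  assumes cont: "continuous_on {0..} \<rho>" and one: "\<rho> 0 = 1"
    and mult: "\<And>r s. 0 \<le> r \<Longrightarrow> 0 \<le> s \<Longrightarrow> \<rho> (r + s) = \<rho> r * \<rho> s"
  obtains k where "\<And>r. 0 \<le> r \<Longrightarrow> \<rho> r = exp (- (r *\<^sub>R k))"
proof -
  obtain \<epsilon> where \<epsilon>: "\<epsilon> > 0" "integral {0..\<epsilon>} \<rho> \<noteq> 0" using integral_near_one_nonzero[OF cont one] by blast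
  define J where "J r = integral {0..r} \<rho>" for r
  \<comment> \<open>Minus the derivative of \<rho> at 0.\<close>
  define k where "k = (1 - \<rho> \<epsilon>) / J \<epsilon>"
  have int: "\<rho> integrable_on {0..r}" for r
    by (intro integrable_continuous_real continuous_on_subset[OF cont]) auto
  have shift: "\<rho> r = (J (r + \<epsilon>) - J r) / J \<epsilon>" if r: "0 \<le> r" for r
  proof -
    have "integral {0..\<epsilon>} (\<rho> \<circ> ((+) r)) = integral {0..\<epsilon>} (\<lambda>s. \<rho> r * \<rho> s)"
      by (rule integral_cong) (simp add: mult r)
    then have "integral {0+r..\<epsilon>+r} \<rho> = \<rho> r * J \<epsilon>"
      unfolding integral_shift_Icc_real J_def by simp
    moreover have "J r + integral {r..r + \<epsilon>} \<rho> = J (r + \<epsilon>)"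
      unfolding J_def by (rule Henstock_Kurzweil_Integration.integral_combine) (use r \<epsilon> int in auto)
    ultimately show ?thesis using \<epsilon>(2) by (simp add: J_def field_simps)
  qed
  have J': "(J has_vector_derivative \<rho> r) (at r within {0..})" if "0 \<le> r" for r
  proof -
    have "(J has_vector_derivative \<rho> r) (at r within {0..r+1})"
      unfolding J_def using that
      by (intro integral_has_vector_derivative continuous_on_subset[OF cont]) auto
    moreover have "at r within {0..r+1} = at r within {0..}"
      by (rule at_within_nhd[of _ "{..<r+1}"]) auto
    ultimately show ?thesis by simp
  qed
  have deriv: "(\<rho> has_vector_derivative - (k * \<rho> r)) (at r within {0..})" if r: "0 \<le> r" for r
  proof -
    have "((\<lambda>s. J (s + \<epsilon>)) has_vector_derivative \<rho> (r + \<epsilon>)) (at r within {0..})"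
    proof -
      have "((J \<circ> (\<lambda>s. s + \<epsilon>)) has_vector_derivative 1 *\<^sub>R \<rho> (r + \<epsilon>)) (at r within {0..})"
      proof (rule vector_diff_chain_within)
        show "((\<lambda>s. s + \<epsilon>) has_vector_derivative 1) (at r within {0..})"
          by (auto intro!: derivative_eq_intros)
        show "(J has_vector_derivative \<rho> (r + \<epsilon>)) (at (r + \<epsilon>) within (\<lambda>s. s + \<epsilon>) ` {0..})"
          by (rule has_vector_derivative_within_subset[OF J']) (use r \<epsilon> in auto)
      qed
      then show ?thesis by (simp add: o_def)
    qed
    then have "((\<lambda>s. (J (s + \<epsilon>) - J s) * inverse (J \<epsilon>)) has_vector_derivative (\<rho> (r + \<epsilon>) - \<rho> r) * inverse (J \<epsilon>)) (at r within {0..})"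
      by (intro has_vector_derivative_mult_left has_vector_derivative_diff J' r)
    then have "(\<rho> has_vector_derivative (\<rho> (r + \<epsilon>) - \<rho> r) * inverse (J \<epsilon>)) (at r within {0..})"
      by (rule has_vector_derivative_transform[rotated 2]) (use r shift in \<open>auto simp: field_simps\<close>)
    moreover have "(\<rho> (r + \<epsilon>) - \<rho> r) * inverse (J \<epsilon>) = - (k * \<rho> r)"
      using \<epsilon> r by (simp add: mult k_def J_def field_simps)
    ultimately show ?thesis by simp
  qed
  have "((\<lambda>s. \<rho> s * exp (s *\<^sub>R k)) has_vector_derivative 0) (at r within {0..})" if "r \<in> {0..}" for r
  proof -
    have "((\<lambda>s. exp (s *\<^sub>R k)) has_vector_derivative exp (r *\<^sub>R k) * k) (at r within {0..})"
      by (rule exp_scaleR_has_vector_derivative_right)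
    with deriv[of r] that have "((\<lambda>s. \<rho> s * exp (s *\<^sub>R k)) has_vector_derivative
        \<rho> r * (exp (r *\<^sub>R k) * k) + - (k * \<rho> r) * exp (r *\<^sub>R k)) (at r within {0..})"
      by (intro has_vector_derivative_mult) auto
    then show ?thesis by (simp add: algebra_simps)
  qed
  then obtain c where c: "\<And>r. r \<in> {0..} \<Longrightarrow> \<rho> r * exp (r *\<^sub>R k) = c"
    using has_vector_derivative_zero_constant[of "{0..}" "\<lambda>s. \<rho> s * exp (s *\<^sub>R k)"] by auto
  have "\<rho> r = exp (- (r *\<^sub>R k))" if "0 \<le> r" for r
    using c[of 0] c[of r] that one by (simp add: exp_minus field_simps)
  then show ?thesis by (rule that)
qed

text \<open>The generator supplies right derivatives only. For each \<epsilon> the bound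
  \<open>\<epsilon> * (t - a)\<close> is continued: it is closed by continuity, and a vanishing
  right derivative carries it a little beyond any time before \<open>b\<close> reached so
  far.\<close>

lemma right_derivative_zero_const:
  fixes f :: "real \<Rightarrow> 'a::real_normed_vector"
  assumes cont: "continuous_on {a..b} f"
    and deriv: "\<And>t. a \<le> t \<Longrightarrow> t < b \<Longrightarrow> (f has_vector_derivative 0) (at t within {t..})"
    and t: "t \<in> {a..b}"
  shows "f t = f a"
proof -
  have main: "norm (f t - f a) \<le> \<epsilon> * (t - a)" if \<epsilon>: "\<epsilon> > 0" for \<epsilon>
  proof -
    define G where "G = {s \<in> {a..b}. norm (f s - f a) \<le> \<epsilon> * (s - a)}"
    \<comment> \<open>Asking for the whole initial segment makes the supremum of \<open>S\<close>
      control all earlier times.\<close>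
    define S where "S = {s \<in> {a..b}. {a..s} \<subseteq> G}"
    have "closed ({a..b} \<inter> (\<lambda>s. \<epsilon> * (s - a) - norm (f s - f a)) -` {0..})"
      by (intro continuous_closed_preimage continuous_intros cont)
    also have "{a..b} \<inter> (\<lambda>s. \<epsilon> * (s - a) - norm (f s - f a)) -` {0..} = G" by (auto simp: G_def)
    finally have "closed G" .
    have ab: "a \<le> b" using t by auto
    have aS: "a \<in> S" using ab by (auto simp: S_def G_def)
    have Sb: "s \<le> b" if "s \<in> S" for s using that by (simp add: S_def)
    then have bdd: "bdd_above S" by (rule bdd_aboveI)
    define T where "T = Sup S"
    have "a \<le> T" unfolding T_def by (rule cSup_upper[OF aS bdd])
    moreover have "T \<le> b" unfolding T_def by (rule cSup_least[OF _ Sb]) (use aS in blast)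
    ultimately have Tb: "a \<le> T" "T \<le> b" .
    have below: "s \<in> G" if "a \<le> s" "s < T" for s
    proof -
      obtain r where "r \<in> S" "s < r" using less_cSupE[of s S] aS \<open>s < T\<close> unfolding T_def by blast
      then show ?thesis using that by (auto simp: S_def)
    qed
    have "T \<in> G"
    proof (cases "T = a")
      case False
      then have "T \<in> closure {a..<T}" using Tb by simp
      moreover have "closure {a..<T} \<subseteq> G" by (rule closure_minimal) (use below \<open>closed G\<close> in auto)
      ultimately show ?thesis by blast
    qed (use ab in \<open>auto simp: G_def\<close>)
    then have TS: "{a..T} \<subseteq> G" using below by (force simp: less_le)
    have "T = b"
    proof (rule ccontr)
      assume "T \<noteq> b"
      then have "T < b" using Tb by simp
      have "(f has_derivative (\<lambda>_. 0)) (at T within {T..})"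
        using deriv[OF Tb(1) \<open>T < b\<close>] by (simp add: has_vector_derivative_def)
      then obtain d where d: "d > 0" "\<And>s. s \<in> {T..} \<Longrightarrow> norm (s - T) < d \<Longrightarrow> norm (f s - f T) \<le> \<epsilon> * norm (s - T)"
        using \<epsilon> unfolding has_derivative_within_alt by auto
      define T' where "T' = min b (T + d / 2)"
      have T': "T < T'" "T' \<le> b" using \<open>T < b\<close> d(1) by (auto simp: T'_def)
      have "s \<in> G" if s: "s \<in> {a..T'}" for s
      proof (cases "s \<le> T")
        case False
        then have "norm (f s - f T) \<le> \<epsilon> * (s - T)" using d(2)[of s] d(1) s by (auto simp: T'_def)
        moreover have "norm (f T - f a) \<le> \<epsilon> * (T - a)" using \<open>T \<in> G\<close> by (simp add: G_def)
        ultimately have "norm (f s - f a) \<le> \<epsilon> * (s - T) + \<epsilon> * (T - a)"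
          using norm_triangle_ineq[of "f s - f T" "f T - f a"] by simp
        then show ?thesis using s T' by (simp add: G_def algebra_simps)
      qed (use TS s in auto)
      then have "T' \<in> S" using T' Tb by (auto simp: S_def)
      then have "T' \<le> T" using cSup_upper[OF _ bdd] by (simp add: T_def)
      then show False using T'(1) by simp
    qed
    then show ?thesis using TS t by (auto simp: G_def)
  qed
  have "norm (f t - f a) \<le> 0"
  proof (rule field_le_epsilon)
    fix e :: real assume e: "0 < e"
    have "norm (f t - f a) \<le> (e / (t - a + 1)) * (t - a)" using main[of "e / (t - a + 1)"] e t by auto
    also have "\<dots> \<le> e" using e t by (simp add: field_simps)
    finally show "norm (f t - f a) \<le> 0 + e" by simp
  qed
  then show ?thesis by simp
qed

section \<open>The complex exponent on interior arguments\<close>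

context affine_kernel
begin

definition interior_arg :: "complex^'d^'d \<Rightarrow> bool" where
  "interior_arg u \<longleftrightarrow> re_mat u \<in> Spp \<and> im_mat u \<in> Sd"

lemma interior_arg_CSdp: "interior_arg u \<Longrightarrow> u \<in> CSdp"
  by (auto simp: interior_arg_def CSdp_iff Spp_Sdp)

text \<open>The quotient \<rho> is multiplicative and bounded on the cone. Along each ray it is an
  exponential with some rate \<open>k x\<close>; boundedness makes \<open>Re (k x)\<close>
  nonnegative, and injectivity along rays makes \<open>k\<close> additive and homogeneous, so a
  matrix represents it.\<close>

lemma exponent_exists:
  assumes t: "0 \<le> t" and u: "interior_arg u" and nz: "g t 0 u \<noteq> 0"
  shows "\<exists>M\<in>CSdp. \<forall>x\<in>Sdp. g t x u = g t 0 u * exp (- cip M x)"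
proof -
  have uC: "u \<in> CSdp" by (rule interior_arg_CSdp[OF u])
  have u': "re_mat u \<in> Spp" "im_mat u \<in> Sd" using u by (auto simp: interior_arg_def)
  define \<rho> where "\<rho> x = g t x u / g t 0 u" for x
  have \<rho>_mult: "\<rho> (x + y) = \<rho> x * \<rho> y" if "x \<in> Sdp" "y \<in> Sdp" for x y
    using g_functional_equation_interior[OF t that u'] nz by (simp add: \<rho>_def field_simps)
  have \<rho>_bound: "norm (\<rho> x) \<le> 1 / norm (g t 0 u)" if "x \<in> Sdp" for x
    using norm_g_le_1[OF t that uC] nz by (simp add: \<rho>_def norm_divide field_simps)
  have "\<exists>k. \<forall>r\<ge>0. \<rho> (r *\<^sub>R x) = exp (- (r *\<^sub>R k))" if x: "x \<in> Sdp" for x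
  proof -
    have "continuous_on {0..} (\<lambda>r. \<rho> (r *\<^sub>R x))"
      unfolding \<rho>_def
      by (intro continuous_intros continuous_on_compose2[OF continuous_on_g_space[OF t u']])
         (use nz x in \<open>auto intro: Sdp_scaleR\<close>)
    moreover have "\<rho> ((r + s) *\<^sub>R x) = \<rho> (r *\<^sub>R x) * \<rho> (s *\<^sub>R x)" if "0 \<le> r" "0 \<le> s" for r s
      using that x by (simp add: scaleR_add_left \<rho>_mult Sdp_scaleR)
    moreover have "\<rho> (0 *\<^sub>R x) = 1" using nz by (simp add: \<rho>_def)
    ultimately obtain k where "\<And>r. 0 \<le> r \<Longrightarrow> \<rho> (r *\<^sub>R x) = exp (- (r *\<^sub>R k))"
      using continuous_ray_character[of "\<lambda>r. \<rho> (r *\<^sub>R x)"] by blast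
    then show ?thesis by blast
  qed
  then obtain k where k: "\<And>x r. x \<in> Sdp \<Longrightarrow> 0 \<le> r \<Longrightarrow> \<rho> (r *\<^sub>R x) = exp (- (r *\<^sub>R k x))" by metis
  have k_pos: "0 \<le> Re (k x)" if x: "x \<in> Sdp" for x
  proof -
    \<comment> \<open>The bound on \<rho> is uniform along the ray, so the logarithm of its modulus
      cannot have positive slope.\<close>
    have "- Re (k x) \<le> 0"
    proof (rule affine_le_imp_slope_le[of 0 _ "ln (1 / norm (g t 0 u))"])
      fix l :: real assume l: "0 \<le> l"
      have "exp (- (l * Re (k x))) = norm (\<rho> (l *\<^sub>R x))" by (simp add: k[OF x l])
      also have "\<dots> \<le> 1 / norm (g t 0 u)" by (rule \<rho>_bound[OF Sdp_scaleR[OF x l]])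
      finally have "ln (exp (- (l * Re (k x)))) \<le> ln (1 / norm (g t 0 u))"
        by (subst ln_le_cancel_iff) (use nz in auto)
      then show "0 + l * - Re (k x) \<le> ln (1 / norm (g t 0 u)) + l * 0" by simp
    qed
    then show ?thesis by simp
  qed
  have k_add: "k (x + y) = k x + k y" if "x \<in> Sdp" "y \<in> Sdp" for x y
  proof (rule exp_ray_inj[OF k_pos[OF Sdp_add[OF that]]])
    fix s :: real assume s: "0 \<le> s"
    have "exp (- (s *\<^sub>R k (x + y))) = \<rho> (s *\<^sub>R x + s *\<^sub>R y)"
      using k[OF Sdp_add[OF that] s] by (simp add: scaleR_add_right)
    also have "\<dots> = exp (- (s *\<^sub>R k x)) * exp (- (s *\<^sub>R k y))"
      using that s by (simp add: \<rho>_mult Sdp_scaleR k)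
    also have "\<dots> = exp (- (s *\<^sub>R (k x + k y)))" by (simp add: exp_add[symmetric] algebra_simps)
    finally show "exp (- (s *\<^sub>R k (x + y))) = exp (- (s *\<^sub>R (k x + k y)))" .
  qed
  have k_scale: "k (r *\<^sub>R x) = r *\<^sub>R k x" if "x \<in> Sdp" "0 \<le> r" for x r
  proof (rule exp_ray_inj[OF k_pos[OF Sdp_scaleR[OF that]]])
    fix s :: real assume s: "0 \<le> s"
    show "exp (- (s *\<^sub>R k (r *\<^sub>R x))) = exp (- (s *\<^sub>R (r *\<^sub>R k x)))"
      using k[OF Sdp_scaleR[OF that] s] k[OF that(1), of "s * r"] s that(2) by simp
  qed
  define M where "M = (\<chi> i j. if i = j then k (Ediag i) else (k (Epair i j) - k (Ediag i) - k (Ediag j)) / 2)"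
  have M: "cip M x = k x" if "x \<in> Sdp" for x
    unfolding M_def by (rule cone_additive_representation[OF k_add k_scale that])
  have "M \<in> CSdp"
  proof (rule cip_CSdp_I)
    have "Epair i j = Epair j i" for i j :: 'd by (simp add: Epair_def vec_eq_iff disj_commute)
    then show "M$i$j = M$j$i" for i j by (simp add: M_def)
  qed (simp add: M k_pos)
  moreover have "g t x u = g t 0 u * exp (- cip M x)" if "x \<in> Sdp" for x
    using k[OF that, of 1] nz by (simp add: M[OF that] \<rho>_def field_simps)
  ultimately show ?thesis by blast
qed

text \<open>Junk value: \<open>\<psi> t u\<close> is unspecified where \<open>g t 0 u = 0\<close>.\<close>
definition \<psi> :: "real \<Rightarrow> complex^'d^'d \<Rightarrow> complex^'d^'d" where
  "\<psi> t u = (SOME M. M \<in> CSdp \<and> (\<forall>x\<in>Sdp. g t x u = g t 0 u * exp (- cip M x)))"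

lemma
  assumes "0 \<le> t" "interior_arg u" "g t 0 u \<noteq> 0"
  shows \<psi>_CSdp: "\<psi> t u \<in> CSdp"
    and g_eq_\<psi>: "x \<in> Sdp \<Longrightarrow> g t x u = g t 0 u * exp (- cip (\<psi> t u) x)"
  using someI_ex[OF exponent_exists[OF assms, unfolded Bex_def]] unfolding \<psi>_def by blast+

text \<open>The modulus of \<open>g t (l *\<^sub>R x) u\<close> decays in \<open>l\<close> at the
  rate given by the real part of \<open>\<psi> t u\<close>, the dominating real transform at the
  rate given by \<open>\<psi>0\<close>. So that real part dominates
  \<open>\<psi>0 t (re_mat u)\<close>, which is positive definite by
  \<open>\<psi>0_Spp\<close>.\<close>

lemma \<psi>_interior:
  assumes t: "0 \<le> t" and u: "interior_arg u" and nz: "g t 0 u \<noteq> 0"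
  shows "interior_arg (\<psi> t u)"
proof -
  have v: "re_mat u \<in> Spp" using u by (simp add: interior_arg_def)
  have "\<psi>0 t (re_mat u) \<in> Spp" by (rule \<psi>0_Spp[OF t v])
  moreover have "re_mat (\<psi> t u) - \<psi>0 t (re_mat u) \<in> Sdp"
  proof -
    have "0 \<le> ip (re_mat (\<psi> t u) - \<psi>0 t (re_mat u)) x" if x: "x \<in> Sdp" for x
    proof -
      have "ip (\<psi>0 t (re_mat u)) x \<le> ip (re_mat (\<psi> t u)) x"
      proof (rule affine_le_imp_slope_le[of "\<phi>0 t (re_mat u)" _ "- ln (norm (g t 0 u))"])
        fix l :: real assume l: "0 \<le> l"
        have "norm (g t 0 u) * exp (- (l * ip (re_mat (\<psi> t u)) x)) = norm (g t (l *\<^sub>R x) u)"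
          unfolding g_eq_\<psi>[OF t u nz Sdp_scaleR[OF x l]] by (simp add: norm_mult Re_cip ip.scaleR_right)
        also have "\<dots> \<le> exp (- \<phi>0 t (re_mat u) - ip (\<psi>0 t (re_mat u)) (l *\<^sub>R x))"
          by (rule norm_g_le[OF t Sdp_scaleR[OF x l] interior_arg_CSdp[OF u]])
        finally have "ln (norm (g t 0 u) * exp (- (l * ip (re_mat (\<psi> t u)) x)))
            \<le> ln (exp (- \<phi>0 t (re_mat u) - ip (\<psi>0 t (re_mat u)) (l *\<^sub>R x)))"
          by (subst ln_le_cancel_iff) (use nz in auto)
        then show "\<phi>0 t (re_mat u) + l * ip (\<psi>0 t (re_mat u)) x \<le> - ln (norm (g t 0 u)) + l * ip (re_mat (\<psi> t u)) x"
          using nz by (simp add: ln_mult ip.scaleR_right)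
      qed
      then show ?thesis by (simp add: ip.diff_left)
    qed
    moreover have "re_mat (\<psi> t u) - \<psi>0 t (re_mat u) \<in> Sd"
      using \<psi>_CSdp[OF t u nz] \<psi>0_Sdp[OF t Spp_Sdp[OF v]] subspace_diff[OF subspace_Sd] Sdp_Sd
      by (auto simp: CSdp_iff)
    ultimately show ?thesis unfolding Sdp_iff[of "re_mat (\<psi> t u) - _"] using outer_Sdp by blast
  qed
  ultimately have "\<psi>0 t (re_mat u) + (re_mat (\<psi> t u) - \<psi>0 t (re_mat u)) \<in> Spp" by (rule Spp_Sdp_add)
  then show ?thesis using \<psi>_CSdp[OF t u nz] by (simp add: interior_arg_def CSdp_iff)
qed

text \<open>Convergence on the whole cone includes convergence on every ray, from which exponents
  are recovered without a logarithm.\<close>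

lemma tendsto_exponent:
  fixes M :: "nat \<Rightarrow> complex^'d^'d"
  assumes M: "\<And>n. M n \<in> CSdp" "M0 \<in> CSdp"
    and lim: "\<And>x. x \<in> Sdp \<Longrightarrow> (\<lambda>n. exp (- cip (M n) x)) \<longlonglongrightarrow> exp (- cip M0 x)"
  shows "M \<longlonglongrightarrow> M0"
proof (rule tendsto_cip_imp_tendsto)
  fix x :: "real^'d^'d" assume x: "x \<in> Sdp"
  show "(\<lambda>n. cip (M n) x) \<longlonglongrightarrow> cip M0 x"
  proof (rule tendsto_of_exp_ray_tendsto)
    show "0 \<le> Re (cip (M n) x)" for n by (rule Re_cip_nonneg[OF M(1) x])
    show "(\<lambda>n. exp (- (s *\<^sub>R cip (M n) x))) \<longlonglongrightarrow> exp (- (s *\<^sub>R cip M0 x))" if "0 \<le> s" for s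
      using lim[OF Sdp_scaleR[OF x that]] by (simp add: cip.scaleR_right)
  qed
qed (use M CSdp_sym in auto)

text \<open>The quotients \<open>g t x u / g t 0 u\<close> are continuous in \<open>t\<close> for
  each \<open>x\<close>, and they determine the exponent.\<close>

lemma continuous_on_\<psi>:
  assumes u: "interior_arg u" and nz: "\<And>t. t \<in> S \<Longrightarrow> g t 0 u \<noteq> 0" and S: "S \<subseteq> {0..}"
  shows "continuous_on S (\<lambda>t. \<psi> t u)"
  unfolding continuous_on_sequentially
proof safe
  fix \<tau> :: "nat \<Rightarrow> real" and t
  assume t: "t \<in> S" and \<tau>: "\<forall>n. \<tau> n \<in> S" and lim: "\<tau> \<longlonglongrightarrow> t"
  have nn: "0 \<le> t" "\<And>n. 0 \<le> \<tau> n" using t \<tau> S by auto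
  have glim: "(\<lambda>n. g (\<tau> n) x u) \<longlonglongrightarrow> g t x u" if "x \<in> Sdp" for x
    using continuous_on_g[OF that interior_arg_CSdp[OF u]] lim nn
    by (intro continuous_on_tendsto_compose[of "{0..}" "\<lambda>t. g t x u"]) auto
  show "((\<lambda>t. \<psi> t u) \<circ> \<tau>) \<longlonglongrightarrow> \<psi> t u"
    unfolding o_def
  proof (rule tendsto_exponent)
    show "\<psi> (\<tau> n) u \<in> CSdp" for n using \<psi>_CSdp[OF nn(2) u nz] \<tau> by blast
    show "\<psi> t u \<in> CSdp" using \<psi>_CSdp[OF nn(1) u nz] t by blast
    fix x :: "real^'d^'d" assume x: "x \<in> Sdp"
    have eq: "exp (- cip (\<psi> r u) x) = g r x u / g r 0 u" if "r \<in> S" for r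
      using g_eq_\<psi>[OF _ u nz[OF that] x] nz[OF that] S that by auto
    have "(\<lambda>n. g (\<tau> n) x u / g (\<tau> n) 0 u) \<longlonglongrightarrow> g t x u / g t 0 u"
      using nz[OF t] x by (intro tendsto_intros glim) auto
    then show "(\<lambda>n. exp (- cip (\<psi> (\<tau> n) u) x)) \<longlonglongrightarrow> exp (- cip (\<psi> t u) x)"
      using eq t \<tau> by simp
  qed
qed

end

section \<open>The generator on exponentials\<close>

text \<open>Just enough polynomials to contain a Gaussian exponent and to be closed under the
  derivatives of \<open>P x * exp (q x)\<close>.\<close>

inductive cpoly :: "('a::real_inner \<Rightarrow> complex) \<Rightarrow> bool" where
  const: "cpoly (\<lambda>_. a)"
| linear: "bounded_linear f \<Longrightarrow> cpoly f"
| square: "cpoly (\<lambda>x. complex_of_real (x \<bullet> x))"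
| add: "cpoly f \<Longrightarrow> cpoly h \<Longrightarrow> cpoly (\<lambda>x. f x + h x)"
| mult: "cpoly f \<Longrightarrow> cpoly h \<Longrightarrow> cpoly (\<lambda>x. f x * h x)"

lemma cpoly_derivative:
  "cpoly f \<Longrightarrow> \<exists>D. (\<forall>v. cpoly (\<lambda>x. D x v)) \<and> (\<forall>x. (f has_derivative D x) (at x))"
proof (induction rule: cpoly.induct)
  case (const a)
  show ?case by (intro exI[of _ "\<lambda>_ _. 0"]) (auto intro: cpoly.const)
next
  case (linear f)
  then show ?case by (intro exI[of _ "\<lambda>_. f"]) (auto intro: cpoly.const bounded_linear_imp_has_derivative)
next
  case square
  have "((\<lambda>x. complex_of_real (x \<bullet> x)) has_derivative (\<lambda>v. complex_of_real (2 * (v \<bullet> x)))) (at x)" for x :: 'a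
    by (auto intro!: derivative_eq_intros simp: inner_commute)
  moreover have "cpoly (\<lambda>x. complex_of_real (2 * (v \<bullet> x)))" for v :: 'a
    by (intro cpoly.linear bounded_linear_compose[OF bounded_linear_of_real]
        bounded_linear_compose[OF bounded_linear_mult_right] bounded_linear_inner_right)
  ultimately show ?case by (intro exI[of _ "\<lambda>x v. complex_of_real (2 * (v \<bullet> x))"]) blast
next
  case (add f h)
  then obtain D D' where "\<forall>v. cpoly (\<lambda>x. D x v)" "\<forall>x. (f has_derivative D x) (at x)"
    "\<forall>v. cpoly (\<lambda>x. D' x v)" "\<forall>x. (h has_derivative D' x) (at x)" by blast
  then show ?case
    by (intro exI[of _ "\<lambda>x v. D x v + D' x v"]) (auto intro: cpoly.add has_derivative_add)
next
  case (mult f h)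
  then obtain D D' where "\<forall>v. cpoly (\<lambda>x. D x v)" "\<forall>x. (f has_derivative D x) (at x)"
    "\<forall>v. cpoly (\<lambda>x. D' x v)" "\<forall>x. (h has_derivative D' x) (at x)" by blast
  with mult.hyps show ?case
    by (intro exI[of _ "\<lambda>x v. f x * D' x v + D x v * h x"] conjI allI cpoly.add cpoly.mult has_derivative_mult) blast+
qed

lemma cpoly_growth:
  "cpoly f \<Longrightarrow> \<exists>C n. 0 \<le> C \<and> (\<forall>x. norm (f x) \<le> C * (1 + norm x) ^ n)"
proof (induction rule: cpoly.induct)
  case (const a)
  show ?case by (intro exI[of _ "norm a"] exI[of _ 0]) auto
next
  case (linear f)
  then obtain K where K: "\<And>x. norm (f x) \<le> norm x * K" "0 \<le> K"
    using bounded_linear.nonneg_bounded by blast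
  have "norm (f x) \<le> K * (1 + norm x) ^ 1" for x
    using K(1)[of x] K(2) by (simp add: algebra_simps)
  then show ?case using K(2) by blast
next
  case square
  have "norm (complex_of_real (x \<bullet> x)) \<le> 1 * (1 + norm x) ^ 2" for x :: 'a
    unfolding norm_of_real by (simp add: dot_square_norm power2_sum)
  then show ?case by (metis zero_le_one)
next
  case (add f h)
  then obtain C D n k where C: "0 \<le> C" "0 \<le> D" "\<And>x. norm (f x) \<le> C * (1 + norm x) ^ n"
    "\<And>x. norm (h x) \<le> D * (1 + norm x) ^ k" by blast
  have "norm (f x + h x) \<le> (C + D) * (1 + norm x) ^ (n + k)" for x
  proof -
    have "norm (f x + h x) \<le> C * (1 + norm x) ^ n + D * (1 + norm x) ^ k"
      by (rule norm_triangle_mono[OF C(3,4)])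
    also have "\<dots> \<le> C * (1 + norm x) ^ (n + k) + D * (1 + norm x) ^ (n + k)"
      using C(1,2) by (intro add_mono mult_left_mono power_increasing) auto
    finally show ?thesis by (simp add: algebra_simps)
  qed
  then show ?case using C(1,2) add_nonneg_nonneg by blast
next
  case (mult f h)
  then obtain C D n k where C: "0 \<le> C" "0 \<le> D" "\<And>x. norm (f x) \<le> C * (1 + norm x) ^ n"
    "\<And>x. norm (h x) \<le> D * (1 + norm x) ^ k" by blast
  have "norm (f x * h x) \<le> (C * D) * (1 + norm x) ^ (n + k)" for x
  proof -
    have "norm (f x * h x) \<le> (C * (1 + norm x) ^ n) * (D * (1 + norm x) ^ k)"
      unfolding norm_mult by (rule mult_mono[OF C(3,4)]) (use C in auto)
    then show ?thesis by (simp add: power_add algebra_simps)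
  qed
  then show ?case using C(1,2) mult_nonneg_nonneg by blast
qed

text \<open>From \<open>(1 + y / n) ^ n \<le> exp y\<close> with \<open>n = Suc N\<close>, which
  keeps the denominator positive for \<open>N = 0\<close>.\<close>

lemma power_exp_bound:
  fixes y :: real
  assumes "0 \<le> y"
  shows "(1 + y) ^ N * exp (- y) \<le> real (Suc N) ^ Suc N"
proof -
  have "(1 + y) ^ N \<le> (1 + y) ^ Suc N" using assms by (intro power_increasing) auto
  also have "\<dots> \<le> (real (Suc N) * (1 + y / real (Suc N))) ^ Suc N"
    using assms by (intro power_mono) (auto simp: field_simps)
  also have "\<dots> = real (Suc N) ^ Suc N * (1 + y / real (Suc N)) ^ Suc N" by (rule power_mult_distrib)
  also have "\<dots> \<le> real (Suc N) ^ Suc N * exp y"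
    using assms by (intro mult_left_mono exp_ge_one_plus_x_over_n_power_n) auto
  finally show ?thesis by (simp add: exp_minus field_simps)
qed

lemma cpoly_exp_derivative:
  assumes "(P has_derivative DP) (at x)" "(q has_derivative Dq) (at x)"
  shows "((\<lambda>x. Re (P x * exp (q x))) has_derivative (\<lambda>v. Re ((P x * Dq v + DP v) * exp (q x)))) (at x)"
proof -
  have "((\<lambda>x. exp (q x)) has_derivative (\<lambda>v. Dq v * exp (q x))) (at x)"
    using has_derivative_compose[OF assms(2) DERIV_exp[of "q x", unfolded has_field_derivative_def]]
    by (simp add: mult.commute)
  from has_derivative_Re[OF has_derivative_mult[OF assms(1) this]]
  show ?thesis by (rule has_derivative_eq_rhs) (simp add: algebra_simps)
qed

lemma dirder_eq:
  assumes "(f has_derivative D) (at x)"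
  shows "dirder v f x = D v"
proof -
  have "((\<lambda>s. f (x + s *\<^sub>R v)) has_derivative (\<lambda>s. D (s *\<^sub>R v))) (at 0)"
    by (rule has_derivative_compose[of "\<lambda>s. x + s *\<^sub>R v" _ 0 UNIV f D])
      (use assms in \<open>auto intro!: derivative_eq_intros\<close>)
  moreover have "D (s *\<^sub>R v) = D v * s" for s
    using linear_scale[OF has_derivative_linear[OF assms]] by (simp add: mult.commute)
  ultimately have "((\<lambda>s. f (x + s *\<^sub>R v)) has_field_derivative D v) (at 0)"
    by (simp add: has_field_derivative_def)
  then show ?thesis unfolding dirder_def by (rule DERIV_imp_deriv)
qed

text \<open>Every iterated derivative is again a polynomial times \<open>exp (q x)\<close>, and the
  factor \<open>exp (K - norm x)\<close> beats each power of the norm.\<close>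

lemma rapidly_decreasing_cpoly_exp:
  fixes q :: "real^'d^'d \<Rightarrow> complex"
  assumes P: "cpoly P" and q: "cpoly q" and K: "\<And>x. Re (q x) \<le> K - norm x"
  shows "rapidly_decreasing (\<lambda>x. Re (P x * exp (q x)))"
proof -
  obtain Dq where Dq: "\<And>v. cpoly (\<lambda>x. Dq x v)" "\<And>x. (q has_derivative Dq x) (at x)"
    using cpoly_derivative[OF q] by blast
  have iter: "\<exists>P'. cpoly P' \<and> iter_dirder vs (\<lambda>x. Re (P x * exp (q x))) = (\<lambda>x. Re (P' x * exp (q x)))" for vs
  proof (induction vs)
    case (Cons v vs)
    then obtain P' where P': "cpoly P'" "iter_dirder vs (\<lambda>x. Re (P x * exp (q x))) = (\<lambda>x. Re (P' x * exp (q x)))" by blast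
    obtain D where D: "\<And>v. cpoly (\<lambda>x. D x v)" "\<And>x. (P' has_derivative D x) (at x)"
      using cpoly_derivative[OF P'(1)] by blast
    have "iter_dirder (v # vs) (\<lambda>x. Re (P x * exp (q x))) = (\<lambda>x. Re ((P' x * Dq x v + D x v) * exp (q x)))"
      unfolding iter_dirder.simps P'(2) fun_eq_iff dirder_eq[OF cpoly_exp_derivative[OF D(2) Dq(2)]] by blast
    moreover have "cpoly (\<lambda>x. P' x * Dq x v + D x v)" by (intro cpoly.intros P' D Dq)
    ultimately show ?case by blast
  qed (use P in auto)
  show ?thesis unfolding rapidly_decreasing_def
  proof (intro allI conjI)
    fix vs
    obtain P' where P': "cpoly P'" "iter_dirder vs (\<lambda>x. Re (P x * exp (q x))) = (\<lambda>x. Re (P' x * exp (q x)))"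
      using iter by blast
    obtain D where D: "\<And>x. (P' has_derivative D x) (at x)" using cpoly_derivative[OF P'(1)] by blast
    show "iter_dirder vs (\<lambda>x. Re (P x * exp (q x))) differentiable at x" for x
      unfolding P'(2) differentiable_def using cpoly_exp_derivative[OF D Dq(2)] by blast
    fix k
    obtain C n where C: "0 \<le> C" "\<And>x. norm (P' x) \<le> C * (1 + norm x) ^ n" using cpoly_growth[OF P'(1)] by blast
    have "norm ((1 + norm x) ^ k * Re (P' x * exp (q x))) \<le> C * exp K * real (Suc (k + n)) ^ Suc (k + n)" for x
    proof -
      have "\<bar>Re (P' x * exp (q x))\<bar> \<le> norm (P' x) * exp (Re (q x))"
        using abs_Re_le_cmod[of "P' x * exp (q x)"] by (simp add: norm_mult)
      also have "\<dots> \<le> (C * (1 + norm x) ^ n) * exp (K - norm x)"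
        by (rule mult_mono) (use C K in auto)
      finally have "(1 + norm x) ^ k * \<bar>Re (P' x * exp (q x))\<bar> \<le> (1 + norm x) ^ k * ((C * (1 + norm x) ^ n) * exp (K - norm x))"
        by (intro mult_left_mono) auto
      also have "\<dots> = C * exp K * ((1 + norm x) ^ (k + n) * exp (- norm x))"
        by (simp add: power_add exp_diff exp_minus field_simps)
      also have "\<dots> \<le> C * exp K * real (Suc (k + n)) ^ Suc (k + n)"
        using C by (intro mult_left_mono power_exp_bound) auto
      finally show ?thesis by (simp add: abs_mult)
    qed
    then show "bounded (range (\<lambda>x. (1 + norm x) ^ k * iter_dirder vs (\<lambda>x. Re (P x * exp (q x))) x))"
      unfolding P'(2) bounded_iff by blast
  qed
qed

text \<open>Exponent of \<open>exp (- cip u y)\<close> times a Gaussian. Centring at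
  \<open>x\<close> leaves value and gradient at \<open>x\<close> unchanged, while the quadratic term
  compensates the growth outside the cone.\<close>

definition gauss_exponent :: "complex^'d^'d \<Rightarrow> real \<Rightarrow> real^'d^'d \<Rightarrow> real^'d^'d \<Rightarrow> complex" where
  "gauss_exponent u \<eta> x y = - cip u y - complex_of_real (\<eta> * ((y - x) \<bullet> (y - x)))"

lemma continuous_on_gauss_exponent: "continuous_on S (gauss_exponent u \<eta> x)"
  unfolding gauss_exponent_def by (intro continuous_intros cip.continuous_on)

lemma cpoly_gauss_exponent: "cpoly (gauss_exponent u \<eta> x)"
proof -
  have "cpoly (\<lambda>y. (- cip u y + complex_of_real (2 * \<eta> * (x \<bullet> y))) +
      (complex_of_real (- \<eta>) * complex_of_real (y \<bullet> y) + complex_of_real (- \<eta> * (x \<bullet> x))))"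
    by (intro cpoly.intros bounded_linear_add bounded_linear_minus cip.bounded_linear_right
        bounded_linear_compose[OF bounded_linear_of_real]
        bounded_linear_compose[OF bounded_linear_mult_right] bounded_linear_inner_right)
  moreover have "(- cip u y + complex_of_real (2 * \<eta> * (x \<bullet> y))) +
      (complex_of_real (- \<eta>) * complex_of_real (y \<bullet> y) + complex_of_real (- \<eta> * (x \<bullet> x))) = gauss_exponent u \<eta> x y" for y
    by (simp add: gauss_exponent_def inner_diff_left inner_diff_right inner_commute algebra_simps)
  ultimately show ?thesis by simp
qed

text \<open>Completing the square in \<open>norm (y - x)\<close>.\<close>

lemma Re_gauss_exponent_bound:
  fixes x :: "real^'d^'d"
  assumes "\<eta> > 0"
  obtains K where "\<And>y. Re (gauss_exponent u \<eta> x y) \<le> K - norm y"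
proof -
  obtain k where k: "k > 0" "\<And>(u::complex^'d^'d) (x::real^'d^'d). norm (cip u x) \<le> k * (norm u * norm x)"
    using cip_bound by blast
  \<comment> \<open>The extra 1 provides the term \<open>- norm y\<close>.\<close>
  define M where "M = k * norm u + 1"
  have "Re (gauss_exponent u \<eta> x y) \<le> (M * norm x + M\<^sup>2 / (4 * \<eta>)) - norm y" for y
  proof -
    define r where "r = norm (y - x)"
    have "0 \<le> (2 * \<eta> * r - M)\<^sup>2 / (4 * \<eta>)" using assms by simp
    also have "\<dots> = \<eta> * r\<^sup>2 - M * r + M\<^sup>2 / (4 * \<eta>)"
      using assms by (simp add: power2_eq_square field_simps)
    finally have 1: "M * r - \<eta> * r\<^sup>2 \<le> M\<^sup>2 / (4 * \<eta>)" by simp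
    have "norm y \<le> r + norm x" using norm_triangle_ineq[of "y - x" x] by (simp add: r_def)
    then have 2: "M * norm y \<le> M * (r + norm x)" using k(1) by (intro mult_left_mono) (auto simp: M_def)
    have "- Re (cip u y) \<le> k * (norm u * norm y)" using k(2)[of u y] abs_Re_le_cmod[of "cip u y"] by linarith
    then have "- Re (cip u y) \<le> M * norm y - norm y" by (simp add: M_def algebra_simps)
    moreover have "Re (gauss_exponent u \<eta> x y) = - Re (cip u y) - \<eta> * r\<^sup>2"
      by (simp add: gauss_exponent_def r_def power2_norm_eq_inner)
    ultimately show ?thesis using 1 2 by (simp add: algebra_simps)
  qed
  then show ?thesis by (rule that)
qed

lemma norm_exp_gauss_exponent_le:
  assumes "u \<in> CSdp" "y \<in> Sdp" "0 \<le> \<eta>"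
  shows "norm (exp (gauss_exponent u \<eta> x y)) \<le> 1"
proof -
  have "0 \<le> \<eta> * ((y - x) \<bullet> (y - x))" by (intro mult_nonneg_nonneg assms inner_ge_zero)
  moreover have "Re (gauss_exponent u \<eta> x y) = - Re (cip u y) - \<eta> * ((y - x) \<bullet> (y - x))"
    by (simp add: gauss_exponent_def)
  ultimately have "Re (gauss_exponent u \<eta> x y) \<le> 0" using Re_cip_nonneg[OF assms(1,2)] by linarith
  then show ?thesis by simp
qed

lemma gauss_rapidly_decreasing:
  assumes "\<eta> > 0"
  shows "rapidly_decreasing (\<lambda>y. Re (\<kappa> * exp (gauss_exponent u \<eta> x y)))"
proof -
  obtain K where "\<And>y. Re (gauss_exponent u \<eta> x y) \<le> K - norm y" using Re_gauss_exponent_bound[OF assms] by blast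
  then show ?thesis by (rule rapidly_decreasing_cpoly_exp[OF cpoly.const cpoly_gauss_exponent])
qed

lemma gauss_exponent_derivative:
  "(gauss_exponent u \<eta> x has_derivative (\<lambda>v. - cip u v - complex_of_real (2 * \<eta> * ((y - x) \<bullet> v)))) (at y)"
proof -
  have "((\<lambda>y. (y - x) \<bullet> (y - x)) has_derivative (\<lambda>v. 2 * ((y - x) \<bullet> v))) (at y)"
    by (auto intro!: derivative_eq_intros simp: inner_commute)
  from has_derivative_diff[OF has_derivative_minus[OF bounded_linear_imp_has_derivative[OF cip.bounded_linear_right]]
      has_derivative_of_real[OF has_derivative_mult_right[OF this]]]
  show ?thesis unfolding gauss_exponent_def by (simp add: mult.assoc mult.left_commute)
qed

lemma nabla_gauss:
  "nabla k l (\<lambda>y. Re (\<kappa> * exp (gauss_exponent u \<eta> x y))) y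
    = Re ((\<kappa> * (- cip u (Esym k l) - complex_of_real (2 * \<eta> * ((y - x) \<bullet> Esym k l)))) * exp (gauss_exponent u \<eta> x y))"
  unfolding nabla_def
  by (subst dirder_eq[OF cpoly_exp_derivative[OF has_derivative_const gauss_exponent_derivative]]) simp

text \<open>At its centre the Gaussian contributes only its Hessian, the term with factor \<eta>,
  which disappears in the limit.\<close>

lemma nabla_nabla_gauss:
  assumes "\<And>k l. u$k$l = u$l$k"
  shows "nabla i j (nabla k l (\<lambda>y. Re (\<kappa> * exp (gauss_exponent u \<eta> x y)))) x
    = Re (\<kappa> * exp (- cip u x) * (u$i$j * u$k$l - complex_of_real (2 * \<eta> * (Esym i j \<bullet> Esym k l))))"
proof -
  let ?P = "\<lambda>y. \<kappa> * (- cip u (Esym k l) - complex_of_real (2 * \<eta> * ((y - x) \<bullet> Esym k l)))"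
  have "(?P has_derivative (\<lambda>v. \<kappa> * (- complex_of_real (2 * \<eta> * (v \<bullet> Esym k l))))) (at x)"
    by (auto intro!: derivative_eq_intros)
  note d = cpoly_exp_derivative[OF this gauss_exponent_derivative]
  have "nabla i j (\<lambda>y. Re (?P y * exp (gauss_exponent u \<eta> x y))) x = Re (\<kappa> * exp (- cip u x) * (cip u (Esym i j) * cip u (Esym k l) - complex_of_real (2 * \<eta> * (Esym i j \<bullet> Esym k l))))"
    unfolding nabla_def dirder_eq[OF d] by (simp add: gauss_exponent_def algebra_simps)
  moreover have "cip u (Esym i j) = u$i$j" for i j using assms[of i j] by (simp add: cip_Esym)
  ultimately show ?thesis unfolding nabla_gauss[abs_def] by simp
qed

lemma nabla_gauss_at:
  assumes "\<And>k l. u$k$l = u$l$k"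
  shows "nabla k l (\<lambda>y. Re (\<kappa> * exp (gauss_exponent u \<eta> x y))) x = Re (\<kappa> * exp (- cip u x) * - (u$k$l))"
proof -
  have "cip u (Esym k l) = u$k$l" using assms[of k l] by (simp add: cip_Esym)
  then show ?thesis unfolding nabla_gauss by (simp add: gauss_exponent_def algebra_simps)
qed

definition gauss_jump :: "(real^'d^'d) measure \<Rightarrow> complex^'d^'d \<Rightarrow> real \<Rightarrow> complex" where
  "gauss_jump N u \<eta> = (\<integral>\<xi>. exp (- cip u \<xi> - complex_of_real (\<eta> * (\<xi> \<bullet> \<xi>))) - 1 \<partial>N)"

text \<open>A domination uniform in \<eta> up to 1: for norms up to 1 the Gaussian part adds at most
  \<open>norm x\<close>, beyond that the bound 2 applies.\<close>

lemma gauss_jump_bound: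
  fixes u :: "complex^'d^'d"
  assumes k: "k > 0" "\<And>(u::complex^'d^'d) x. norm (cip u x) \<le> k * (norm u * norm x)"
    and u: "u \<in> CSdp" and x: "x \<in> Sdp" and \<eta>: "0 \<le> \<eta>" "\<eta> \<le> 1"
  shows "norm (exp (- cip u x - complex_of_real (\<eta> * (x \<bullet> x))) - 1) \<le> (3 + k * norm u) * min (norm x) 1"
proof -
  let ?z = "cip u x + complex_of_real (\<eta> * (x \<bullet> x))"
  have "0 \<le> Re ?z" using Re_cip_nonneg[OF u x] \<eta> by simp
  from norm_exp_minus_one_le[OF this]
  have le: "norm (exp (- cip u x - complex_of_real (\<eta> * (x \<bullet> x))) - 1) \<le> min (norm ?z) 2" by (simp add: algebra_simps)
  show ?thesis
  proof (cases "norm x \<le> 1")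
    case True
    have "norm ?z \<le> norm (cip u x) + \<eta> * (x \<bullet> x)"
      using norm_triangle_ineq[of "cip u x" "complex_of_real (\<eta> * (x \<bullet> x))"] \<eta>(1) by (simp del: of_real_mult)
    also have "\<dots> \<le> k * (norm u * norm x) + 1 * (1 * norm x)"
      unfolding dot_square_norm power2_eq_square
      using k(2)[of u x] True \<eta> by (intro add_mono mult_mono) auto
    also have "\<dots> \<le> (3 + k * norm u) * norm x" by (simp add: algebra_simps)
    finally show ?thesis using le True by simp
  next
    case False
    have "0 \<le> k * norm u" using k(1) by simp
    then show ?thesis using le False by simp
  qed
qed

lemma integrable_gauss_jump:
  fixes N :: "(real^'d^'d) measure"
  assumes N: "jump_measure N" and u: "u \<in> CSdp" and \<eta>: "0 \<le> \<eta>" "\<eta> \<le> 1"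
  shows "integrable N (\<lambda>\<xi>. exp (- cip u \<xi> - complex_of_real (\<eta> * (\<xi> \<bullet> \<xi>))) - 1)"
proof -
  obtain k where k: "k > 0" "\<And>(u::complex^'d^'d) (x::real^'d^'d). norm (cip u x) \<le> k * (norm u * norm x)"
    using cip_bound by blast
  show ?thesis
    by (rule jump_integrable_bound(1)[OF N _ gauss_jump_bound[OF k u _ \<eta>]])
       (auto intro!: borel_measurable_continuous_onI continuous_intros cip.continuous_on)
qed

lemma gauss_jump_tendsto:
  fixes N :: "(real^'d^'d) measure"
  assumes N: "jump_measure N" and u: "u \<in> CSdp"
  shows "(\<lambda>n. gauss_jump N u (inverse (real (Suc n)))) \<longlonglongrightarrow> jump_transform N u"
proof -
  obtain k where k: "k > 0" "\<And>(u::complex^'d^'d) (x::real^'d^'d). norm (cip u x) \<le> k * (norm u * norm x)"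
    using cip_bound by blast
  have N': "sets N = sets borel" using N by (simp add: jump_measure_def)
  have \<eta>: "0 \<le> inverse (real (Suc n))" "inverse (real (Suc n)) \<le> 1" for n by (auto simp: field_simps)
  show ?thesis unfolding gauss_jump_def jump_transform_def
  proof (rule integral_dominated_convergence[where w="\<lambda>\<xi>. (3 + k * norm u) * min (norm \<xi>) 1"])
    show "integrable N (\<lambda>\<xi>. (3 + k * norm u) * min (norm \<xi>) 1)"
      using jump_measure_integrable_min[OF N] by simp
    show "AE \<xi> in N. (\<lambda>n. exp (- cip u \<xi> - complex_of_real (inverse (real (Suc n)) * (\<xi> \<bullet> \<xi>))) - 1) \<longlonglongrightarrow> exp (- cip u \<xi>) - 1"
    proof (rule AE_I2)
      fix \<xi> :: "real^'d^'d"
      have "(\<lambda>n. exp (- cip u \<xi> - complex_of_real (inverse (real (Suc n)) * (\<xi> \<bullet> \<xi>))) - 1) \<longlonglongrightarrow> exp (- cip u \<xi> - complex_of_real (0 * (\<xi> \<bullet> \<xi>))) - 1"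
        by (intro tendsto_intros LIMSEQ_inverse_real_of_nat)
      then show "(\<lambda>n. exp (- cip u \<xi> - complex_of_real (inverse (real (Suc n)) * (\<xi> \<bullet> \<xi>))) - 1) \<longlonglongrightarrow> exp (- cip u \<xi>) - 1" by simp
    qed
    show "AE \<xi> in N. norm (exp (- cip u \<xi> - complex_of_real (inverse (real (Suc n)) * (\<xi> \<bullet> \<xi>))) - 1) \<le> (3 + k * norm u) * min (norm \<xi>) 1" for n
      using jump_measure_AE[OF N] by eventually_elim (use gauss_jump_bound[OF k u _ \<eta>] in auto)
    show "(\<lambda>\<xi>. exp (- cip u \<xi> - complex_of_real (inverse (real (Suc n)) * (\<xi> \<bullet> \<xi>))) - 1) \<in> borel_measurable N" for n
      unfolding measurable_cong_sets[OF N' refl]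
      by (intro borel_measurable_continuous_onI continuous_intros cip.continuous_on)
  qed (simp add: measurable_cong_sets[OF N' refl])
qed

context admissible_parameters
begin

text \<open>The value of the generator on the regularised exponential at its centre, divided by
  \<open>exp (- cip u x)\<close>; the fourfold sum is the Gaussian Hessian.\<close>

definition gauss_symbol :: "complex^'d^'d \<Rightarrow> real \<Rightarrow> real^'d^'d \<Rightarrow> complex" where
  "gauss_symbol u \<eta> x = 2 * cip (u ** cmat \<alpha> ** u) x
     - complex_of_real (\<eta> * (4 * (\<Sum>i\<in>UNIV. \<Sum>j\<in>UNIV. \<Sum>k\<in>UNIV. \<Sum>l\<in>UNIV. x$l$i * \<alpha>$j$k * (Esym i j \<bullet> Esym k l))))
     - cip u (b + B x) - complex_of_real (c + ip \<gamma> x) + gauss_jump m u \<eta> + gauss_jump (mu_pair \<mu> x) u \<eta>"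

text \<open>Brings the matrix product into the index pattern of the second-order part of
  \<open>gen_A\<close>.\<close>

lemma cip_quadratic:
  "cip (u ** cmat \<alpha> ** u) x
    = (\<Sum>i\<in>UNIV. \<Sum>j\<in>UNIV. \<Sum>k\<in>UNIV. \<Sum>l\<in>UNIV. complex_of_real (x$l$i * \<alpha>$j$k) * (u$i$j * u$k$l))"
proof -
  have "cip (u ** cmat \<alpha> ** u) x = (\<Sum>i\<in>UNIV. \<Sum>l\<in>UNIV. \<Sum>k\<in>UNIV. \<Sum>j\<in>UNIV. complex_of_real (x$l$i * \<alpha>$j$k) * (u$i$j * u$k$l))"
    by (simp add: cip_def matrix_matrix_mult_def cmat_def sum_distrib_right sum_distrib_left algebra_simps)
  also have "\<dots> = (\<Sum>i\<in>UNIV. \<Sum>j\<in>UNIV. \<Sum>k\<in>UNIV. \<Sum>l\<in>UNIV. complex_of_real (x$l$i * \<alpha>$j$k) * (u$i$j * u$k$l))"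
  proof (rule sum.cong[OF refl])
    fix i
    have "(\<Sum>l\<in>UNIV. \<Sum>k\<in>UNIV. \<Sum>j\<in>UNIV. complex_of_real (x$l$i * \<alpha>$j$k) * (u$i$j * u$k$l))
      = (\<Sum>l\<in>UNIV. \<Sum>j\<in>UNIV. \<Sum>k\<in>UNIV. complex_of_real (x$l$i * \<alpha>$j$k) * (u$i$j * u$k$l))"
      by (intro sum.cong refl sum.swap)
    also have "\<dots> = (\<Sum>j\<in>UNIV. \<Sum>l\<in>UNIV. \<Sum>k\<in>UNIV. complex_of_real (x$l$i * \<alpha>$j$k) * (u$i$j * u$k$l))"
      by (rule sum.swap)
    also have "\<dots> = (\<Sum>j\<in>UNIV. \<Sum>k\<in>UNIV. \<Sum>l\<in>UNIV. complex_of_real (x$l$i * \<alpha>$j$k) * (u$i$j * u$k$l))"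
      by (intro sum.cong refl sum.swap)
    finally show "(\<Sum>l\<in>UNIV. \<Sum>k\<in>UNIV. \<Sum>j\<in>UNIV. complex_of_real (x$l$i * \<alpha>$j$k) * (u$i$j * u$k$l))
      = (\<Sum>j\<in>UNIV. \<Sum>k\<in>UNIV. \<Sum>l\<in>UNIV. complex_of_real (x$l$i * \<alpha>$j$k) * (u$i$j * u$k$l))" .
  qed
  finally show ?thesis .
qed

lemma gauss_jump_integral:
  assumes N: "jump_measure N" and u: "u \<in> CSdp" and \<eta>: "0 \<le> \<eta>" "\<eta> \<le> 1"
  shows "set_lebesgue_integral N (Sdp - {0}) (\<lambda>\<xi>. Re (\<kappa> * exp (gauss_exponent u \<eta> x (x + \<xi>))) - Re (\<kappa> * exp (gauss_exponent u \<eta> x x)))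
    = Re (\<kappa> * exp (- cip u x) * gauss_jump N u \<eta>)"
proof -
  have eq: "Re (\<kappa> * exp (gauss_exponent u \<eta> x (x + \<xi>))) - Re (\<kappa> * exp (gauss_exponent u \<eta> x x))
      = Re (\<kappa> * exp (- cip u x) * (exp (- cip u \<xi> - complex_of_real (\<eta> * (\<xi> \<bullet> \<xi>))) - 1))" for \<xi>
  proof -
    have "gauss_exponent u \<eta> x (x + \<xi>) = - cip u x + (- cip u \<xi> - complex_of_real (\<eta> * (\<xi> \<bullet> \<xi>)))"
      by (simp add: gauss_exponent_def cip.add_right)
    moreover have "gauss_exponent u \<eta> x x = - cip u x" by (simp add: gauss_exponent_def)
    ultimately show ?thesis by (simp only: exp_add) (simp add: algebra_simps)
  qed
  have meas: "(\<lambda>\<xi>. Re (\<kappa> * exp (- cip u x) * (exp (- cip u \<xi> - complex_of_real (\<eta> * (\<xi> \<bullet> \<xi>))) - 1))) \<in> borel_measurable borel"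
    by (intro borel_measurable_continuous_onI continuous_intros cip.continuous_on)
  show ?thesis
    unfolding eq jump_measure_set_integral[OF N meas] gauss_jump_def
    using integral_Re[OF integrable_mult_right[OF integrable_gauss_jump[OF N u \<eta>], of "\<kappa> * exp (- cip u x)"]]
    by simp
qed

text \<open>The generator acts on real functions; the free factor \<kappa> lets real and imaginary
  parts be extracted with \<open>\<kappa> = 1\<close> and \<open>\<kappa> = - \<i>\<close>.\<close>

lemma gen_A_gauss:
  assumes u: "u \<in> CSdp" and x: "x \<in> Sdp" and \<eta>: "0 \<le> \<eta>" "\<eta> \<le> 1"
  shows "gen_A \<alpha> b B c \<gamma> m \<mu> (\<lambda>y. Re (\<kappa> * exp (gauss_exponent u \<eta> x y))) x
    = Re (\<kappa> * exp (- cip u x) * gauss_symbol u \<eta> x)"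
proof -
  let ?f = "\<lambda>y. Re (\<kappa> * exp (gauss_exponent u \<eta> x y))"
  let ?e = "\<kappa> * exp (- cip u x)"
  have sym: "u$k$l = u$l$k" for k l by (rule CSdp_sym[OF u])
  have Re_scale: "r * Re (z * w) = Re (z * (complex_of_real r * w))" for r z w
    by (simp add: algebra_simps)
  have quad: "2 * (\<Sum>i\<in>UNIV. \<Sum>j\<in>UNIV. \<Sum>k\<in>UNIV. \<Sum>l\<in>UNIV. x$l$i * \<alpha>$j$k * nabla i j (nabla k l ?f) x)
    = Re (?e * (2 * cip (u ** cmat \<alpha> ** u) x - complex_of_real (\<eta> * (4 * (\<Sum>i\<in>UNIV. \<Sum>j\<in>UNIV. \<Sum>k\<in>UNIV. \<Sum>l\<in>UNIV. x$l$i * \<alpha>$j$k * (Esym i j \<bullet> Esym k l))))))"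
    (is "2 * ?S = _")
  proof -
    have "?S = (\<Sum>i\<in>UNIV. \<Sum>j\<in>UNIV. \<Sum>k\<in>UNIV. \<Sum>l\<in>UNIV. Re (?e * (complex_of_real (x$l$i * \<alpha>$j$k) * (u$i$j * u$k$l)
        - complex_of_real (2 * \<eta> * (x$l$i * \<alpha>$j$k * (Esym i j \<bullet> Esym k l))))))"
      unfolding nabla_nabla_gauss[OF sym] Re_scale by (intro sum.cong refl) (simp add: algebra_simps)
    also have "\<dots> = Re (?e * (cip (u ** cmat \<alpha> ** u) x - complex_of_real (2 * \<eta> * (\<Sum>i\<in>UNIV. \<Sum>j\<in>UNIV. \<Sum>k\<in>UNIV. \<Sum>l\<in>UNIV. x$l$i * \<alpha>$j$k * (Esym i j \<bullet> Esym k l)))))"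
      unfolding Re_sum[symmetric] sum_distrib_left[symmetric] sum_subtractf of_real_sum[symmetric] cip_quadratic ..
    finally show ?thesis by (simp add: algebra_simps)
  qed
  have grad: "ip (grad ?f x) (b + B x) = Re (?e * - cip u (b + B x))"
  proof -
    have "ip (grad ?f x) (b + B x) = (\<Sum>i\<in>UNIV. \<Sum>j\<in>UNIV. Re (?e * - (u$i$j * complex_of_real ((b + B x)$j$i))))"
      unfolding ip_def grad_def vec_lambda_beta nabla_gauss_at[OF sym]
      by (intro sum.cong refl) (simp add: algebra_simps)
    also have "\<dots> = Re (?e * - cip u (b + B x))"
      unfolding Re_sum[symmetric] sum_distrib_left[symmetric] sum_negf cip_def ..
    finally show ?thesis .
  qed
  have kill: "(c + ip \<gamma> x) * ?f x = Re (?e * complex_of_real (c + ip \<gamma> x))"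
    by (simp add: gauss_exponent_def algebra_simps)
  show ?thesis
    unfolding gen_A_def quad grad kill gauss_jump_integral[OF jump_measure_m u \<eta>]
      gauss_jump_integral[OF jump_measure_mu_pair[OF x] u \<eta>] gauss_symbol_def
    by (simp add: algebra_simps)
qed

lemma gauss_symbol_tendsto:
  assumes u: "u \<in> CSdp" and x: "x \<in> Sdp"
  shows "(\<lambda>n. gauss_symbol u (inverse (real (Suc n))) x) \<longlonglongrightarrow> - F u - cip (R u) x"
proof -
  have "(\<lambda>n. gauss_symbol u (inverse (real (Suc n))) x) \<longlonglongrightarrow> 2 * cip (u ** cmat \<alpha> ** u) x
     - complex_of_real (0 * (4 * (\<Sum>i\<in>UNIV. \<Sum>j\<in>UNIV. \<Sum>k\<in>UNIV. \<Sum>l\<in>UNIV. x$l$i * \<alpha>$j$k * (Esym i j \<bullet> Esym k l))))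
     - cip u (b + B x) - complex_of_real (c + ip \<gamma> x) + jump_transform m u + jump_transform (mu_pair \<mu> x) u"
    unfolding gauss_symbol_def
    by (intro tendsto_intros LIMSEQ_inverse_real_of_nat gauss_jump_tendsto jump_measure_m jump_measure_mu_pair u x)
  then show ?thesis by (simp add: F_eq cip_R[OF u x] cip.add_right algebra_simps)
qed

end

section \<open>Difference quotients of the transforms at time zero\<close>

locale affine_generator = affine_kernel p \<phi>0 \<psi>0 + admissible_parameters \<alpha> b \<gamma> B c m \<mu>
  for p :: "real \<Rightarrow> real^'d^'d \<Rightarrow> (real^'d^'d) measure" and \<phi>0 \<psi>0
    and \<alpha> b \<gamma> :: "real^'d^'d" and B c m \<mu> +
  assumes gen: "has_generator p (gen_A \<alpha> b B c \<gamma> m \<mu>)"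
begin

lemma gauss_generator:
  assumes u: "u \<in> CSdp" and x: "x \<in> Sdp" and \<eta>: "0 < \<eta>" "\<eta> \<le> 1"
  shows "((\<lambda>t. ((\<integral>y. exp (gauss_exponent u \<eta> x y) \<partial>p t x) - exp (- cip u x)) / complex_of_real t)
    \<longlongrightarrow> exp (- cip u x) * gauss_symbol u \<eta> x) (at_right 0)"
proof -
  let ?h = "\<lambda>y. exp (gauss_exponent u \<eta> x y)"
  let ?D = "\<lambda>t. (integral\<^sup>L (p t x) ?h - exp (- cip u x)) / complex_of_real t"
  have hx: "?h x = exp (- cip u x)" by (simp add: gauss_exponent_def)
  have hm: "?h \<in> borel_measurable borel"
    unfolding gauss_exponent_def by (intro borel_measurable_continuous_onI continuous_intros cip.continuous_on)
  have hb: "norm (?h y) \<le> 1" if "y \<in> Sdp" for y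
    by (rule norm_exp_gauss_exponent_le[OF u that]) (use \<eta> in simp)
  have lim: "((\<lambda>t. Re (\<kappa> * ?D t)) \<longlongrightarrow> Re (\<kappa> * (exp (- cip u x) * gauss_symbol u \<eta> x))) (at_right 0)" for \<kappa>
  proof -
    have lim0: "((\<lambda>t. (set_lebesgue_integral (p t x) Sdp (\<lambda>y. Re (\<kappa> * ?h y)) - Re (\<kappa> * ?h x)) / t)
        \<longlongrightarrow> gen_A \<alpha> b B c \<gamma> m \<mu> (\<lambda>y. Re (\<kappa> * ?h y)) x) (at_right 0)"
      using gen gauss_rapidly_decreasing[OF \<eta>(1)] x unfolding has_generator_def by blast
    have eq: "gen_A \<alpha> b B c \<gamma> m \<mu> (\<lambda>y. Re (\<kappa> * ?h y)) x = Re (\<kappa> * (exp (- cip u x) * gauss_symbol u \<eta> x))"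
      using gen_A_gauss[OF u x, of \<eta> \<kappa>] \<eta> by (simp only: mult.assoc less_imp_le)
    have ev: "\<forall>\<^sub>F t in at_right 0. (set_lebesgue_integral (p t x) Sdp (\<lambda>y. Re (\<kappa> * ?h y)) - Re (\<kappa> * ?h x)) / t = Re (\<kappa> * ?D t)"
      using eventually_at_right_less[of 0]
    proof eventually_elim
      case (elim t)
      then have t: "0 \<le> t" by simp
      have int: "integrable (p t x) ?h" by (rule integrable_p[OF t x hm hb])
      have "set_lebesgue_integral (p t x) Sdp (\<lambda>y. Re (\<kappa> * ?h y)) = (\<integral>y. Re (\<kappa> * ?h y) \<partial>p t x)"
        by (intro set_integral_p t x borel_measurable_continuous_onI continuous_intros
            continuous_on_gauss_exponent)
      also have "\<dots> = Re (\<kappa> * integral\<^sup>L (p t x) ?h)"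
        using int by (subst integral_Re) auto
      finally have "(set_lebesgue_integral (p t x) Sdp (\<lambda>y. Re (\<kappa> * ?h y)) - Re (\<kappa> * ?h x)) / t
          = Re (\<kappa> * (integral\<^sup>L (p t x) ?h - ?h x)) / t" by (simp add: algebra_simps)
      also have "\<dots> = Re (\<kappa> * ?D t)" unfolding hx times_divide_eq_right Re_divide_of_real ..
      finally show ?case .
    qed
    show ?thesis using lim0 unfolding eq tendsto_cong[OF ev] .
  qed
  have "Re (- \<i> * z) = Im z" for z by simp
  then show ?thesis
    unfolding tendsto_complex_iff using lim[of 1] lim[of "- \<i>"] by (simp only: mult_1_left)
qed

text \<open>The generator on the Gaussian around \<open>x\<close>, taken with zero argument, shows
  that the mass lost or displaced from \<open>x\<close> is of order \<open>t\<close>.\<close>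

lemma difference_quotient_tail:
  assumes x: "x \<in> Sdp"
  obtains K where "K \<ge> 0" "\<forall>\<^sub>F t in at_right 0. 1 - (\<integral>y. exp (- ((y - x) \<bullet> (y - x))) \<partial>p t x) \<le> K * t"
proof -
  let ?q = "\<lambda>y::real^'d^'d. exp (- ((y - x) \<bullet> (y - x)))"
  have 0: "(0 :: complex^'d^'d) \<in> CSdp" by (simp add: CSdp_iff subspace_0[OF subspace_Sd])
  have e: "exp (gauss_exponent 0 1 x y) = complex_of_real (?q y)" for y
    by (simp add: gauss_exponent_def cip.zero_left exp_of_real flip: of_real_minus)
  define G where "G = Re (gauss_symbol 0 1 x)"
  have "((\<lambda>t. Re (((\<integral>y. exp (gauss_exponent 0 1 x y) \<partial>p t x) - 1) / complex_of_real t)) \<longlongrightarrow> G) (at_right 0)"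
    using tendsto_Re[OF gauss_generator[OF 0 x, of 1]] by (simp add: cip.zero_left G_def)
  then have "((\<lambda>t. ((\<integral>y. ?q y \<partial>p t x) - 1) / t) \<longlongrightarrow> G) (at_right 0)"
    unfolding e by (simp add: Re_divide_of_real)
  then have "\<forall>\<^sub>F t in at_right 0. - (\<bar>G\<bar> + 1) < ((\<integral>y. ?q y \<partial>p t x) - 1) / t"
    by (rule order_tendstoD) auto
  then have "\<forall>\<^sub>F t in at_right 0. 1 - (\<integral>y. ?q y \<partial>p t x) \<le> (\<bar>G\<bar> + 1) * t"
    using eventually_at_right_less[of 0]
  proof eventually_elim
    case (elim t)
    then have "- (\<bar>G\<bar> + 1) * t < (\<integral>y. ?q y \<partial>p t x) - 1" by (simp add: pos_less_divide_eq)
    then show ?case by (simp add: algebra_simps)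
  qed
  then show ?thesis by (intro that[of "\<bar>G\<bar> + 1"]) auto
qed

text \<open>Replacing \<open>exp (- cip u y)\<close> by its product with a flat Gaussian centred at \<open>x\<close> changes the
  difference quotient by at most a multiple of \<open>\<eta>\<close>, uniformly in small \<open>t\<close>.\<close>
lemma difference_quotient_gauss:
  assumes u: "interior_arg u" and x: "x \<in> Sdp"
  obtains K where "K \<ge> 0" "\<And>\<eta>. 0 < \<eta> \<Longrightarrow> \<forall>\<^sub>F t in at_right 0.
    norm (g t x u - (\<integral>y. exp (gauss_exponent u \<eta> x y) \<partial>p t x)) \<le> \<eta> * K * t"
proof -
  have uC: "u \<in> CSdp" by (rule interior_arg_CSdp[OF u])
  obtain \<delta> where \<delta>: "\<delta> > 0" "\<And>y. y \<in> Sdp \<Longrightarrow> \<delta> * norm y \<le> ip (re_mat u) y"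
    using Spp_coercive[of "re_mat u"] u by (auto simp: interior_arg_def)
  obtain K where K: "K \<ge> 0" "\<forall>\<^sub>F t in at_right 0. 1 - (\<integral>y. exp (- ((y - x) \<bullet> (y - x))) \<partial>p t x) \<le> K * t"
    using difference_quotient_tail[OF x] by blast
  \<comment> \<open>Bounds \<open>exp (- (\<delta> * norm y)) * (1 + s)\<close> for the squared
    distance \<open>s\<close> of \<open>y\<close> from \<open>x\<close>, by
    \<open>s \<le> 2 * (x \<bullet> x) + 2 * (y \<bullet> y)\<close> and the quadratic lower bound
    of \<open>exp (\<delta> * norm y)\<close>.\<close>
  define C where "C = 1 + 2 * (x \<bullet> x) + 4 / \<delta>\<^sup>2"
  have C: "0 \<le> C" by (simp add: C_def)
  have pointwise: "norm (exp (- cip u y) - exp (gauss_exponent u \<eta> x y)) \<le> \<eta> * C * (1 - exp (- ((y - x) \<bullet> (y - x))))"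
    if y: "y \<in> Sdp" and \<eta>: "0 < \<eta>" for y \<eta>
  proof -
    define s where "s = (y - x) \<bullet> (y - x)"
    have s: "0 \<le> s" by (simp add: s_def)
    have "exp (- cip u y) - exp (gauss_exponent u \<eta> x y) = exp (- cip u y) * complex_of_real (1 - exp (- (\<eta> * s)))"
    proof -
      have "gauss_exponent u \<eta> x y = - cip u y + complex_of_real (- (\<eta> * s))" by (simp add: gauss_exponent_def s_def)
      then show ?thesis by (simp only: exp_add exp_of_real) (simp add: algebra_simps)
    qed
    then have "norm (exp (- cip u y) - exp (gauss_exponent u \<eta> x y)) = exp (- ip (re_mat u) y) * (1 - exp (- (\<eta> * s)))"
      using s \<eta> by (simp add: norm_mult Re_cip del: of_real_diff)
    also have "\<dots> \<le> exp (- (\<delta> * norm y)) * (\<eta> * s)"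
    proof (rule mult_mono)
      show "1 - exp (- (\<eta> * s)) \<le> \<eta> * s" using exp_ge_add_one_self[of "- (\<eta> * s)"] by simp
      show "0 \<le> 1 - exp (- (\<eta> * s))" using s \<eta> by simp
    qed (use \<delta>(2)[OF y] in auto)
    also have "\<dots> \<le> \<eta> * C * (1 - exp (- s))"
    proof -
      have "s \<le> 2 * (x \<bullet> x) + 2 * (y \<bullet> y)"
      proof -
        have "0 \<le> (y + x) \<bullet> (y + x)" by simp
        then show ?thesis by (simp add: s_def inner_diff_left inner_diff_right inner_add_left inner_add_right inner_commute)
      qed
      moreover have "\<delta>\<^sup>2 * (y \<bullet> y) / 2 \<le> exp (\<delta> * norm y)"
      proof -
        have n: "0 \<le> \<delta> * norm y" using \<delta>(1) by simp
        have "(\<delta> * norm y)\<^sup>2 / 2 = \<delta>\<^sup>2 * (y \<bullet> y) / 2"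
          by (simp add: power_mult_distrib power2_norm_eq_inner)
        then show ?thesis using exp_lower_Taylor_quadratic[OF n] n by linarith
      qed
      then have "2 * (y \<bullet> y) \<le> 4 / \<delta>\<^sup>2 * exp (\<delta> * norm y)"
        using \<delta>(1) by (simp add: field_simps)
      moreover have e1: "1 \<le> exp (\<delta> * norm y)" using \<delta>(1) by simp
      ultimately have "1 + s \<le> C * exp (\<delta> * norm y)"
        using mult_left_mono[OF e1, of "1 + 2 * (x \<bullet> x)"] by (simp add: C_def algebra_simps)
      then have "exp (- (\<delta> * norm y)) * (1 + s) \<le> C" by (simp add: exp_minus field_simps)
      then have "exp (- (\<delta> * norm y)) * (1 + s) * (s / (1 + s)) \<le> C * (s / (1 + s))"
        by (rule mult_right_mono) (use s in simp)
      then have 1: "exp (- (\<delta> * norm y)) * s \<le> C * (s / (1 + s))" using s by simp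
      \<comment> \<open>Turns the weight \<open>s / (1 + s)\<close> into
        \<open>1 - exp (- s)\<close>, whose integral the tail estimate controls.\<close>
      have "exp (- s) \<le> 1 / (1 + s)"
        using exp_ge_add_one_self[of s] s by (simp add: exp_minus field_simps)
      then have "s / (1 + s) \<le> 1 - exp (- s)" using s by (simp add: field_simps)
      then have "C * (s / (1 + s)) \<le> C * (1 - exp (- s))" by (rule mult_left_mono[OF _ C])
      with 1 have "exp (- (\<delta> * norm y)) * s \<le> C * (1 - exp (- s))" by linarith
      then show ?thesis using mult_left_mono[of _ _ \<eta>] \<eta> by (simp add: mult.assoc mult.left_commute)
    qed
    finally show ?thesis by (simp add: s_def)
  qed
  have "\<forall>\<^sub>F t in at_right 0. norm (g t x u - (\<integral>y. exp (gauss_exponent u \<eta> x y) \<partial>p t x)) \<le> \<eta> * (C * K) * t"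
    if \<eta>: "0 < \<eta>" for \<eta>
    using K(2) eventually_at_right_less[of 0]
  proof eventually_elim
    case (elim t)
    then have t: "0 \<le> t" by simp
    interpret finite_measure "p t x" by (rule finite_p[OF t x])
    have qm: "(\<lambda>y::real^'d^'d. exp (- ((y - x) \<bullet> (y - x)))) \<in> borel_measurable borel"
      by (intro borel_measurable_continuous_onI continuous_intros)
    have qi: "integrable (p t x) (\<lambda>y. exp (- ((y - x) \<bullet> (y - x))))"
      by (rule integrable_p[OF t x qm, where C=1]) auto
    have em: "(\<lambda>y. exp (gauss_exponent u \<eta> x y)) \<in> borel_measurable borel"
      unfolding gauss_exponent_def by (intro borel_measurable_continuous_onI continuous_intros cip.continuous_on)
    have ei: "integrable (p t x) (\<lambda>y. exp (gauss_exponent u \<eta> x y))"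
    proof (rule integrable_p[OF t x em, where C=1])
      show "norm (exp (gauss_exponent u \<eta> x y)) \<le> 1" if "y \<in> Sdp" for y
        by (rule norm_exp_gauss_exponent_le[OF uC that]) (use \<eta> in simp)
    qed
    have "norm (g t x u - (\<integral>y. exp (gauss_exponent u \<eta> x y) \<partial>p t x))
        = norm (\<integral>y. exp (- cip u y) - exp (gauss_exponent u \<eta> x y) \<partial>p t x)"
      by (simp add: g_eq[OF t x] integrable_exp_cip[OF t x uC] ei)
    also have "\<dots> \<le> (\<integral>y. \<eta> * C * (1 - exp (- ((y - x) \<bullet> (y - x)))) \<partial>p t x)"
      by (rule integral_p_norm_le[OF t x _ pointwise]) (use em qi \<eta> in auto)
    also have "\<dots> = \<eta> * C * (measure (p t x) UNIV - (\<integral>y. exp (- ((y - x) \<bullet> (y - x))) \<partial>p t x))"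
      using qi by (simp add: space_p[OF t x])
    also have "\<dots> \<le> \<eta> * C * (K * t)"
      using measure_p_le[OF t x] elim(1) C \<eta> by (intro mult_left_mono) auto
    finally show ?case by (simp add: mult.assoc)
  qed
  then show ?thesis using C K(1) by (intro that[of "C * K"]) auto
qed

text \<open>Interchanges the limits in \<open>t\<close> and \<eta>. The regularisation error is of
  order \<open>\<eta> * t\<close>, so after division by \<open>t\<close> it is small for a fixed
  small \<eta>, and \<open>t\<close> may then tend to 0.\<close>

lemma exponential_generator:
  assumes u: "interior_arg u" and x: "x \<in> Sdp"
  shows "((\<lambda>t. (g t x u - exp (- cip u x)) / complex_of_real t)
    \<longlongrightarrow> exp (- cip u x) * (- F u - cip (R u) x)) (at_right 0)"
proof (rule tendstoI)
  fix e :: real assume e: "0 < e"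
  have uC: "u \<in> CSdp" by (rule interior_arg_CSdp[OF u])
  obtain K where K: "K \<ge> 0" "\<And>\<eta>. 0 < \<eta> \<Longrightarrow> \<forall>\<^sub>F t in at_right 0.
    norm (g t x u - (\<integral>y. exp (gauss_exponent u \<eta> x y) \<partial>p t x)) \<le> \<eta> * K * t"
    using difference_quotient_gauss[OF u x] by blast
  let ?L = "exp (- cip u x) * (- F u - cip (R u) x)"
  have "(\<lambda>n. exp (- cip u x) * gauss_symbol u (inverse (real (Suc n))) x) \<longlonglongrightarrow> ?L"
    by (intro tendsto_intros gauss_symbol_tendsto uC x)
  then have "\<forall>\<^sub>F n in sequentially. dist (exp (- cip u x) * gauss_symbol u (inverse (real (Suc n))) x) ?L < e / 3"
    by (rule tendstoD) (use e in simp)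
  moreover have "(\<lambda>n. inverse (real (Suc n)) * K) \<longlonglongrightarrow> 0 * K" by (intro tendsto_intros LIMSEQ_inverse_real_of_nat)
  then have "\<forall>\<^sub>F n in sequentially. inverse (real (Suc n)) * K < e / 3" by (rule order_tendstoD) (use e in simp)
  ultimately have "\<forall>\<^sub>F n in sequentially. dist (exp (- cip u x) * gauss_symbol u (inverse (real (Suc n))) x) ?L < e / 3
      \<and> inverse (real (Suc n)) * K < e / 3" by (rule eventually_conj)
  then obtain n where n: "dist (exp (- cip u x) * gauss_symbol u (inverse (real (Suc n))) x) ?L < e / 3"
    "inverse (real (Suc n)) * K < e / 3" unfolding eventually_sequentially by blast
  define \<eta> where "\<eta> = inverse (real (Suc n))"
  have \<eta>: "0 < \<eta>" "\<eta> \<le> 1" by (auto simp: \<eta>_def field_simps)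
  have "\<forall>\<^sub>F t in at_right 0. dist (((\<integral>y. exp (gauss_exponent u \<eta> x y) \<partial>p t x) - exp (- cip u x)) / complex_of_real t)
      (exp (- cip u x) * gauss_symbol u \<eta> x) < e / 3"
    by (rule tendstoD[OF gauss_generator[OF uC x \<eta>]]) (use e in simp)
  then show "\<forall>\<^sub>F t in at_right 0. dist ((g t x u - exp (- cip u x)) / complex_of_real t) ?L < e"
    using K(2)[OF \<eta>(1)] eventually_at_right_less[of 0]
  proof eventually_elim
    case (elim t)
    let ?I = "\<integral>y. exp (gauss_exponent u \<eta> x y) \<partial>p t x"
    have "dist ((g t x u - exp (- cip u x)) / complex_of_real t) ((?I - exp (- cip u x)) / complex_of_real t)
        = norm (g t x u - ?I) / t"
      using elim(3) by (simp add: dist_norm diff_divide_distrib[symmetric] norm_divide)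
    also have "\<dots> \<le> \<eta> * K" using elim(2,3) by (simp add: pos_divide_le_eq)
    also have "\<dots> < e / 3" using n(2) by (simp add: \<eta>_def)
    finally have 1: "dist ((g t x u - exp (- cip u x)) / complex_of_real t) ((?I - exp (- cip u x)) / complex_of_real t) < e / 3" .
    have "dist ((g t x u - exp (- cip u x)) / complex_of_real t) ?L
      \<le> dist ((g t x u - exp (- cip u x)) / complex_of_real t) ((?I - exp (- cip u x)) / complex_of_real t)
        + (dist ((?I - exp (- cip u x)) / complex_of_real t) (exp (- cip u x) * gauss_symbol u \<eta> x)
        + dist (exp (- cip u x) * gauss_symbol u \<eta> x) ?L)"
      using dist_triangle add_left_mono order_trans by meson
    also have "\<dots> < e / 3 + (e / 3 + e / 3)"
      using 1 elim(1) n(1) unfolding \<eta>_def[symmetric] by (intro add_strict_mono)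
    finally show ?case by simp
  qed
qed

end

section \<open>Energy estimate for the Riccati equation\<close>

lemma ip_eq_trace: "ip x y = trace (x ** y)"
  by (simp add: ip_def trace_def matrix_matrix_mult_def)

lemma ip_conj: "ip (a ** x ** a) y = ip x (a ** y ** a)"
proof -
  have "trace (a ** (x ** a ** y)) = trace ((x ** a ** y) ** a)" by (rule trace_mul_sym)
  then show ?thesis by (simp add: ip_eq_trace matrix_mul_assoc)
qed

lemma conj_Sdp:
  assumes w: "w \<in> Sd" and a: "a \<in> Sdp"
  shows "w ** a ** w \<in> Sdp"
proof -
  have wt: "transpose w = w" and at: "transpose a = a" using w Sdp_Sd[OF a] by (auto simp: Sd_def)
  have "w ** a ** w \<in> Sd" by (simp add: Sd_def matrix_transpose_mul wt at matrix_mul_assoc)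
  moreover have "0 \<le> ip (w ** a ** w) (outer z)" for z
  proof -
    have "ip (w ** a ** w) (outer z) = (z v* w) \<bullet> (a *v (w *v z))"
      by (simp add: ip_outer dot_lmul_matrix matrix_vector_mul_assoc matrix_mul_assoc)
    also have "z v* w = w *v z" using transpose_matrix_vector[of w z] by (simp add: wt)
    finally show ?thesis using a by (simp add: Sdp_def)
  qed
  ultimately show ?thesis by (simp add: Sdp_iff)
qed

text \<open>The spectral lower bound of \<open>a\<close> is used twice, once for each factor
  \<open>a\<close> in the trace of \<open>a ** w ** a ** w\<close>; hence the constant
  \<open>\<delta>\<^sup>2\<close>.\<close>

lemma ip_conj_coercive:
  assumes a: "a \<in> Spp"
  obtains \<kappa> where "\<kappa> > 0" "\<And>w. w \<in> Sd \<Longrightarrow> \<kappa> * (norm w)\<^sup>2 \<le> ip (a ** w ** a) w"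
proof -
  obtain \<delta> where \<delta>: "\<delta> > 0" "a - \<delta> *\<^sub>R mat 1 \<in> Sdp" using a by (auto simp: Spp_iff)
  have "\<delta>\<^sup>2 * (norm w)\<^sup>2 \<le> ip (a ** w ** a) w" if w: "w \<in> Sd" for w
  proof -
    have "0 \<le> ip (a - \<delta> *\<^sub>R mat 1) (w ** a ** w)"
      by (intro ip_Sdp_nonneg conj_Sdp w \<delta> Spp_Sdp a)
    then have "\<delta> * ip (mat 1) (w ** a ** w) \<le> ip a (w ** a ** w)" by (simp add: ip.diff_left ip.scaleR_left)
    moreover have "0 \<le> ip (w ** mat 1 ** w) (a - \<delta> *\<^sub>R mat 1)"
      by (rule ip_Sdp_nonneg[OF conj_Sdp[OF w mat_Sdp] \<delta>(2)]) simp
    then have "\<delta> * ip (w ** w) (mat 1) \<le> ip (w ** w) a" by (simp add: ip.diff_right ip.scaleR_right)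
    moreover have "ip (w ** w) a = ip (mat 1) (w ** a ** w)"
      using ip_conj[of w "mat 1" a] by simp
    moreover have "ip (w ** w) (mat 1) = (norm w)\<^sup>2"
    proof -
      have "ip (w ** w) (mat 1) = ip w w" by (simp add: ip_eq_trace)
      then show ?thesis by (simp add: ip_eq_inner[OF w] power2_norm_eq_inner)
    qed
    moreover have "ip a (w ** a ** w) = ip (a ** w ** a) w"
      by (simp add: ip_eq_trace matrix_mul_assoc)
    ultimately have "\<delta> * (norm w)\<^sup>2 \<le> ip (mat 1) (w ** a ** w)"
      "\<delta> * ip (mat 1) (w ** a ** w) \<le> ip (a ** w ** a) w" by metis+
    then have "\<delta> * (\<delta> * (norm w)\<^sup>2) \<le> ip (a ** w ** a) w"
      using mult_left_mono[of "\<delta> * (norm w)\<^sup>2" "ip (mat 1) (w ** a ** w)" \<delta>] \<delta>(1) by linarith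
    then show ?thesis by (simp add: power2_eq_square)
  qed
  with \<delta>(1) show ?thesis by (intro that[of "\<delta>\<^sup>2"]) auto
qed

lemma re_mat_matrix_mult: "re_mat (x ** cmat a ** y) = re_mat x ** a ** re_mat y - im_mat x ** a ** im_mat y"
  and im_mat_matrix_mult: "im_mat (x ** cmat a ** y) = re_mat x ** a ** im_mat y + im_mat x ** a ** re_mat y"
  by (simp_all add: re_mat_def im_mat_def cmat_def matrix_matrix_mult_def vec_eq_iff
      sum_subtractf[symmetric] sum.distrib[symmetric] sum_distrib_right algebra_simps)

lemma norm_vec_power2: "(norm (x :: 'a::real_normed_vector^'n))\<^sup>2 = (\<Sum>i\<in>UNIV. (norm (x$i))\<^sup>2)"
  by (simp add: norm_vec_def L2_set_def sum_nonneg)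

lemma norm_re_im: "(norm u)\<^sup>2 = (norm (re_mat u))\<^sup>2 + (norm (im_mat u))\<^sup>2"
  by (simp add: norm_vec_power2 re_mat_def im_mat_def cmod_power2 sum.distrib)

text \<open>For \<open>u = v + \<i> w\<close> the form \<open>tr (a v a v) + tr (a w a w)\<close> is a squared norm along which the
  quadratic part \<open>- 2 u a u\<close> of the Riccati equation points inwards.\<close>
definition energy :: "real^'d^'d \<Rightarrow> complex^'d^'d \<Rightarrow> complex^'d^'d \<Rightarrow> real" where
  "energy a x y = ip (a ** re_mat x ** a) (re_mat y) + ip (a ** im_mat x ** a) (im_mat y)"

lemma energy_commute: "energy a x y = energy a y x"
proof -
  have "ip (a ** v ** a) w = ip (a ** w ** a) v" for v w
    by (simp only: ip_conj[of a v w] ip_commute[of v])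
  then show ?thesis by (simp add: energy_def)
qed

lemma matrix_conj_linear:
  fixes a :: "real^'d^'d"
  shows "a ** (x + y) ** a = a ** x ** a + a ** y ** a" "a ** (r *\<^sub>R x) ** a = r *\<^sub>R (a ** x ** a)"
    "a ** (x - y) ** a = a ** x ** a - a ** y ** a"
  by (simp_all add: matrix_matrix_mult_def vec_eq_iff sum.distrib sum_subtractf sum_distrib_left
      sum_distrib_right algebra_simps)

lemma bilinear_energy: "bounded_bilinear (energy a)"
  unfolding bilinear_conv_bounded_bilinear[symmetric] bilinear_def
  by (auto intro!: linearI simp: energy_def matrix_conj_linear ip.add_left ip.add_right
      ip.scaleR_left ip.scaleR_right algebra_simps)

text \<open>With real part \<open>v\<close> and imaginary part \<open>w\<close> of \<open>u\<close>,
  the cubic terms containing \<open>w\<close> twice are cyclically equal and occur with signs -, +,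
  +. What is left pairs \<open>v ** a ** v\<close> and \<open>w ** a ** w\<close> with
  \<open>a ** v ** a\<close>, all of them in the cone.\<close>

lemma energy_quadratic_nonneg:
  assumes a: "a \<in> Sdp" and u: "u \<in> CSdp"
  shows "0 \<le> energy a (u ** cmat a ** u) u"
proof -
  let ?v = "re_mat u" and ?w = "im_mat u"
  have v: "?v \<in> Sdp" and w: "?w \<in> Sd" using u by (auto simp: CSdp_iff)
  have aSd: "a \<in> Sd" by (rule Sdp_Sd[OF a])
  have tr: "trace (a ** x ** a ** y ** a ** z) = trace (a ** y ** a ** z ** a ** x)" for x y z
    using trace_mul_sym[of "a ** x" "a ** y ** a ** z"] by (simp add: matrix_mul_assoc)
  have "ip (a ** (?v ** a ** ?w) ** a) ?w = ip (a ** (?w ** a ** ?w) ** a) ?v"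
    using tr[of ?v ?w ?w] by (simp add: ip_eq_trace matrix_mul_assoc)
  then have "energy a (u ** cmat a ** u) u = ip (a ** (?v ** a ** ?v) ** a) ?v + ip (a ** (?w ** a ** ?v) ** a) ?w"
    by (simp add: energy_def re_mat_matrix_mult im_mat_matrix_mult matrix_conj_linear ip.diff_left ip.add_left)
  moreover have "ip (a ** (?w ** a ** ?v) ** a) ?w = ip (?w ** a ** ?w) (a ** ?v ** a)"
    using trace_mul_sym[of ?w "a ** ?w ** a ** ?v ** a"] by (simp add: ip_eq_trace matrix_mul_assoc)
  moreover have "ip (a ** (?v ** a ** ?v) ** a) ?v = ip (?v ** a ** ?v) (a ** ?v ** a)"
    by (simp add: ip_conj)
  moreover have "0 \<le> ip (?w ** a ** ?w) (a ** ?v ** a)" "0 \<le> ip (?v ** a ** ?v) (a ** ?v ** a)"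
    by (intro ip_Sdp_nonneg conj_Sdp w a aSd v Sdp_Sd[OF v])+
  ultimately show ?thesis by simp
qed

text \<open>Gronwall in differential form: \<open>f s * exp (- C * s)\<close> has nonpositive
  derivative.\<close>

lemma exponential_growth_bound:
  fixes f f' :: "real \<Rightarrow> real"
  assumes deriv: "\<And>t. t \<in> {0..T} \<Longrightarrow> (f has_real_derivative f' t) (at t within {0..T})"
    and le: "\<And>t. t \<in> {0..T} \<Longrightarrow> f' t \<le> C * f t" and t: "t \<in> {0..T}"
  shows "f t \<le> f 0 * exp (C * t)"
proof -
  define h where "h s = f s * exp (- C * s)" for s
  let ?h' = "\<lambda>s. (f' s - C * f s) * exp (- C * s)"
  have h': "(h has_derivative (*) (?h' s)) (at s within {0..t})" if "0 \<le> s" "s \<le> t" for s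
  proof -
    have s: "s \<in> {0..T}" using that t by auto
    have "((\<lambda>s. exp (- C * s)) has_real_derivative - C * exp (- C * s)) (at s within {0..T})"
      by (auto intro!: derivative_eq_intros)
    from DERIV_mult[OF deriv[OF s] this]
    have "(h has_real_derivative ?h' s) (at s within {0..T})"
      unfolding h_def by (rule DERIV_cong) (simp add: algebra_simps)
    then show ?thesis
      unfolding has_field_derivative_def by (rule has_derivative_subset) (use t in auto)
  qed
  have "\<exists>z\<in>{0..t}. h t - h 0 = (*) (?h' z) (t - 0)"
    by (rule mvt_very_simple) (use t h' in auto)
  then obtain z where z: "z \<in> {0..t}" "h t - h 0 = ?h' z * (t - 0)" by blast
  have "(f' z - C * f z) * exp (- C * z) * (t - 0) \<le> 0"
    using le[of z] z(1) t by (intro mult_nonpos_nonneg) auto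
  then have "h t \<le> h 0" using z(2) by simp
  then have "f t * exp (- C * t) \<le> f 0" by (simp add: h_def)
  then show ?thesis by (simp add: exp_minus field_simps)
qed

context admissible_parameters
begin

text \<open>The quadratic term has the favourable sign, so only \<open>L\<close> matters. Its linear
  growth bounds the energy product by a multiple of \<open>1 + (norm u)\<^sup>2\<close>, and
  coercivity turns this into the energy.\<close>

lemma riccati_energy_estimate:
  assumes "invertible \<alpha> \<or> \<alpha> = 0"
  obtains a C where "C \<ge> 0" "\<And>u. u \<in> CSdp \<Longrightarrow> 2 * energy a (R u) u \<le> C * (1 + energy a u u)"
    "\<And>u. u \<in> CSdp \<Longrightarrow> (norm u)\<^sup>2 \<le> C * energy a u u"
proof -
  \<comment> \<open>For \<open>\<alpha> = 0\<close> the quadratic term vanishes and the energy of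
    the identity, on \<open>CSdp\<close> the plain squared norm, serves.\<close>
  define a where "a = (if \<alpha> = 0 then mat 1 else \<alpha>)"
  have aS: "a \<in> Spp" using assms mat_Spp[of 1] invertible_Sdp_Spp[OF \<alpha>_Sdp] by (auto simp: a_def)
  obtain \<kappa> where \<kappa>: "\<kappa> > 0" "\<And>w. w \<in> Sd \<Longrightarrow> \<kappa> * (norm w)\<^sup>2 \<le> ip (a ** w ** a) w"
    using ip_conj_coercive[OF aS] by blast
  have coercive: "\<kappa> * (norm u)\<^sup>2 \<le> energy a u u" if "u \<in> CSdp" for u
    using \<kappa>(2)[of "re_mat u"] \<kappa>(2)[of "im_mat u"] that
    by (simp add: energy_def norm_re_im distrib_left CSdp_iff Sdp_Sd)
  obtain k where k: "k > 0" "\<And>x y. norm (energy a x y) \<le> norm x * norm y * k"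
    using bounded_bilinear.pos_bounded[OF bilinear_energy[of a]] by blast
  obtain K where K: "K \<ge> 0" "\<And>u. u \<in> CSdp \<Longrightarrow> norm (L u) \<le> K * (1 + norm u)" using L_growth by blast
  have quad: "0 \<le> energy a (u ** cmat \<alpha> ** u) u" if "u \<in> CSdp" for u
  proof (cases "\<alpha> = 0")
    case True
    then have "u ** cmat \<alpha> ** u = 0" by (simp add: cmat_def matrix_matrix_mult_def vec_eq_iff)
    then show ?thesis by (simp add: bounded_bilinear.zero_left[OF bilinear_energy])
  next
    case False
    then show ?thesis using energy_quadratic_nonneg[OF \<alpha>_Sdp that] by (simp add: a_def)
  qed
  define D where "D = 4 * k * K * (1 + 1 / \<kappa>)"
  have D: "0 \<le> D" using k(1) K(1) \<kappa>(1) by (simp add: D_def)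
  have est: "2 * energy a (R u) u \<le> D * (1 + energy a u u)" if u: "u \<in> CSdp" for u
  proof -
    have "energy a (R u) u = - 2 * energy a (u ** cmat \<alpha> ** u) u + energy a (L u) u"
      unfolding R_eq bounded_bilinear.add_left[OF bilinear_energy] bounded_bilinear.scaleR_left[OF bilinear_energy] by simp
    then have "2 * energy a (R u) u \<le> 2 * (norm (L u) * norm u * k)"
      using quad[OF u] k(2)[of "L u" u] by simp
    also have "\<dots> \<le> 2 * (K * (1 + norm u) * norm u * k)"
      using K(2)[OF u] k(1) by (intro mult_left_mono mult_right_mono) auto
    also have "\<dots> = 2 * K * k * ((1 + norm u) * norm u)" by simp
    also have "\<dots> \<le> 2 * K * k * (2 * (1 + (norm u)\<^sup>2))"
    proof (rule mult_left_mono)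
      have "0 \<le> (norm u - 1)\<^sup>2" by simp
      then have "2 * norm u \<le> 1 + (norm u)\<^sup>2" by (simp add: power2_eq_square algebra_simps)
      then have "norm u \<le> 2 + (norm u)\<^sup>2" using zero_le_power2[of "norm u"] by linarith
      then show "(1 + norm u) * norm u \<le> 2 * (1 + (norm u)\<^sup>2)"
        by (simp add: power2_eq_square algebra_simps)
    qed (use k(1) K(1) in simp)
    also have "\<dots> = 4 * k * K * (1 + (norm u)\<^sup>2)" by simp
    also have "\<dots> \<le> 4 * k * K * ((1 + 1 / \<kappa>) * (1 + energy a u u))"
    proof (rule mult_left_mono)
      have "(norm u)\<^sup>2 \<le> energy a u u / \<kappa>" using coercive[OF u] \<kappa>(1) by (simp add: field_simps)
      moreover have "0 \<le> energy a u u" using coercive[OF u] \<kappa>(1) by (meson mult_nonneg_nonneg less_imp_le order_trans zero_le_power2)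
      ultimately show "1 + (norm u)\<^sup>2 \<le> (1 + 1 / \<kappa>) * (1 + energy a u u)"
        using \<kappa>(1) by (simp add: distrib_left distrib_right add_increasing)
    qed (use k(1) K(1) in simp)
    finally show ?thesis by (simp add: D_def mult.assoc)
  qed
  \<comment> \<open>A single constant for both claims: \<open>D\<close> serves the growth estimate,
    \<open>1 / \<kappa>\<close> the comparison with the norm.\<close>
  have "2 * energy a (R u) u \<le> (D + 1 / \<kappa>) * (1 + energy a u u)" "(norm u)\<^sup>2 \<le> (D + 1 / \<kappa>) * energy a u u"
    if u: "u \<in> CSdp" for u
  proof -
    have e: "0 \<le> energy a u u" using coercive[OF u] \<kappa>(1) by (meson mult_nonneg_nonneg less_imp_le order_trans zero_le_power2)
    show "2 * energy a (R u) u \<le> (D + 1 / \<kappa>) * (1 + energy a u u)"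
      by (rule order_trans[OF est[OF u] mult_right_mono]) (use \<kappa>(1) e in auto)
    have "(norm u)\<^sup>2 \<le> 1 / \<kappa> * energy a u u" using coercive[OF u] \<kappa>(1) by (simp add: field_simps)
    also have "\<dots> \<le> (D + 1 / \<kappa>) * energy a u u" using D e by (intro mult_right_mono) auto
    finally show "(norm u)\<^sup>2 \<le> (D + 1 / \<kappa>) * energy a u u" .
  qed
  then show ?thesis using D \<kappa>(1) by (intro that[of "D + 1 / \<kappa>" a]) auto
qed

end

section \<open>Integrating the Riccati equations\<close>

lemma has_right_derivativeI:
  fixes f :: "real \<Rightarrow> 'a::real_normed_vector"
  assumes "((\<lambda>h. (f (t + h) - f t) /\<^sub>R h) \<longlongrightarrow> D) (at_right 0)"
  shows "(f has_vector_derivative D) (at t within {t..})"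
proof -
  have "((\<lambda>h. (f (t + h) - f t) /\<^sub>R h - D) \<longlongrightarrow> D - D) (at_right 0)"
    by (intro tendsto_intros assms)
  then have lim: "((\<lambda>h. (f (t + h) - f t) /\<^sub>R h - D) \<longlongrightarrow> 0) (at_right 0)" by simp
  have ev: "\<forall>\<^sub>F h in at_right 0. (f (t + h) - f t) /\<^sub>R h - D = (1 / norm h) *\<^sub>R (f (h + t) - (f t + h *\<^sub>R D))"
    using eventually_at_right_less[of 0]
  proof eventually_elim
    case (elim h)
    then show ?case by (simp add: scaleR_diff_right add.commute inverse_eq_divide scaleR_add_right)
  qed
  from lim have "((\<lambda>h. (1 / norm h) *\<^sub>R (f (h + t) - (f t + h *\<^sub>R D))) \<longlongrightarrow> 0) (at_right 0)"
    unfolding tendsto_cong[OF ev] .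
  then have "((\<lambda>s. (1 / norm (s - t)) *\<^sub>R (f s - (f t + (s - t) *\<^sub>R D))) \<longlongrightarrow> 0) (at_right t)"
    by (subst filterlim_at_right_to_0) (simp add: add.commute)
  then show ?thesis
    unfolding has_vector_derivative_def has_derivative_within at_within_Ici_at_right
    by (simp add: bounded_linear_scaleR_left)
qed

lemma integral_vector_derivative_Ici:
  fixes f :: "real \<Rightarrow> 'a::banach"
  assumes f: "continuous_on {0..} f" and t: "0 \<le> t"
  shows "((\<lambda>s. integral {0..s} f) has_vector_derivative f t) (at t within {0..})"
proof -
  have "((\<lambda>s. integral {0..s} f) has_vector_derivative f t) (at t within {0..t+1})"
    using t by (intro integral_has_vector_derivative continuous_on_subset[OF f]) auto
  moreover have "at t within {0..t+1} = at t within {0..}"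
    by (rule at_within_nhd[of _ "{..<t+1}"]) auto
  ultimately show ?thesis by simp
qed

lemma CSdp_integral_sym:
  fixes f :: "real \<Rightarrow> complex^'d^'d"
  assumes "f integrable_on S" "\<And>s i j. s \<in> S \<Longrightarrow> f s $ i $ j = f s $ j $ i"
  shows "integral S f $ i $ j = integral S f $ j $ i"
proof -
  have "integral S (\<lambda>s. f s $ i $ j) = integral S f $ i $ j" for i j
    using integral_linear[OF assms(1), of "\<lambda>u. u $ i $ j"]
      bounded_linear_compose[OF bounded_linear_vec_nth bounded_linear_vec_nth, of i j]
    by (simp add: o_def)
  moreover have "integral S (\<lambda>s. f s $ i $ j) = integral S (\<lambda>s. f s $ j $ i)"
    by (rule integral_cong) (rule assms(2))
  ultimately show ?thesis by metis
qed

context affine_generator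
begin

lemma g_0_0: "g 0 0 u = 1"
  by (simp add: g_0 cip.zero_right)

lemma continuous_on_F_\<psi>:
  assumes u: "interior_arg u" and nz: "\<And>t. t \<in> {0..T} \<Longrightarrow> g t 0 u \<noteq> 0"
  shows "continuous_on {0..T} (\<lambda>s. F (\<psi> s u))" "continuous_on {0..T} (\<lambda>s. R (\<psi> s u))"
proof -
  have \<psi>C: "(\<lambda>s. \<psi> s u) ` {0..T} \<subseteq> CSdp" using \<psi>_CSdp[OF _ u nz] by auto
  have \<psi>c: "continuous_on {0..T} (\<lambda>s. \<psi> s u)" by (rule continuous_on_\<psi>[OF u nz]) auto
  show "continuous_on {0..T} (\<lambda>s. F (\<psi> s u))" "continuous_on {0..T} (\<lambda>s. R (\<psi> s u))"
    by (rule continuous_on_compose2[OF continuous_on_F \<psi>c \<psi>C],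
        rule continuous_on_compose2[OF continuous_on_R \<psi>c \<psi>C])
qed

text \<open>By Chapman-Kolmogorov the transform at time \<open>h + t\<close> is
  \<open>g t 0 u\<close> times the transform at time \<open>h\<close> with argument
  \<open>\<psi> t u\<close>. An increment after time \<open>t\<close> thus becomes one after time 0,
  where the generator applies because \<open>\<psi> t u\<close> is interior.\<close>

lemma g_right_derivative:
  assumes u: "interior_arg u" and t: "0 \<le> t" and nz: "g t 0 u \<noteq> 0" and x: "x \<in> Sdp"
  shows "((\<lambda>s. g s x u) has_vector_derivative - (F (\<psi> t u) + cip (R (\<psi> t u)) x) * g t x u) (at t within {t..})"
proof (rule has_right_derivativeI)
  have semi: "g (h + t) x u = g t 0 u * g h x (\<psi> t u)" if h: "0 \<le> h" for h
  proof -
    have "g (h + t) x u = (\<integral>y. g t 0 u * exp (- cip (\<psi> t u) y) \<partial>p h x)"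
    proof (rule g_chapman_kolmogorov[OF h t x interior_arg_CSdp[OF u]])
      show "g t y u = g t 0 u * exp (- cip (\<psi> t u) y)" if "y \<in> Sdp" for y
        by (rule g_eq_\<psi>[OF t u nz that])
    qed simp
    then show ?thesis by (simp add: g_eq[OF h x])
  qed
  have "((\<lambda>h. g t 0 u * ((g h x (\<psi> t u) - exp (- cip (\<psi> t u) x)) / complex_of_real h))
      \<longlongrightarrow> g t 0 u * (exp (- cip (\<psi> t u) x) * (- F (\<psi> t u) - cip (R (\<psi> t u)) x))) (at_right 0)"
    by (intro tendsto_intros exponential_generator \<psi>_interior[OF t u nz] x)
  then have "((\<lambda>h. g t 0 u * ((g h x (\<psi> t u) - exp (- cip (\<psi> t u) x)) / complex_of_real h))
      \<longlongrightarrow> - (F (\<psi> t u) + cip (R (\<psi> t u)) x) * g t x u) (at_right 0)"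
    by (simp add: g_eq_\<psi>[OF t u nz x] algebra_simps)
  then show "((\<lambda>h. (g (t + h) x u - g t x u) /\<^sub>R h) \<longlongrightarrow> - (F (\<psi> t u) + cip (R (\<psi> t u)) x) * g t x u) (at_right 0)"
  proof (rule Lim_transform_eventually)
    show "\<forall>\<^sub>F h in at_right 0. g t 0 u * ((g h x (\<psi> t u) - exp (- cip (\<psi> t u) x)) / complex_of_real h)
        = (g (t + h) x u - g t x u) /\<^sub>R h"
      using eventually_at_right_less[of 0]
    proof eventually_elim
      case (elim h)
      then show ?case
        using semi[of h] by (simp add: add.commute g_eq_\<psi>[OF t u nz x] scaleR_conv_of_real field_simps)
    qed
  qed
qed

text \<open>The transform times the exponential of the integrated rate has zero right derivative,
  which makes the transform explicit for every \<open>x\<close>. The case \<open>x = 0\<close>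
  isolates the integral of \<open>F\<close>, and comparison with \<open>\<psi> t u\<close>
  identifies the integral of \<open>R\<close>.\<close>

lemma riccati_integral_interior:
  assumes u: "interior_arg u" and nz: "\<And>t. t \<in> {0..T} \<Longrightarrow> g t 0 u \<noteq> 0" and t: "t \<in> {0..T}"
  shows "g t 0 u = exp (- integral {0..t} (\<lambda>s. F (\<psi> s u)))"
    and "\<psi> t u = u + integral {0..t} (\<lambda>s. R (\<psi> s u))"
proof -
  have uC: "u \<in> CSdp" by (rule interior_arg_CSdp[OF u])
  note cont = continuous_on_F_\<psi>[OF u nz]
  have sub: "{0..t} \<subseteq> {0..T}" using t by auto
  have int: "(\<lambda>s. F (\<psi> s u)) integrable_on {0..t}" "(\<lambda>s. R (\<psi> s u)) integrable_on {0..t}"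
    by (intro integrable_continuous_real continuous_on_subset[OF _ sub] cont; assumption)+
  define \<Psi> where "\<Psi> = u + integral {0..t} (\<lambda>s. R (\<psi> s u))"
  define E where "E = integral {0..t} (\<lambda>s. F (\<psi> s u))"
  have key: "g t x u = exp (- E) * exp (- cip \<Psi> x)" if x: "x \<in> Sdp" for x
  proof -
    define H where "H s = F (\<psi> s u) + cip (R (\<psi> s u)) x" for s
    have Hc: "continuous_on {0..T} H" unfolding H_def by (intro continuous_intros cip.continuous_on cont)
    define I where "I r = integral {0..r} H" for r
    have "g t x u * exp (I t) = g 0 x u * exp (I 0)"
    proof (rule right_derivative_zero_const[of 0 T "\<lambda>s. g s x u * exp (I s)" t])
      have "continuous_on {0..T} I" unfolding I_def
        by (intro indefinite_integral_continuous_1 integrable_continuous_real Hc)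
      then show "continuous_on {0..T} (\<lambda>s. g s x u * exp (I s))"
        by (intro continuous_intros continuous_on_subset[OF continuous_on_g[OF x uC]]) auto
      fix s assume s: "0 \<le> s" "s < T"
      have "(I has_vector_derivative H s) (at s within {0..T})"
        unfolding I_def using s by (intro integral_has_vector_derivative Hc) auto
      then have "(I has_vector_derivative H s) (at s within {s..T})"
        by (rule has_vector_derivative_within_subset) (use s in auto)
      then have I': "(I has_vector_derivative H s) (at s within {s..})"
        using s by (simp add: at_within_Icc_at_right at_within_Ici_at_right)
      have "((exp \<circ> I) has_vector_derivative H s * exp (I s)) (at s within {s..})"
        by (rule field_vector_diff_chain_within[OF I']) (rule DERIV_subset[OF DERIV_exp], simp)
      then have e: "((\<lambda>s. exp (I s)) has_vector_derivative H s * exp (I s)) (at s within {s..})" by (simp add: o_def)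
      have gs: "g s 0 u \<noteq> 0" using nz[of s] s by simp
      from has_vector_derivative_mult[OF g_right_derivative[OF u s(1) gs x] e]
      show "((\<lambda>s. g s x u * exp (I s)) has_vector_derivative 0) (at s within {s..})"
        by (simp add: H_def algebra_simps)
    qed (rule t)
    then have "g t x u = exp (- cip u x) * exp (- I t)"
      using x by (simp add: g_0 I_def exp_minus field_simps)
    moreover have "I t = E + cip (integral {0..t} (\<lambda>s. R (\<psi> s u))) x"
    proof -
      have "((\<lambda>s. cip (R (\<psi> s u)) x) has_integral cip (integral {0..t} (\<lambda>s. R (\<psi> s u))) x) {0..t}"
        using has_integral_linear[OF integrable_integral[OF int(2)] cip.bounded_linear_left[of x]] by (simp add: o_def)
      from has_integral_add[OF integrable_integral[OF int(1)] this]
      show ?thesis unfolding I_def H_def E_def by (rule integral_unique)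
    qed
    ultimately show ?thesis by (simp add: \<Psi>_def cip.add_left exp_add[symmetric] algebra_simps)
  qed
  show g0: "g t 0 u = exp (- integral {0..t} (\<lambda>s. F (\<psi> s u)))"
    using key[of 0] by (simp add: cip.zero_right E_def)
  have t0: "0 \<le> t" using t by simp
  have \<psi>tC: "\<psi> t u \<in> CSdp" by (rule \<psi>_CSdp[OF t0 u nz[OF t]])
  \<comment> \<open>Equality of exponentials at all multiples of \<open>x\<close> removes the
    ambiguity by multiples of 2 pi i.\<close>
  have "cip (\<psi> t u) x = cip \<Psi> x" if x: "x \<in> Sdp" for x
  proof (rule exp_ray_inj[OF Re_cip_nonneg[OF \<psi>tC x]])
    fix s :: real assume s: "0 \<le> s"
    have "exp (- cip (\<psi> t u) (s *\<^sub>R x)) = exp (- cip \<Psi> (s *\<^sub>R x))"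
      using key[OF Sdp_scaleR[OF x s]] g_eq_\<psi>[OF t0 u nz[OF t] Sdp_scaleR[OF x s]] g0 by (simp add: E_def)
    then show "exp (- (s *\<^sub>R cip (\<psi> t u) x)) = exp (- (s *\<^sub>R cip \<Psi> x))" by (simp add: cip.scaleR_right)
  qed
  moreover have "\<Psi> $ i $ j = \<Psi> $ j $ i" for i j
  proof -
    have "integral {0..t} (\<lambda>s. R (\<psi> s u)) $ i $ j = integral {0..t} (\<lambda>s. R (\<psi> s u)) $ j $ i"
    proof (rule CSdp_integral_sym[OF int(2)], rule R_sym, rule CSdp_sym)
      show "\<psi> s u \<in> CSdp" if "s \<in> {0..t}" for s
        by (rule \<psi>_CSdp[OF _ u nz]) (use that t in auto)
    qed
    then show ?thesis using CSdp_sym[OF uC, of i j] by (simp add: \<Psi>_def)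
  qed
  ultimately show "\<psi> t u = u + integral {0..t} (\<lambda>s. R (\<psi> s u))"
    unfolding \<Psi>_def[symmetric] using CSdp_sym[OF \<psi>tC] by (intro cip_eqI) auto
qed

text \<open>Gronwall for one plus the energy. \<open>M\<close> depends on \<open>r\<close> and
  \<open>T\<close> but not on the interval up to \<open>T'\<close> on which the transform is known
  to be nonzero; this uniformity allows an approach to a possible first zero.\<close>

lemma \<psi>_bound:
  assumes \<alpha>: "invertible \<alpha> \<or> \<alpha> = 0"
  obtains M where "\<And>u t T'. interior_arg u \<Longrightarrow> norm u \<le> r \<Longrightarrow> T' \<le> T \<Longrightarrow>
    (\<And>t. t \<in> {0..T'} \<Longrightarrow> g t 0 u \<noteq> 0) \<Longrightarrow> t \<in> {0..T'} \<Longrightarrow> norm (\<psi> t u) \<le> M"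
proof -
  obtain a C where C: "C \<ge> 0" "\<And>u. u \<in> CSdp \<Longrightarrow> 2 * energy a (R u) u \<le> C * (1 + energy a u u)"
    "\<And>u. u \<in> CSdp \<Longrightarrow> (norm u)\<^sup>2 \<le> C * energy a u u"
    by (rule riccati_energy_estimate[OF \<alpha>]) (rule that)
  obtain k where k: "k > 0" "\<And>x y. norm (energy a x y) \<le> norm x * norm y * k"
    using bounded_bilinear.pos_bounded[OF bilinear_energy[of a]] by blast
  define M where "M = sqrt (C * ((1 + r * r * k) * exp (C * T)))"
  have "norm (\<psi> t u) \<le> M"
    if u: "interior_arg u" and r: "norm u \<le> r" and T': "T' \<le> T"
      and nz: "\<And>t. t \<in> {0..T'} \<Longrightarrow> g t 0 u \<noteq> 0" and t: "t \<in> {0..T'}" for u t T'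
  proof -
    have \<psi>C: "\<psi> s u \<in> CSdp" if "s \<in> {0..T'}" for s using \<psi>_CSdp[OF _ u nz] that by auto
    note cont = continuous_on_F_\<psi>[OF u nz]
    have int: "\<psi> s u = u + integral {0..s} (\<lambda>s. R (\<psi> s u))" if "s \<in> {0..T'}" for s
      using riccati_integral_interior(2)[OF u nz that] .
    have \<psi>': "((\<lambda>s. \<psi> s u) has_vector_derivative R (\<psi> s u)) (at s within {0..T'})" if s: "s \<in> {0..T'}" for s
    proof -
      have "((\<lambda>s. u + integral {0..s} (\<lambda>s. R (\<psi> s u))) has_vector_derivative 0 + R (\<psi> s u)) (at s within {0..T'})"
        by (intro has_vector_derivative_add has_vector_derivative_const integral_has_vector_derivative cont s)
      then have "((\<lambda>s. u + integral {0..s} (\<lambda>s. R (\<psi> s u))) has_vector_derivative R (\<psi> s u)) (at s within {0..T'})"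
        by simp
      then show ?thesis
        by (rule has_vector_derivative_transform[rotated 2]) (use s int in auto)
    qed
    define f where "f s = 1 + energy a (\<psi> s u) (\<psi> s u)" for s
    have f': "(f has_real_derivative 2 * energy a (R (\<psi> s u)) (\<psi> s u)) (at s within {0..T'})" if s: "s \<in> {0..T'}" for s
    proof -
      have "((\<lambda>s. energy a (\<psi> s u) (\<psi> s u)) has_vector_derivative
          energy a (\<psi> s u) (R (\<psi> s u)) + energy a (R (\<psi> s u)) (\<psi> s u)) (at s within {0..T'})"
        by (rule bounded_bilinear.has_vector_derivative[OF bilinear_energy \<psi>'[OF s] \<psi>'[OF s]])
      then have "(f has_vector_derivative 0 + (energy a (\<psi> s u) (R (\<psi> s u)) + energy a (R (\<psi> s u)) (\<psi> s u))) (at s within {0..T'})"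
        unfolding f_def by (intro has_vector_derivative_add has_vector_derivative_const)
      then show ?thesis
        by (simp add: energy_commute[of a "\<psi> s u"] has_real_derivative_iff_has_vector_derivative)
    qed
    have "f t \<le> f 0 * exp (C * t)"
      by (rule exponential_growth_bound[OF f' _ t]) (use C(2) \<psi>C in \<open>auto simp: f_def\<close>)
    also have "\<dots> \<le> (1 + r * r * k) * exp (C * T)"
    proof (rule mult_mono)
      have "energy a u u \<le> norm u * norm u * k" using k(2)[of u u] by simp
      also have "\<dots> \<le> r * r * k"
        using r k(1) order_trans[OF norm_ge_zero r] by (intro mult_right_mono mult_mono) auto
      finally show "f 0 \<le> 1 + r * r * k" using int[of 0] t by (simp add: f_def)
      show "0 \<le> 1 + r * r * k" using k(1) by simp
      show "exp (C * t) \<le> exp (C * T)" using C(1) t T' by (simp add: mult_left_mono)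
    qed simp
    finally have "energy a (\<psi> t u) (\<psi> t u) \<le> (1 + r * r * k) * exp (C * T)" by (simp add: f_def)
    then have "(norm (\<psi> t u))\<^sup>2 \<le> C * ((1 + r * r * k) * exp (C * T))"
      using order_trans[OF C(3)[OF \<psi>C[OF t]] mult_left_mono[OF _ C(1)]] by blast
    then show ?thesis unfolding M_def by (rule real_le_rsqrt)
  qed
  then show ?thesis by (rule that)
qed

text \<open>As long as the transform is nonzero it is the exponential of minus an integral of
  \<open>F\<close>, which stays bounded with the exponent; this yields the lower bound \<kappa>. At
  a first zero the bound would contradict continuity, so there is none.\<close>

lemma g_lower_bound:
  assumes \<alpha>: "invertible \<alpha> \<or> \<alpha> = 0"
  obtains \<kappa> M where "\<kappa> > 0" "\<And>u t. interior_arg u \<Longrightarrow> norm u \<le> r \<Longrightarrow> t \<in> {0..T} \<Longrightarrow>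
    \<kappa> \<le> norm (g t 0 u) \<and> norm (\<psi> t u) \<le> M"
proof -
  obtain M where M: "\<And>u t T'. interior_arg u \<Longrightarrow> norm u \<le> r \<Longrightarrow> T' \<le> T \<Longrightarrow>
    (\<And>t. t \<in> {0..T'} \<Longrightarrow> g t 0 u \<noteq> 0) \<Longrightarrow> t \<in> {0..T'} \<Longrightarrow> norm (\<psi> t u) \<le> M"
    by (rule \<psi>_bound[OF \<alpha>, of r T]) blast
  obtain K where K: "K \<ge> 0" "\<And>u. u \<in> CSdp \<Longrightarrow> norm (F u) \<le> K * (1 + norm u)" using F_growth by blast
  \<comment> \<open>\<open>M\<close> carries no sign, hence the absolute value.\<close>
  define \<kappa> where "\<kappa> = exp (- (K * (1 + \<bar>M\<bar>) * T))"
  have lower: "\<kappa> \<le> norm (g t 0 u)"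
    if u: "interior_arg u" "norm u \<le> r" and T': "T' \<le> T" and nz: "\<And>t. t \<in> {0..T'} \<Longrightarrow> g t 0 u \<noteq> 0"
      and t: "t \<in> {0..T'}" for u t T'
  proof -
    have "norm (integral {0..t} (\<lambda>s. F (\<psi> s u))) \<le> K * (1 + \<bar>M\<bar>) * (t - 0)"
    proof (rule integral_bound)
      show "continuous_on {0..t} (\<lambda>s. F (\<psi> s u))"
        by (rule continuous_on_subset[OF continuous_on_F_\<psi>(1)[OF u(1) nz]]) (use t in auto)
      fix s assume s: "s \<in> {0..t}"
      then have s': "s \<in> {0..T'}" using t by auto
      have "norm (F (\<psi> s u)) \<le> K * (1 + norm (\<psi> s u))"
        by (rule K(2)[OF \<psi>_CSdp[OF _ u(1) nz[OF s']]]) (use s in simp)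
      also have "\<dots> \<le> K * (1 + \<bar>M\<bar>)"
        using M[OF u T' nz s'] K(1) by (intro mult_left_mono) auto
      finally show "norm (F (\<psi> s u)) \<le> K * (1 + \<bar>M\<bar>)" .
    qed (use t in simp)
    also have "\<dots> \<le> K * (1 + \<bar>M\<bar>) * T" using t T' K(1) by (intro mult_left_mono) auto
    finally have "Re (integral {0..t} (\<lambda>s. F (\<psi> s u))) \<le> K * (1 + \<bar>M\<bar>) * T"
      using complex_Re_le_cmod order_trans by blast
    moreover have "norm (g t 0 u) = exp (- Re (integral {0..t} (\<lambda>s. F (\<psi> s u))))"
      using arg_cong[OF riccati_integral_interior(1)[OF u(1) nz t], of norm] by simp
    ultimately show ?thesis unfolding \<kappa>_def by simp
  qed
  have nonzero: "g t 0 u \<noteq> 0" if u: "interior_arg u" "norm u \<le> r" and t: "t \<in> {0..T}" for u t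
  proof
    assume z: "g t 0 u = 0"
    have uC: "u \<in> CSdp" by (rule interior_arg_CSdp[OF u(1)])
    have gc: "continuous_on {0..} (\<lambda>t. g t 0 u)" by (rule continuous_on_g[OF zero_Sdp uC])
    define Z where "Z = {s \<in> {0..}. g s 0 u = 0}"
    have "closed Z"
      unfolding Z_def by (rule continuous_closed_preimage_constant[OF gc closed_atLeast])
    moreover have "t \<in> Z" using z t by (simp add: Z_def)
    moreover have bdd: "bdd_below Z" by (rule bdd_belowI[of _ 0]) (simp add: Z_def)
    ultimately have inf: "Inf Z \<in> Z" using closed_contains_Inf by blast
    define \<tau> where "\<tau> = Inf Z"
    have \<tau>: "g \<tau> 0 u = 0" "0 \<le> \<tau>" "\<tau> \<le> t" using inf cInf_lower[OF \<open>t \<in> Z\<close> bdd] by (auto simp: \<tau>_def Z_def)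
    have "\<tau> \<noteq> 0" using \<tau>(1) g_0_0[of u] by auto
    then have \<tau>_pos: "0 < \<tau>" using \<tau>(2) by simp
    have nz: "g s 0 u \<noteq> 0" if "0 \<le> s" "s < \<tau>" for s
      using cInf_lower[OF _ bdd, of s] that by (auto simp: \<tau>_def Z_def)
    have "\<kappa> \<le> norm (g s 0 u)" if "0 \<le> s" "s < \<tau>" for s
      by (rule lower[OF u, of s s]) (use that nz \<tau> t in auto)
    \<comment> \<open>Times increasing to the first zero, all strictly before it.\<close>
    then have "\<kappa> \<le> norm (g (\<tau> - \<tau> / real (Suc n)) 0 u)" for n
      using \<tau>_pos by (simp add: field_simps)
    moreover have "(\<lambda>n. norm (g (\<tau> - \<tau> / real (Suc n)) 0 u)) \<longlonglongrightarrow> norm (g \<tau> 0 u)"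
    proof (intro tendsto_norm continuous_on_tendsto_compose[OF gc])
      have "(\<lambda>n. \<tau> - \<tau> * inverse (real (Suc n))) \<longlonglongrightarrow> \<tau> - \<tau> * 0"
        by (intro tendsto_intros LIMSEQ_inverse_real_of_nat)
      then show "(\<lambda>n. \<tau> - \<tau> / real (Suc n)) \<longlonglongrightarrow> \<tau>" by (simp add: divide_inverse)
      show "\<forall>\<^sub>F n in sequentially. \<tau> - \<tau> / real (Suc n) \<in> {0..}"
        using \<tau>_pos by (intro always_eventually) (simp add: field_simps)
    qed (use \<tau> in simp)
    ultimately have "\<kappa> \<le> norm (g \<tau> 0 u)" by (intro LIMSEQ_le_const) auto
    then show False using \<tau>(1) by (simp add: \<kappa>_def)
  qed
  have "\<kappa> \<le> norm (g t 0 u) \<and> norm (\<psi> t u) \<le> M" if u: "interior_arg u" "norm u \<le> r" and t: "t \<in> {0..T}" for u t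
    using lower[OF u order_refl nonzero[OF u] t] M[OF u order_refl nonzero[OF u] t] by blast
  then show ?thesis by (intro that[of \<kappa> M]) (auto simp: \<kappa>_def)
qed

section \<open>Extension to the boundary of the argument domain\<close>

definition approx :: "complex^'d^'d \<Rightarrow> nat \<Rightarrow> complex^'d^'d" where
  "approx u n = u + inverse (real (Suc n)) *\<^sub>R cmat (mat 1)"

lemma approx_interior: "u \<in> CSdp \<Longrightarrow> interior_arg (approx u n)"
proof -
  assume u: "u \<in> CSdp"
  have "inverse (real (Suc n)) *\<^sub>R (mat 1 :: real^'d^'d) = mat (inverse (real (Suc n)))"
    by (simp add: vec_eq_iff mat_def)
  then have "inverse (real (Suc n)) *\<^sub>R mat 1 + re_mat u \<in> Spp"
    using mat_Spp[of "inverse (real (Suc n))"] u by (intro Spp_Sdp_add) (auto simp: CSdp_iff)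
  then show ?thesis using u by (simp add: interior_arg_def approx_def CSdp_iff add.commute)
qed

lemma approx_tendsto: "approx u \<longlonglongrightarrow> u"
proof -
  have "(\<lambda>n. u + inverse (real (Suc n)) *\<^sub>R cmat (mat 1)) \<longlonglongrightarrow> u + 0 *\<^sub>R cmat (mat 1)"
    by (intro tendsto_intros LIMSEQ_inverse_real_of_nat)
  then show ?thesis by (simp add: approx_def[abs_def])
qed

lemma norm_approx_le: "norm (approx u n) \<le> norm u + norm (cmat (mat 1) :: complex^'d^'d)"
proof -
  have "norm (approx u n) \<le> norm u + inverse (real (Suc n)) * norm (cmat (mat 1) :: complex^'d^'d)"
    unfolding approx_def by (rule order_trans[OF norm_triangle_ineq]) simp
  also have "\<dots> \<le> norm u + 1 * norm (cmat (mat 1) :: complex^'d^'d)"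
    by (intro add_left_mono mult_right_mono) (auto simp: field_simps)
  finally show ?thesis by simp
qed

text \<open>The uniform bound gives a cluster point of the exponents, and the exponential identity
  passes to it. That identity determines the limit, so the whole sequence converges; the lower bound
  on the transforms keeps the limit nonzero.\<close>

lemma exponent_limit:
  assumes \<alpha>: "invertible \<alpha> \<or> \<alpha> = 0" and u: "u \<in> CSdp" and t: "0 \<le> t"
  shows "g t 0 u \<noteq> 0 \<and> (\<exists>M\<in>CSdp. (\<lambda>n. \<psi> t (approx u n)) \<longlonglongrightarrow> M \<and> (\<forall>x\<in>Sdp. g t x u = g t 0 u * exp (- cip M x)))"
proof -
  obtain \<kappa> M where \<kappa>: "\<kappa> > 0" "\<And>v s. interior_arg v \<Longrightarrow> norm v \<le> norm u + norm (cmat (mat 1) :: complex^'d^'d) \<Longrightarrow> s \<in> {0..t} \<Longrightarrow>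
    \<kappa> \<le> norm (g s 0 v) \<and> norm (\<psi> s v) \<le> M"
    by (rule g_lower_bound[OF \<alpha>, of "norm u + norm (cmat (mat 1) :: complex^'d^'d)" t]) blast
  have \<kappa>n: "\<kappa> \<le> norm (g t 0 (approx u n))" "norm (\<psi> t (approx u n)) \<le> M" for n
    using \<kappa>(2)[OF approx_interior[OF u] norm_approx_le, of t n] t by auto
  have glim: "(\<lambda>n. g t x (approx u n)) \<longlonglongrightarrow> g t x u" if "x \<in> Sdp" for x
    by (rule tendsto_g_param[OF t that interior_arg_CSdp[OF approx_interior[OF u]] approx_tendsto])
  have "\<kappa> \<le> norm (g t 0 u)"
    by (rule LIMSEQ_le_const[OF tendsto_norm[OF glim[OF zero_Sdp]]]) (use \<kappa>n in auto)
  then have nz: "g t 0 u \<noteq> 0" using \<kappa>(1) by auto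
  have nzn: "g t 0 (approx u n) \<noteq> 0" for n using \<kappa>n(1)[of n] \<kappa>(1) by auto
  have \<psi>C: "\<psi> t (approx u n) \<in> CSdp" for n by (rule \<psi>_CSdp[OF t approx_interior[OF u] nzn])
  have "bounded (range (\<lambda>n. \<psi> t (approx u n)))" using \<kappa>n(2) by (auto simp: bounded_iff)
  then obtain l \<sigma> where l: "strict_mono \<sigma>" "((\<lambda>n. \<psi> t (approx u n)) \<circ> \<sigma>) \<longlonglongrightarrow> l"
    using bounded_imp_convergent_subsequence by blast
  have lC: "l \<in> CSdp"
    by (rule closed_sequentially[OF closed_CSdp _ l(2)]) (simp add: \<psi>C)
  have gn: "g t x (approx u n) = g t 0 (approx u n) * exp (- cip (\<psi> t (approx u n)) x)" if "x \<in> Sdp" for x n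
    by (rule g_eq_\<psi>[OF t approx_interior[OF u] nzn that])
  have gl: "g t x u = g t 0 u * exp (- cip l x)" if x: "x \<in> Sdp" for x
  proof (rule LIMSEQ_unique)
    show "(\<lambda>n. g t x (approx u (\<sigma> n))) \<longlonglongrightarrow> g t x u"
      using LIMSEQ_subseq_LIMSEQ[OF glim[OF x] l(1)] by (simp add: o_def)
    have "(\<lambda>n. g t 0 (approx u (\<sigma> n)) * exp (- cip (\<psi> t (approx u (\<sigma> n))) x)) \<longlonglongrightarrow> g t 0 u * exp (- cip l x)"
      using LIMSEQ_subseq_LIMSEQ[OF glim[OF zero_Sdp] l(1)] l(2)
      by (intro tendsto_intros cip.tendsto) (auto simp: o_def)
    then show "(\<lambda>n. g t x (approx u (\<sigma> n))) \<longlonglongrightarrow> g t 0 u * exp (- cip l x)" unfolding gn[OF x] .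
  qed
  have "(\<lambda>n. \<psi> t (approx u n)) \<longlonglongrightarrow> l"
  proof (rule tendsto_exponent[OF \<psi>C lC])
    fix x :: "real^'d^'d" assume x: "x \<in> Sdp"
    have "(\<lambda>n. g t x (approx u n) / g t 0 (approx u n)) \<longlonglongrightarrow> g t x u / g t 0 u"
      by (intro tendsto_intros glim x zero_Sdp nz)
    moreover have "g t x (approx u n) / g t 0 (approx u n) = exp (- cip (\<psi> t (approx u n)) x)" for n
      using nzn[of n] by (subst gn[OF x]) simp
    moreover have "g t x u / g t 0 u = exp (- cip l x)" using nz by (subst gl[OF x]) simp
    ultimately show "(\<lambda>n. exp (- cip (\<psi> t (approx u n)) x)) \<longlonglongrightarrow> exp (- cip l x)" by simp
  qed
  then show ?thesis using nz lC gl by blast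
qed

text \<open>The integral equations of the approximations pass to the limit by dominated convergence,
  and continuity of the limit turns them back into differential equations. The scalar exponent is
  defined as an integral, so no logarithm of the transform has to be chosen.\<close>

lemma riccati_solution:
  assumes \<alpha>: "invertible \<alpha> \<or> \<alpha> = 0" and u: "u \<in> CSdp"
  shows "\<exists>\<Phi> \<Psi>. (\<forall>t\<ge>0. 0 \<le> Re (\<Phi> t) \<and> \<Psi> t \<in> CSdp) \<and> \<Phi> 0 = 0 \<and> \<Psi> 0 = u \<and>
    (\<forall>t\<ge>0. (\<Phi> has_vector_derivative F (\<Psi> t)) (at t within {0..}) \<and>
            (\<Psi> has_vector_derivative R (\<Psi> t)) (at t within {0..})) \<and>
    (\<forall>t\<ge>0. \<forall>x\<in>Sdp. g t x u = exp (- \<Phi> t - cip (\<Psi> t) x))"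
proof -
  have "\<exists>M. \<forall>t\<ge>0. M t \<in> CSdp \<and> (\<lambda>n. \<psi> t (approx u n)) \<longlonglongrightarrow> M t \<and> (\<forall>x\<in>Sdp. g t x u = g t 0 u * exp (- cip (M t) x))"
    using exponent_limit[OF \<alpha> u] by (intro choice allI) blast
  then obtain \<Psi> where \<Psi>: "\<And>t. 0 \<le> t \<Longrightarrow> \<Psi> t \<in> CSdp" "\<And>t. 0 \<le> t \<Longrightarrow> (\<lambda>n. \<psi> t (approx u n)) \<longlonglongrightarrow> \<Psi> t"
    "\<And>t x. 0 \<le> t \<Longrightarrow> x \<in> Sdp \<Longrightarrow> g t x u = g t 0 u * exp (- cip (\<Psi> t) x)" by blast
  define \<Phi> where "\<Phi> t = integral {0..t} (\<lambda>s. F (\<Psi> s))" for t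
  \<comment> \<open>Stated for an arbitrary continuous \<open>h\<close>, to be used with both
    \<open>F\<close> and \<open>R\<close>.\<close>
  have lim: "(\<lambda>s. h (\<Psi> s)) integrable_on {0..t}
      \<and> (\<lambda>n. integral {0..t} (\<lambda>s. h (\<psi> s (approx u n)))) \<longlonglongrightarrow> integral {0..t} (\<lambda>s. h (\<Psi> s))"
    if t: "0 \<le> t" and h: "continuous_on CSdp h" for t and h :: "complex^'d^'d \<Rightarrow> 'z::euclidean_space"
  proof -
    obtain \<kappa> M where \<kappa>: "\<kappa> > 0" "\<And>v s. interior_arg v \<Longrightarrow> norm v \<le> norm u + norm (cmat (mat 1) :: complex^'d^'d) \<Longrightarrow> s \<in> {0..t} \<Longrightarrow>
      \<kappa> \<le> norm (g s 0 v) \<and> norm (\<psi> s v) \<le> M"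
      by (rule g_lower_bound[OF \<alpha>, of "norm u + norm (cmat (mat 1) :: complex^'d^'d)" t]) blast
    have \<kappa>n: "\<kappa> \<le> norm (g s 0 (approx u n))" "norm (\<psi> s (approx u n)) \<le> M" if "s \<in> {0..t}" for n s
      using \<kappa>(2)[OF approx_interior[OF u] norm_approx_le that] by auto
    have nz: "g s 0 (approx u n) \<noteq> 0" if "s \<in> {0..t}" for n s using \<kappa>n(1)[OF that, of n] \<kappa>(1) by auto
    have \<psi>C: "\<psi> s (approx u n) \<in> CSdp" if "s \<in> {0..t}" for n s
      using \<psi>_CSdp[OF _ approx_interior[OF u] nz[OF that]] that by auto
    \<comment> \<open>All approximating exponents up to time \<open>t\<close> lie in this compact
      set, on which \<open>h\<close> is bounded; this gives the dominating constant.\<close>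
    have "compact (CSdp \<inter> cball 0 M :: (complex^'d^'d) set)" by (intro closed_Int_compact closed_CSdp compact_cball)
    then have "compact (h ` (CSdp \<inter> cball 0 M))"
      by (intro compact_continuous_image continuous_on_subset[OF h]) auto
    then have "bounded (h ` (CSdp \<inter> cball 0 M))" by (rule compact_imp_bounded)
    then obtain D where D: "\<And>v. v \<in> CSdp \<inter> cball 0 M \<Longrightarrow> norm (h v) \<le> D"
      unfolding bounded_iff by fast
    have int: "(\<lambda>s. h (\<psi> s (approx u n))) integrable_on {0..t}" for n
    proof (rule integrable_continuous_real)
      have "continuous_on {0..t} (\<lambda>s. \<psi> s (approx u n))"
        by (rule continuous_on_\<psi>[OF approx_interior[OF u] nz]) auto
      then show "continuous_on {0..t} (\<lambda>s. h (\<psi> s (approx u n)))"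
        by (rule continuous_on_compose2[OF h]) (use \<psi>C in auto)
    qed
    have bd: "norm (h (\<psi> s (approx u n))) \<le> D" if "s \<in> {0..t}" for n s
      by (rule D) (use \<psi>C[OF that] \<kappa>n(2)[OF that] in auto)
    have conv: "(\<lambda>n. h (\<psi> s (approx u n))) \<longlonglongrightarrow> h (\<Psi> s)" if s: "s \<in> {0..t}" for s
      using s \<psi>C[OF s] \<Psi>(1,2)[of s] by (intro continuous_on_tendsto_compose[OF h]) auto
    have const: "(\<lambda>_. D) integrable_on {0..t}" by (intro integrable_continuous_real continuous_intros)
    show ?thesis by (rule conjI[OF dominated_convergence[OF int const bd conv]])
  qed
  have nz: "g t 0 (approx u n) \<noteq> 0" if "0 \<le> t" for t n
    using exponent_limit[OF \<alpha> interior_arg_CSdp[OF approx_interior[OF u]] that] by blast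
  have \<Psi>_int: "\<Psi> t = u + integral {0..t} (\<lambda>s. R (\<Psi> s))" if t: "0 \<le> t" for t
  proof (rule LIMSEQ_unique[OF \<Psi>(2)[OF t]])
    have "(\<lambda>n. approx u n + integral {0..t} (\<lambda>s. R (\<psi> s (approx u n)))) \<longlonglongrightarrow> u + integral {0..t} (\<lambda>s. R (\<Psi> s))"
      using lim[OF t continuous_on_R] by (intro tendsto_add approx_tendsto) blast
    then show "(\<lambda>n. \<psi> t (approx u n)) \<longlonglongrightarrow> u + integral {0..t} (\<lambda>s. R (\<Psi> s))"
      by (subst riccati_integral_interior(2)[OF approx_interior[OF u], of t]) (use nz t in auto)
  qed
  have g0: "g t 0 u = exp (- \<Phi> t)" if t: "0 \<le> t" for t
  proof (rule LIMSEQ_unique)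
    show "(\<lambda>n. g t 0 (approx u n)) \<longlonglongrightarrow> g t 0 u"
      by (rule tendsto_g_param[OF t zero_Sdp interior_arg_CSdp[OF approx_interior[OF u]] approx_tendsto])
    have "(\<lambda>n. exp (- integral {0..t} (\<lambda>s. F (\<psi> s (approx u n))))) \<longlonglongrightarrow> exp (- \<Phi> t)"
      unfolding \<Phi>_def using lim[OF t continuous_on_F] by (intro tendsto_intros) blast
    then show "(\<lambda>n. g t 0 (approx u n)) \<longlonglongrightarrow> exp (- \<Phi> t)"
      by (subst riccati_integral_interior(1)[OF approx_interior[OF u], of t]) (use nz t in auto)
  qed
  \<comment> \<open>A pointwise limit need not be continuous; continuity is drawn from the integral
    equation instead.\<close>
  have \<Psi>_cont: "continuous_on {0..} \<Psi>"
  proof -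
    have cont: "continuous_on {0..T} \<Psi>" if T: "0 \<le> T" for T
    proof -
      have "(\<lambda>s. R (\<Psi> s)) integrable_on {0..T}" using lim[OF T continuous_on_R] by blast
      then have "continuous_on {0..T} (\<lambda>t. u + integral {0..t} (\<lambda>s. R (\<Psi> s)))"
        by (intro continuous_intros indefinite_integral_continuous_1)
      then show ?thesis by (rule continuous_on_eq) (use \<Psi>_int in auto)
    qed
    show ?thesis
      unfolding continuous_on_eq_continuous_within
    proof
      fix t :: real assume t: "t \<in> {0..}"
      have "continuous_on {0..t+1} \<Psi>" using cont[of "t + 1"] t by simp
      then have "continuous (at t within {0..t+1}) \<Psi>"
        using t by (simp add: continuous_on_eq_continuous_within)
      moreover have "at t within {0..t+1} = at t within {0..}"
        by (rule at_within_nhd[of _ "{..<t+1}"]) auto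
      ultimately show "continuous (at t within {0..}) \<Psi>" by simp
    qed
  qed
  have \<Psi>_image: "\<Psi> ` {0..} \<subseteq> CSdp" using \<Psi>(1) by auto
  have d1: "(\<Phi> has_vector_derivative F (\<Psi> t)) (at t within {0..})" if t: "0 \<le> t" for t
    unfolding \<Phi>_def
    by (rule integral_vector_derivative_Ici[OF continuous_on_compose2[OF continuous_on_F \<Psi>_cont \<Psi>_image] t])
  have d2: "(\<Psi> has_vector_derivative R (\<Psi> t)) (at t within {0..})" if t: "0 \<le> t" for t
  proof -
    have "((\<lambda>t. u + integral {0..t} (\<lambda>s. R (\<Psi> s))) has_vector_derivative 0 + R (\<Psi> t)) (at t within {0..})"
      by (intro has_vector_derivative_add has_vector_derivative_const
          integral_vector_derivative_Ici[OF continuous_on_compose2[OF continuous_on_R \<Psi>_cont \<Psi>_image] t])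
    then have "((\<lambda>t. u + integral {0..t} (\<lambda>s. R (\<Psi> s))) has_vector_derivative R (\<Psi> t)) (at t within {0..})" by simp
    then show ?thesis
      by (rule has_vector_derivative_transform[rotated 2]) (use t \<Psi>_int in auto)
  qed
  have re: "0 \<le> Re (\<Phi> t)" if t: "0 \<le> t" for t
    using norm_g_le_1[OF t zero_Sdp u] unfolding g0[OF t] by simp
  have init: "\<Phi> 0 = 0" "\<Psi> 0 = u" using \<Psi>_int[of 0] by (simp_all add: \<Phi>_def)
  have gg: "g t x u = exp (- \<Phi> t - cip (\<Psi> t) x)" if "0 \<le> t" "x \<in> Sdp" for t x
    using \<Psi>(3)[OF that] unfolding g0[OF that(1)] by (simp add: exp_add[symmetric])
  show ?thesis
  proof (rule exI[of _ \<Phi>], rule exI[of _ \<Psi>], intro conjI)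
    show "\<forall>t\<ge>0. 0 \<le> Re (\<Phi> t) \<and> \<Psi> t \<in> CSdp" using re \<Psi>(1) by simp
    show "\<forall>t\<ge>0. (\<Phi> has_vector_derivative F (\<Psi> t)) (at t within {0..}) \<and>
            (\<Psi> has_vector_derivative R (\<Psi> t)) (at t within {0..})" using d1 d2 by simp
    show "\<forall>t\<ge>0. \<forall>x\<in>Sdp. g t x u = exp (- \<Phi> t - cip (\<Psi> t) x)" using gg by (intro allI impI ballI)
  qed (rule init)+
qed

end

theorem theorem4p2:
  fixes p :: "real \<Rightarrow> real^'d^'d \<Rightarrow> (real^'d^'d) measure"
    and \<alpha> b \<gamma> :: "real^'d^'d" and B :: "real^'d^'d \<Rightarrow> real^'d^'d" and c :: real
    and m :: "(real^'d^'d) measure" and \<mu> :: "(real^'d^'d) set \<Rightarrow> real^'d^'d"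
  assumes "CARD('d) \<ge> 2"
    and "affine_transition p"
    and "admissible \<alpha> b B c \<gamma> m \<mu>"
    and "has_generator p (gen_A \<alpha> b B c \<gamma> m \<mu>)"
    and "invertible \<alpha> \<or> \<alpha> = 0"
  shows "\<exists>(\<phi> :: real \<Rightarrow> complex^'d^'d \<Rightarrow> complex) (\<psi> :: real \<Rightarrow> complex^'d^'d \<Rightarrow> complex^'d^'d).
     (\<forall>t\<ge>0. \<forall>u\<in>CSdp. Re (\<phi> t u) \<ge> 0 \<and> \<psi> t u \<in> CSdp) \<and>
     (\<forall>u\<in>CSdp. \<phi> 0 u = 0 \<and> \<psi> 0 u = u \<and>
        (\<forall>t\<ge>0.
          ((\<lambda>s. \<phi> s u) has_vector_derivative
              (cip (\<psi> t u) b + complex_of_real c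
               - set_lebesgue_integral m (Sdp - {0}) (\<lambda>\<xi>. exp (- cip (\<psi> t u) \<xi>) - 1)))
            (at t within {0..}) \<and>
          ((\<lambda>s. \<psi> s u) has_vector_derivative
              (- 2 *\<^sub>R (\<psi> t u ** cmat \<alpha> ** \<psi> t u) + adj_c B (\<psi> t u) + cmat \<gamma>
               - mat_integral \<mu> (\<lambda>\<xi>. exp (- cip (\<psi> t u) \<xi>) - 1)))
            (at t within {0..}))) \<and>
     (\<forall>t\<ge>0. \<forall>x\<in>Sdp. \<forall>u\<in>CSdp.
        set_lebesgue_integral (p t x) Sdp (\<lambda>\<xi>. exp (- cip u \<xi>))
          = exp (- \<phi> t u - cip (\<psi> t u) x))"
proof -
  note transition = assms(2)[unfolded affine_transition_def]
  obtain \<phi>0 :: "real \<Rightarrow> real^'d^'d \<Rightarrow> real" and \<psi>0 :: "real \<Rightarrow> real^'d^'d \<Rightarrow> real^'d^'d" where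
    affine: "\<forall>t\<ge>0. \<forall>u\<in>Sdp. \<phi>0 t u \<ge> 0 \<and> \<psi>0 t u \<in> Sdp"
    "\<forall>t\<ge>0. \<forall>x\<in>Sdp. \<forall>u\<in>Sdp.
       set_lebesgue_integral (p t x) Sdp (\<lambda>\<xi>. exp (- ip u \<xi>)) = exp (- \<phi>0 t u - ip (\<psi>0 t u) x)"
    using transition by (elim conjE exE)
  interpret affine_kernel p \<phi>0 \<psi>0
  proof
    show "sets (p t x) = sets borel" "emeasure (p t x) UNIV \<le> 1" "emeasure (p t x) (UNIV - Sdp) = 0"
      if "0 \<le> t" "x \<in> Sdp" for t x using transition that by simp_all
    show "(\<lambda>x. emeasure (p t x) A) \<in> borel_measurable (restrict_space borel Sdp)" if "0 \<le> t" "A \<in> sets borel" for t A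
      using transition that by simp
    show "emeasure (p 0 x) A = indicator A x" if "x \<in> Sdp" "A \<in> sets borel" for x A using transition that by simp
    show "emeasure (p (s + t) x) A = (\<integral>\<^sup>+ y. emeasure (p t y) A * indicator Sdp y \<partial>(p s x))"
      if "0 \<le> s" "0 \<le> t" "x \<in> Sdp" "A \<in> sets borel" for s t x A using transition that by simp
    show "((\<lambda>t. set_lebesgue_integral (p t x) Sdp f) \<longlongrightarrow> set_lebesgue_integral (p s x) Sdp f) (at s within {0..})"
      if "x \<in> Sdp" "0 \<le> s" "continuous_on Sdp f" "bounded (f ` Sdp)" for x s and f :: "real^'d^'d \<Rightarrow> real"
      using transition that by simp
  qed (use affine in simp_all)
  interpret affine_generator p \<phi>0 \<psi>0 \<alpha> b \<gamma> B c m \<mu>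
    by unfold_locales (rule assms)+
  let ?Q = "\<lambda>u \<Phi> \<Psi>. (\<forall>t\<ge>0. 0 \<le> Re (\<Phi> t) \<and> \<Psi> t \<in> CSdp) \<and> \<Phi> 0 = 0 \<and> \<Psi> 0 = u \<and>
    (\<forall>t\<ge>0. (\<Phi> has_vector_derivative F (\<Psi> t)) (at t within {0..}) \<and>
            (\<Psi> has_vector_derivative R (\<Psi> t)) (at t within {0..})) \<and>
    (\<forall>t\<ge>0. \<forall>x\<in>Sdp. g t x u = exp (- \<Phi> t - cip (\<Psi> t) x))"
  have "\<forall>u\<in>CSdp. \<exists>\<Phi>. \<exists>\<Psi>. ?Q u \<Phi> \<Psi>"
    by (intro ballI riccati_solution assms(5))
  \<comment> \<open>Solutions are selected for each \<open>u\<close> separately; the conclusion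
    relates different \<open>u\<close> only through the transform formula.\<close>
  from bchoice[OF this] obtain \<Phi> where "\<forall>u\<in>CSdp. \<exists>\<Psi>. ?Q u (\<Phi> u) \<Psi>" ..
  from bchoice[OF this] obtain \<Psi> where Q: "\<forall>u\<in>CSdp. ?Q u (\<Phi> u) (\<Psi> u)" ..
  show ?thesis
    unfolding F_def[symmetric] R_def[symmetric] g_def[symmetric]
    by (rule exI[of _ "\<lambda>t u. \<Phi> u t"], rule exI[of _ "\<lambda>t u. \<Psi> u t"]) (use Q in simp)
qed

end
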